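(* Let $m\ge 1$, and let $M_{\mathbb Z}$, its coordinate ring $\mathbb Z[M_{\mathbb Z}]$, the element $d\in\mathbb Z[M_{\mathbb Z}]$, and rational tableaux and bideterminants be as defined in the context, with respect to a fixed linear order $\preceq$ on $\{1,\dots,m\}$. (i) Let $\lambda=[\lambda^1,\lambda^2]\in X^+$ be a dominant weight and let $S$ and $T$ be rational tableaux of shape $\lambda$. Then the bideterminant $(S\,|\,T)\in\mathbb Z[M_{\mathbb Z}]$ can be written as a (finite) linear combination $\sum_i a_i d^{t_i}(S_i\,|\,T_i)$, where the $a_i$ are integers, the $t_i$ are integers $\geq 0$, and $(S_i,T_i)$ is a standard rational bitableau of some shape $\mu_i=[\mu_i^1,\mu_i^2]\in X^+$ with $\mu_i\le\lambda$, with $(|\mu_i^1|,|\mu_i^2|)=(|\lambda^1|,|\lambda^2|)-(t_i,t_i)$, and with the same weight as $(S,T)$. (ii) The elements $d^t(S\,|\,T)$, with $t$ an integer $\ge 0$ and $(S,T)$ a rational bitableau with $S$ and $T$ standard, form a basis of the $\mathbb Z$-module $\mathbb Z[M_{\mathbb Z}]$.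
   Context: **The monoid scheme.** For a commutative ring $R$, $M(R)$ is the monoid of pairs $(A,B)$ of $m\times m$ matrices over $R$ with $A^TB=AB^T=d(A,B)I$ for some scalar $d(A,B)\in R$. The functor $M_{\mathbb Z}:R\mapsto M(R)$ is an affine $\mathbb Z$-scheme. With $x_{ij}$ (resp. $y_{ij}$) the entries of the first (resp. second) matrix, $\mathbb Z[M_{\mathbb Z}]$ is the quotient of the polynomial ring $\mathbb Z[x_{ij},y_{ij}:1\le i,j\le m]$ by the ideal generated by $h_{ij},\bar h_{ij}$ ($i\ne j$) and $h_{rr}-\bar h_{ss}$ ($1\le r,s\le m$), where $h_{ij}=\sum_{l=1}^m x_{li}y_{lj}$ and $\bar h_{ij}=\sum_{l=1}^m x_{il}y_{jl}$. The element $d\in\mathbb Z[M_{\mathbb Z}]$ is the function $(A,B)\mapsto d(A,B)$, i.e. the image of $h_{11}$. **Weights.** $X=\mathbb Z^m$ with standard basis $\varepsilon_i$; $X^+=\{\lambda\in\mathbb Z^m:\lambda_1\ge\cdots\ge\lambda_m\}$ (dominant weights); $|\lambda|=\sum_i\lambda_i$. $\mu\le\lambda$ means $|\mu|=|\lambda|$ and $\sum_{i=1}^j\mu_i\le\sum_{i=1}^j\lambda_i$ for all $j$ (dominance order, type $A_{m-1}$). The length $l(\lambda)$ of a partition is its number of nonzero parts. For $\lambda^1,\lambda^2\in\mathbb Z^m$ put $[\lambda^1,\lambda^2]:=\lambda^1-(\lambda^2)^{\rm rev}$, where $\rm rev$ reverses a tuple. Every $\lambda\in X^+$ is uniquely $[\lambda^1,\lambda^2]$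 with $\lambda^1,\lambda^2$ partitions satisfying $l(\lambda^1)+l(\lambda^2)\le m$; this is the meaning of $\lambda^1,\lambda^2$ for given $\lambda\in X^+$. **Tableaux.** A tableau of shape a partition $\lambda$ (length $\le m$) is a map from the Young diagram $\{(i,j):1\le j\le\lambda_i\}$ to $\{1,\dots,m\}$. It is standard if, with respect to $\preceq$, entries strictly increase down columns and weakly increase along rows from left to right. Its weight is the vector whose $i$-th component is the number of occurrences of $i$. A rational tableau of shape $(\lambda^1,\lambda^2)$ is a pair $T=(T^1,T^2)$ with $T^i$ a tableau of shape $\lambda^i$; its weight is (weight of $T^1$) $-$ (weight of $T^2$). If $\lambda=[\lambda^1,\lambda^2]$ with $l(\lambda^1)+l(\lambda^2)\le m$, a rational tableau of shape $(\lambda^1,\lambda^2)$ is said to have shape $\lambda$. A pair $(I^1,I^2)$ of subsets of $\{1,\dots,m\}$ is standard if $|\{i\in I^1:i\preceq j\}|+|\{i\in I^2:i\preceq j\}|\le\zeta(j):=|\{i:i\preceq j\}|$ for all $j\in\{1,\dots,m\}$. A rational tableau $(T^1,T^2)$ is standard if $T^1,T^2$ are standard and the pair of sets of entries of the first columns of $T^1$ and $T^2$ (possibly empty) is standard; then automatically $l(\lambda^1)+l(\lambda^2)\le m$. **Bideterminants.** A rational bitableau of shape $(\lambda^1,\lambda^2)$ is a pair $(S,T)$ of rational tableaux of that shape; it is standard if both $S$ and $T$ are; its weight is $(-\mu,\nu)$ with $\mu,\nu$ the weights of $S,T$. Its bideterminant is $(S\,|\,T)=(S^1\,|\,T^1)_1(S^2\,|\,T^2)_2$,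 where $(S^1\,|\,T^1)_1$ is the product over all columns $c$ of $\lambda^1$ of the minors $\det\big(x_{S^1(a,c)\,T^1(b,c)}\big)_{a,b}$ ($a,b$ from $1$ to the length of column $c$), and $(S^2\,|\,T^2)_2$ is defined in the same way from $S^2,T^2,\lambda^2$ and the $y_{ij}$. *)

theory Defs
  imports
    "HOL-Library.Poly_Mapping"
    "HOL-Algebra.QuotRing"
    "Jordan_Normal_Form.Determinant"
begin

section \<open>The coordinate ring\<close>

text \<open>\<open>VX i j\<close> and \<open>VY i j\<close> index the \<open>(i, j)\<close> entries of the first and the second matrix.
  A polynomial is a finitely supported function from monomials to integers, a monomial a finitely
  supported function from variables to exponents.\<close>

datatype var = VX nat nat | VY nat nat

type_synonym int_mpoly = "(var \<Rightarrow>\<^sub>0 nat) \<Rightarrow>\<^sub>0 int"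

definition mvar :: "var \<Rightarrow> int_mpoly"
  where "mvar v = Poly_Mapping.single (Poly_Mapping.single v 1) 1"

abbreviation x_var :: "nat \<Rightarrow> nat \<Rightarrow> int_mpoly"
  where "x_var i j \<equiv> mvar (VX i j)"

abbreviation y_var :: "nat \<Rightarrow> nat \<Rightarrow> int_mpoly"
  where "y_var i j \<equiv> mvar (VY i j)"

definition matrix_vars :: "nat \<Rightarrow> var set"
  where "matrix_vars m = {v. \<exists>i\<in>{1..m}. \<exists>j\<in>{1..m}. v = VX i j \<or> v = VY i j}"

text \<open>The type \<open>int_mpoly\<close> has infinitely many variables; the carrier keeps the polynomials
  that involve only the \<open>2 m\<^sup>2\<close> matrix entries.\<close>

definition poly_ring :: "nat \<Rightarrow> int_mpoly ring"
  where "poly_ring m =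
    \<lparr>carrier = {p. \<forall>u\<in>Poly_Mapping.keys p. Poly_Mapping.keys u \<subseteq> matrix_vars m},
     monoid.mult = (*), one = 1, zero = 0, add = (+)\<rparr>"

definition h :: "nat \<Rightarrow> nat \<Rightarrow> nat \<Rightarrow> int_mpoly"
  where "h m i j = (\<Sum>l=1..m. x_var l i * y_var l j)"

definition h_bar :: "nat \<Rightarrow> nat \<Rightarrow> nat \<Rightarrow> int_mpoly"
  where "h_bar m i j = (\<Sum>l=1..m. x_var i l * y_var j l)"

definition monoid_relations :: "nat \<Rightarrow> int_mpoly set"
  where "monoid_relations m =
    {h m i j | i j. i \<in> {1..m} \<and> j \<in> {1..m} \<and> i \<noteq> j} \<union>
    {h_bar m i j | i j. i \<in> {1..m} \<and> j \<in> {1..m} \<and> i \<noteq> j} \<union>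
    {h m r r - h_bar m s s | r s. r \<in> {1..m} \<and> s \<in> {1..m}}"

definition monoid_ideal :: "nat \<Rightarrow> int_mpoly set"
  where "monoid_ideal m = genideal (poly_ring m) (monoid_relations m)"

definition coord_ring :: "nat \<Rightarrow> int_mpoly set ring"
  where "coord_ring m = poly_ring m Quot monoid_ideal m"

definition coord_class :: "nat \<Rightarrow> int_mpoly \<Rightarrow> int_mpoly set"
  where "coord_class m p = monoid_ideal m +>\<^bsub>poly_ring m\<^esub> p"

definition d_elem :: "nat \<Rightarrow> int_mpoly set"
  where "d_elem m = coord_class m (h m 1 1)"

section \<open>Weights and partitions\<close>

text \<open>A weight is a list of length \<open>m\<close>; a partition of length at most \<open>m\<close> is a list padded with
  zeros to length exactly \<open>m\<close>, so that its representation is unique.\<close>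

definition dominant_weights :: "nat \<Rightarrow> int list set"
  where "dominant_weights m = {w. length w = m \<and> sorted_wrt (\<ge>) w}"

definition dominance_le :: "int list \<Rightarrow> int list \<Rightarrow> bool"
  where "dominance_le mu lam \<longleftrightarrow>
    sum_list mu = sum_list lam \<and>
    (\<forall>j\<in>{1..length lam}. sum_list (take j mu) \<le> sum_list (take j lam))"

definition partitions :: "nat \<Rightarrow> nat list set"
  where "partitions m = {p. length p = m \<and> sorted_wrt (\<ge>) p}"

definition part_length :: "nat list \<Rightarrow> nat"
  where "part_length p = card {i. i < length p \<and> p ! i \<noteq> 0}"

definition bracket :: "nat list \<Rightarrow> nat list \<Rightarrow> int list"
  where "bracket p q = map2 (-) (map int p) (rev (map int q))"

definition is_decomposition :: "nat \<Rightarrow> int list \<Rightarrow> nat list \<Rightarrow> nat list \<Rightarrow> bool"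
  where "is_decomposition m lam lam1 lam2 \<longleftrightarrow>
    lam1 \<in> partitions m \<and> lam2 \<in> partitions m \<and>
    part_length lam1 + part_length lam2 \<le> m \<and> lam = bracket lam1 lam2"

section \<open>Tableaux\<close>

text \<open>Tableaux are partial maps whose domain is the Young diagram, so a tableau determines its
  shape.\<close>

type_synonym tableau = "nat \<times> nat \<rightharpoonup> nat"
type_synonym rat_tableau = "tableau \<times> tableau"

definition young_diagram :: "nat list \<Rightarrow> (nat \<times> nat) set"
  where "young_diagram p = {(i, j). 1 \<le> i \<and> i \<le> length p \<and> 1 \<le> j \<and> j \<le> p ! (i - 1)}"

definition is_tableau :: "nat \<Rightarrow> nat list \<Rightarrow> tableau \<Rightarrow> bool"
  where "is_tableau m p T \<longleftrightarrow> dom T = young_diagram p \<and> ran T \<subseteq> {1..m}"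

abbreviation entry :: "tableau \<Rightarrow> nat \<Rightarrow> nat \<Rightarrow> nat"
  where "entry T i j \<equiv> the (T (i, j))"

text \<open>The order on the entries is a relation \<open>ord\<close>, with \<open>(i, j) \<in> ord\<close> for \<open>i \<preceq> j\<close>.\<close>

definition standard_tableau :: "nat rel \<Rightarrow> tableau \<Rightarrow> bool"
  where "standard_tableau ord T \<longleftrightarrow>
    (\<forall>i i' j. (i, j) \<in> dom T \<and> (i', j) \<in> dom T \<and> i < i' \<longrightarrow>
       (entry T i j, entry T i' j) \<in> ord \<and> entry T i j \<noteq> entry T i' j) \<and>
    (\<forall>i j j'. (i, j) \<in> dom T \<and> (i, j') \<in> dom T \<and> j < j' \<longrightarrow>
       (entry T i j, entry T i j') \<in> ord)"

definition tableau_weight :: "nat \<Rightarrow> tableau \<Rightarrow> int list"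
  where "tableau_weight m T = map (\<lambda>k. int (card {c. T c = Some k})) [1..<Suc m]"

definition is_rat_tableau :: "nat \<Rightarrow> nat list \<Rightarrow> nat list \<Rightarrow> rat_tableau \<Rightarrow> bool"
  where "is_rat_tableau m lam1 lam2 T \<longleftrightarrow>
    is_tableau m lam1 (fst T) \<and> is_tableau m lam2 (snd T)"

definition rat_weight :: "nat \<Rightarrow> rat_tableau \<Rightarrow> int list"
  where "rat_weight m T = map2 (-) (tableau_weight m (fst T)) (tableau_weight m (snd T))"

definition first_column :: "tableau \<Rightarrow> nat set"
  where "first_column T = {k. \<exists>i. T (i, 1) = Some k}"

definition standard_pair :: "nat \<Rightarrow> nat rel \<Rightarrow> nat set \<Rightarrow> nat set \<Rightarrow> bool"
  where "standard_pair m ord I1 I2 \<longleftrightarrow>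
    (\<forall>j\<in>{1..m}. card {i\<in>I1. (i, j) \<in> ord} + card {i\<in>I2. (i, j) \<in> ord}
       \<le> card {i\<in>{1..m}. (i, j) \<in> ord})"

definition standard_rat_tableau :: "nat \<Rightarrow> nat rel \<Rightarrow> rat_tableau \<Rightarrow> bool"
  where "standard_rat_tableau m ord T \<longleftrightarrow>
    standard_tableau ord (fst T) \<and> standard_tableau ord (snd T) \<and>
    standard_pair m ord (first_column (fst T)) (first_column (snd T))"

definition is_rat_bitableau ::
    "nat \<Rightarrow> nat list \<Rightarrow> nat list \<Rightarrow> rat_tableau \<times> rat_tableau \<Rightarrow> bool"
  where "is_rat_bitableau m lam1 lam2 ST \<longleftrightarrow>
    is_rat_tableau m lam1 lam2 (fst ST) \<and> is_rat_tableau m lam1 lam2 (snd ST)"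

definition standard_rat_bitableau :: "nat \<Rightarrow> nat rel \<Rightarrow> rat_tableau \<times> rat_tableau \<Rightarrow> bool"
  where "standard_rat_bitableau m ord ST \<longleftrightarrow>
    standard_rat_tableau m ord (fst ST) \<and> standard_rat_tableau m ord (snd ST)"

definition bitableau_weight :: "nat \<Rightarrow> rat_tableau \<times> rat_tableau \<Rightarrow> int list \<times> int list"
  where "bitableau_weight m ST = (map uminus (rat_weight m (fst ST)), rat_weight m (snd ST))"

section \<open>Bideterminants\<close>

definition column_length :: "tableau \<Rightarrow> nat \<Rightarrow> nat"
  where "column_length T c = card {a. (a, c) \<in> dom T}"

text \<open>Matrices are indexed from \<open>0\<close>, tableaux from \<open>1\<close>. \<open>S\<close> and \<open>T\<close> have the same domain in
  every use of the following definition.\<close>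

definition bidet_part :: "(nat \<Rightarrow> nat \<Rightarrow> int_mpoly) \<Rightarrow> tableau \<Rightarrow> tableau \<Rightarrow> int_mpoly"
  where "bidet_part z S T =
    (\<Prod>c\<in>snd ` dom S.
       det (mat (column_length S c) (column_length S c)
         (\<lambda>(a, b). z (entry S (Suc a) c) (entry T (Suc b) c))))"

definition bideterminant :: "nat \<Rightarrow> rat_tableau \<times> rat_tableau \<Rightarrow> int_mpoly set"
  where "bideterminant m ST =
    coord_class m (bidet_part x_var (fst (fst ST)) (fst (snd ST))) \<otimes>\<^bsub>coord_ring m\<^esub>
    coord_class m (bidet_part y_var (snd (fst ST)) (snd (snd ST)))"

section \<open>Bases of \<open>\<int>\<close>-modules\<close>

text \<open>The additive group of \<open>R\<close> as a \<open>\<int>\<close>-module. A basis is an indexed family, so independence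
  also forces \<open>b\<close> to be injective on \<open>J\<close>.\<close>

definition int_lincomb ::
    "('a, 'c) ring_scheme \<Rightarrow> 'i set \<Rightarrow> ('i \<Rightarrow> int) \<Rightarrow> ('i \<Rightarrow> 'a) \<Rightarrow> 'a"
  where "int_lincomb R F a b = (\<Oplus>\<^bsub>R\<^esub>i\<in>F. [a i] \<cdot>\<^bsub>R\<^esub> b i)"

definition is_int_basis :: "('a, 'c) ring_scheme \<Rightarrow> 'i set \<Rightarrow> ('i \<Rightarrow> 'a) \<Rightarrow> bool"
  where "is_int_basis R J b \<longleftrightarrow>
    b ` J \<subseteq> carrier R \<and>
    (\<forall>v\<in>carrier R. \<exists>F a. finite F \<and> F \<subseteq> J \<and> v = int_lincomb R F a b) \<and>
    (\<forall>F a. finite F \<and> F \<subseteq> J \<and> int_lincomb R F a b = \<zero>\<^bsub>R\<^esub> \<longrightarrow> (\<forall>i\<in>F. a i = 0))"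

definition d_bidet :: "nat \<Rightarrow> nat \<Rightarrow> rat_tableau \<times> rat_tableau \<Rightarrow> int_mpoly set"
  where "d_bidet m t ST = d_elem m [^]\<^bsub>coord_ring m\<^esub> t \<otimes>\<^bsub>coord_ring m\<^esub> bideterminant m ST"

end

theory Submission
  imports Defs "HOL-Combinatorics.List_Permutation" "HOL-Library.Product_Lexorder"
begin

text \<open>
  Two things are needed: the elements \<open>d\<^sup>t (S | T)\<close> span the coordinate ring over the integers, and
  they are independent, with enough control over leading monomials to read off part (i).

  \<^emph>\<open>Spanning.\<close> Modulo \<open>d\<close> the relations say that \<open>X\<^sup>T Y\<close> and \<open>X Y\<^sup>T\<close> vanish. Take a product of minors
  of \<open>X\<close> and of \<open>Y\<close> that is not standard. If two neighbouring columns of one tableau violate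
  standardness, the classical exchange of entries (\<open>garnir_step\<close>) rewrites the product by products
  with a longer column, or with a smaller left column. If the first columns \<open>I\<close>, \<open>I'\<close> of the two
  tableaux violate the pair condition at \<open>j\<close>, put \<open>C = I \<inter> I' \<inter> {1..j}\<close> and
  \<open>E = {1..j} - (I \<union> I')\<close>; the violation says that \<open>C\<close> has more elements than \<open>E\<close>. Let \<open>K\<close> range over
  the subsets of the complement of \<open>E\<close> with as many elements as \<open>C\<close>, and sum the products of the minors
  with rows \<open>(I - C) \<union> K\<close> of \<open>X\<close> and \<open>(I' - C) \<union> K\<close> of \<open>Y\<close>. By the expansions of Laplace and of
  Cauchy and Binet this sum is a combination of minors of \<open>X\<^sub>P\<^sup>T Y\<^sub>P\<close>, where \<open>P\<close> is the complement of \<open>E\<close>;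
  modulo \<open>d\<close> this matrix is \<open>- X\<^sub>E\<^sup>T Y\<^sub>E\<close>, whose rank is too small, so the sum is \<open>0\<close> modulo \<open>d\<close>
  (\<open>contraction\<close>). The summand \<open>K = C\<close> is the given product, and all others have a larger sum of
  entries (\<open>mixed_step\<close>). Hence both kinds of rewriting terminate (\<open>straightening\<close>), and an induction
  on the degree takes care of the multiples of \<open>d\<close>. This argument ignores weights and dominance.

  \<^emph>\<open>Independence.\<close> Evaluate at the point \<open>X = P D Q\<close>, \<open>Y = d' adj(X)\<^sup>T\<close>, \<open>d = d' det X\<close>, where \<open>P\<close> and \<open>Q\<close>
  are generic matrices, \<open>D\<close> is a generic diagonal matrix and \<open>d'\<close> is a further variable. By Jacobi's
  theorem (\<open>complementary_minor\<close>) a minor of \<open>Y\<close> of size \<open>k\<close> is, up to sign, \<open>d'\<^sup>k det(X)\<^bsup>k - 1\<^esup>\<close> times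
  the complementary minor of \<open>X\<close>. So \<open>d\<^sup>t (S | T)\<close> becomes a power of \<open>d'\<close> times the ordinary
  bideterminant of two tableaux whose columns are some full columns, the complements of the columns
  of the second tableau in reverse order, and the columns of the first tableau; the pair condition
  says exactly that these padded tableaux are standard. In the lexicographic order of monomials in
  which the entries of \<open>D\<close> are most significant, the leading monomial records how often each entry
  occurs in each row of the padded tableaux, and this determines everything (\<open>gmono_inj\<close>).

  \<^emph>\<open>Weights, sizes and dominance.\<close> Expand \<open>(S | T)\<close> in the basis. The evaluation is homogeneous in
  the rows of \<open>P\<close>, in the columns of \<open>Q\<close> and in \<open>d'\<close>, which gives the conditions on weights and sizes.
  The degree of a leading monomial in the first \<open>j\<close> entries of \<open>D\<close> is, up to a common shift, the sum
  of the first \<open>j\<close> entries of the weight of the shape. Among the basis elements that occur, a leading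
  monomial of maximal degree of this kind cannot cancel (\<open>surviving_lead\<close>), whereas the same degree
  is bounded on the evaluation of \<open>(S | T)\<close> by the corresponding sum for its own shape.
\<close>

section \<open>Minors\<close>

text \<open>Rows and columns are indexed by lists, so that they may be permuted or repeated. The value \<open>0\<close>
  for lists of different lengths makes the expansions below hold without conditions on lengths.\<close>

definition minor :: "('i \<Rightarrow> 'j \<Rightarrow> 'a::comm_ring_1) \<Rightarrow> 'i list \<Rightarrow> 'j list \<Rightarrow> 'a"
  where "minor X I J =
    (if length I = length J then det (mat (length I) (length I) (\<lambda>(a, b). X (I ! a) (J ! b))) else 0)"

definition del :: "nat \<Rightarrow> 'a list \<Rightarrow> 'a list"
  where "del b J = take b J @ drop (Suc b) J"

lemma length_del: "b < length J \<Longrightarrow> length (del b J) = length J - 1"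
  by (simp add: del_def)

lemma nth_del:
  assumes "b < length J" "j < length J - 1"
  shows "del b J ! j = J ! (if j < b then j else Suc j)"
  using assms by (auto simp: del_def nth_append min_def)

lemma minor_Nil: "minor X [] J = (if J = [] then 1 else 0)"
  by (simp add: minor_def)

lemma minor_length_neq: "length I \<noteq> length J \<Longrightarrow> minor X I J = 0"
  by (simp add: minor_def)

lemma minor_Cons:
  "minor X (i # I) J = (\<Sum>b<length J. (-1) ^ b * X i (J ! b) * minor X I (del b J))"
proof (cases "length J = Suc (length I)")
  case True
  let ?M = "mat (Suc (length I)) (Suc (length I)) (\<lambda>(a, b). X ((i # I) ! a) (J ! b))"
  have "minor X (i # I) J = det ?M"
    using True by (simp add: minor_def)
  also have "\<dots> = (\<Sum>b<Suc (length I). ?M $$ (0, b) * cofactor ?M 0 b)"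
    by (rule laplace_expansion_row) auto
  also have "\<dots> = (\<Sum>b<length J. (-1) ^ b * X i (J ! b) * minor X I (del b J))"
    unfolding True
  proof (rule sum.cong[OF refl])
    fix b assume b: "b \<in> {..<Suc (length I)}"
    have "mat_delete ?M 0 b = mat (length I) (length I) (\<lambda>(a, c). X (I ! a) (del b J ! c))"
      unfolding mat_delete_def using b True by (intro eq_matI) (auto simp: nth_del)
    then have "cofactor ?M 0 b = (-1) ^ b * minor X I (del b J)"
      using b True by (simp add: cofactor_def minor_def length_del)
    then show "?M $$ (0, b) * cofactor ?M 0 b = (-1) ^ b * X i (J ! b) * minor X I (del b J)"
      using b by (simp add: mult_ac)
  qed
  finally show ?thesis .
next
  case False
  have "minor X I (del b J) = 0" if "b < length J" for b
    using that False by (auto simp: length_del intro!: minor_length_neq)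
  moreover have "minor X (i # I) J = 0"
    using False by (auto intro: minor_length_neq)
  ultimately show ?thesis by simp
qed

lemma minor_transpose: "minor X I J = minor (\<lambda>j i. X i j) J I"
proof (cases "length I = length J")
  case True
  let ?M = "mat (length I) (length I) (\<lambda>(a, b). X (I ! a) (J ! b))"
  have "det ?M = det (transpose_mat ?M)"
    by (rule det_transpose[symmetric]) auto
  also have "transpose_mat ?M = mat (length I) (length I) (\<lambda>(a, b). X (I ! b) (J ! a))"
    by (intro eq_matI) auto
  finally show ?thesis using True by (simp add: minor_def)
qed (simp add: minor_length_neq)

lemma minor_not_distinct_rows:
  assumes "\<not> distinct I"
  shows "minor X I J = 0"
proof (cases "length I = length J")
  case True
  obtain a b where ab: "a < length I" "b < length I" "a \<noteq> b" "I ! a = I ! b"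
    using assms by (auto simp: distinct_conv_nth)
  let ?M = "mat (length I) (length I) (\<lambda>(a, b). X (I ! a) (J ! b))"
  have "det ?M = 0"
    by (rule det_identical_rows[of _ "length I" a b]) (use ab in \<open>auto intro!: eq_vecI\<close>)
  then show ?thesis using True by (simp add: minor_def)
qed (simp add: minor_length_neq)

lemma minor_not_distinct_cols: "\<not> distinct J \<Longrightarrow> minor X I J = 0"
  by (subst minor_transpose) (rule minor_not_distinct_rows)

lemma minor_permute_rows:
  assumes "mset I' = mset I"
  shows "minor (X :: 'i \<Rightarrow> 'j \<Rightarrow> 'a::comm_ring_1) I' J = minor X I J \<or>
    minor X I' J = - minor X I J"
proof (cases "length I = length J")
  case True
  obtain p where p: "p permutes {..<length I}" "permute_list p I = I'"
    using mset_eq_permutation[OF assms] by blast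
  have len: "length I' = length I" using assms mset_eq_length by blast
  let ?M = "mat (length I) (length I) (\<lambda>(a, b). X (I ! a) (J ! b))"
  have p0: "p permutes {0..<length I}" using p(1) by (simp add: lessThan_atLeast0)
  have "mat (length I) (length I) (\<lambda>(a, b). X (I' ! a) (J ! b)) =
      mat (length I) (length I) (\<lambda>(a, b). ?M $$ (p a, b))"
    using permutes_in_image[OF p(1)]
    by (intro eq_matI) (simp_all add: p(2)[symmetric] permute_list_nth[OF p(1)])
  then have "minor X I' J = signof p * minor X I J"
    using True len det_permute_rows[OF _ p0, of ?M] by (simp add: minor_def)
  moreover have "signof p = (1::'a) \<or> signof p = (-1::'a)"
    by (simp add: sign_def)
  ultimately show ?thesis by auto
next
  case False
  moreover have "length I' = length I" using assms mset_eq_length by blast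
  ultimately show ?thesis by (simp add: minor_length_neq)
qed

lemma minor_cong:
  assumes "\<And>i j. i \<in> set I \<Longrightarrow> j \<in> set J \<Longrightarrow> X i j = Y i j"
  shows "minor X I J = minor Y I J"
proof -
  have "length I = length J \<Longrightarrow> mat (length I) (length I) (\<lambda>(a, b). X (I ! a) (J ! b)) =
      mat (length I) (length I) (\<lambda>(a, b). Y (I ! a) (J ! b))"
    by (intro eq_matI) (auto intro!: assms)
  then show ?thesis by (simp add: minor_def)
qed

lemma minor_map: "minor X (map f I) (map g J) = minor (\<lambda>i j. X (f i) (g j)) I J"
proof -
  have "length I = length J \<Longrightarrow> mat (length I) (length I) (\<lambda>(a, b). X (map f I ! a) (map g J ! b)) =
      mat (length I) (length I) (\<lambda>(a, b). X (f (I ! a)) (g (J ! b)))"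
    by (intro eq_matI) auto
  then show ?thesis by (simp add: minor_def)
qed

text \<open>Choosing the rows \<open>K\<close> among the rows \<open>S\<close> is multiplication by a matrix of zeros and ones, so this
  is multiplicativity of the determinant.\<close>

lemma minor_delta:
  assumes "distinct S" "set K \<subseteq> set S" "length K = length S"
  shows "minor (Y :: 'i \<Rightarrow> 'j \<Rightarrow> 'a::comm_ring_1) K J =
    minor (\<lambda>i s. if i = s then 1 else 0) K S * minor Y S J"
proof (cases "length K = length J")
  case True
  let ?n = "length K"
  let ?D = "mat ?n ?n (\<lambda>(a, b). if K ! a = S ! b then 1 else (0::'a))"
  let ?Y = "mat ?n ?n (\<lambda>(a, b). Y (S ! a) (J ! b))"
  have "mat ?n ?n (\<lambda>(a, b). Y (K ! a) (J ! b)) = ?D * ?Y"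
  proof (rule eq_matI)
    fix a b assume "a < dim_row (?D * ?Y)" "b < dim_col (?D * ?Y)"
    then have ab: "a < ?n" "b < ?n" by auto
    obtain c where c: "c < ?n" "K ! a = S ! c"
      using ab assms by (metis in_set_conv_nth subsetD)
    have "(?D * ?Y) $$ (a, b) = (\<Sum>x = 0..<?n. (if K ! a = S ! x then 1 else 0) * Y (S ! x) (J ! b))"
      using ab by (simp add: scalar_prod_def)
    also have "\<dots> = (\<Sum>x = 0..<?n. if x = c then Y (S ! c) (J ! b) else 0)"
      using c assms by (intro sum.cong) (auto simp: nth_eq_iff_index_eq)
    also have "\<dots> = Y (K ! a) (J ! b)" using c by simp
    finally show "mat ?n ?n (\<lambda>(a, b). Y (K ! a) (J ! b)) $$ (a, b) = (?D * ?Y) $$ (a, b)"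
      using ab by simp
  qed auto
  then have "det (mat ?n ?n (\<lambda>(a, b). Y (K ! a) (J ! b))) = det ?D * det ?Y"
    by (simp add: det_mult[of _ ?n])
  then show ?thesis using True assms by (simp add: minor_def)
qed (use assms in \<open>simp add: minor_length_neq\<close>)

lemma minor_delta_self:
  assumes "distinct S"
  shows "minor (\<lambda>i s. if i = s then 1 else 0) S S = (1 :: 'a::comm_ring_1)"
proof -
  have "mat (length S) (length S) (\<lambda>(a, b). if S ! a = S ! b then 1 else 0) =
      (1\<^sub>m (length S) :: 'a mat)"
    using assms by (intro eq_matI) (auto simp: nth_eq_iff_index_eq)
  then show ?thesis by (simp add: minor_def)
qed

lemma minor_zero_row:
  assumes "i \<in> set I" "\<And>j. j \<in> set J \<Longrightarrow> X i j = 0"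
  shows "minor X I J = 0"
  using assms(1)
proof (induction I arbitrary: )
  case Nil then show ?case by simp
next
  case (Cons a I)
  obtain I' where I': "mset (i # I') = mset (a # I)"
    using Cons.prems by (metis list.set_intros(1) mset.simps(2) mset_remove1 insert_DiffM set_mset_mset)
  have "minor X (i # I') J = 0"
    by (subst minor_Cons) (simp add: assms(2))
  then show ?case using minor_permute_rows[OF I'[symmetric], of X J] by auto
qed

section \<open>Laplace and Cauchy--Binet expansions\<close>

text \<open>All ways to cut a list into two complementary sublists, each with the sign of the shuffle that
  puts them back together.\<close>

fun splits :: "'a list \<Rightarrow> ('a list \<times> 'a list \<times> int) list"
  where
    "splits [] = [([], [], 1)]"
  | "splits (k # K) = map (\<lambda>(A, B, s). (k # A, B, s)) (splits K) @
       map (\<lambda>(A, B, s). (A, k # B, (-1) ^ length A * s)) (splits K)"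

lemma sum_sum_list_swap:
  "(\<Sum>b\<in>B. \<Sum>x\<leftarrow>xs. f b x) = (\<Sum>x\<leftarrow>xs. \<Sum>b\<in>B. f b x)"
  by (induction xs) (auto simp: sum.distrib)

lemma del_append1: "b < length J1 \<Longrightarrow> del b (J1 @ J2) = del b J1 @ J2"
  by (simp add: del_def)

lemma del_append2: "del (length J1 + b) (J1 @ J2) = J1 @ del b J2"
  by (simp add: del_def)

lemma sum_lessThan_add: "(\<Sum>b<(m::nat) + n. f b) = (\<Sum>b<m. f b) + (\<Sum>b<n. f (m + b))"
  by (induction n) (auto simp: add.assoc)

text \<open>Expand along the first row: a column of \<open>J1\<close> sends that row into the first factor, a column of
  \<open>J2\<close> sends it into the second.\<close>

lemma laplace_cols:
  "minor X K (J1 @ J2) = (\<Sum>(A, B, s)\<leftarrow>splits K. of_int s * minor X A J1 * minor X B J2)"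
proof (induction K arbitrary: J1 J2)
  case Nil
  then show ?case by (simp add: minor_Nil)
next
  case (Cons k K)
  let ?S = "splits K"
  have "minor X (k # K) (J1 @ J2) =
      (\<Sum>b<length J1. (-1) ^ b * X k (J1 ! b) * minor X K (del b J1 @ J2)) +
      (\<Sum>b<length J2. (-1) ^ (length J1 + b) * X k (J2 ! b) * minor X K (J1 @ del b J2))"
    by (simp add: minor_Cons sum_lessThan_add del_append1 del_append2 nth_append)
  also have "(\<Sum>b<length J1. (-1) ^ b * X k (J1 ! b) * minor X K (del b J1 @ J2)) =
      (\<Sum>(A, B, s)\<leftarrow>?S. of_int s * minor X (k # A) J1 * minor X B J2)"
    unfolding Cons.IH sum_list_const_mult[symmetric] sum_sum_list_swap
    by (rule arg_cong[where f = sum_list], rule map_cong)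
       (auto simp: minor_Cons sum_distrib_left sum_distrib_right mult_ac)
  also have "(\<Sum>b<length J2. (-1) ^ (length J1 + b) * X k (J2 ! b) * minor X K (J1 @ del b J2)) =
      (\<Sum>(A, B, s)\<leftarrow>?S. of_int ((-1) ^ length A * s) * minor X A J1 * minor X (k # B) J2)"
    unfolding Cons.IH sum_list_const_mult[symmetric] sum_sum_list_swap
  proof (rule arg_cong[where f = sum_list], rule map_cong[OF refl])
    fix x assume "x \<in> set ?S"
    obtain A B s where x: "x = (A, B, s)" by (cases x)
    show "(\<Sum>b<length J2. (-1) ^ (length J1 + b) * X k (J2 ! b) *
        (case x of (A, B, s) \<Rightarrow> of_int s * minor X A J1 * minor X B (del b J2))) =
        (case x of (A, B, s) \<Rightarrow> of_int ((-1) ^ length A * s) * minor X A J1 * minor X (k # B) J2)"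
    proof (cases "length A = length J1")
      case True
      then show ?thesis
        by (simp add: x minor_Cons sum_distrib_left sum_distrib_right mult_ac power_add)
    qed (simp add: x minor_length_neq)
  qed
  finally show ?case
    by (simp add: comp_def case_prod_unfold)
qed

lemma laplace_rows:
  "minor X (I1 @ I2) J = (\<Sum>(A, B, s)\<leftarrow>splits J. of_int s * minor X I1 A * minor X I2 B)"
  using laplace_cols[of "\<lambda>j i. X i j" J I1 I2]
  by (subst minor_transpose, subst (2) minor_transpose, subst (3) minor_transpose)

lemma splits_mset:
  "(A, B, s) \<in> set (splits K) \<Longrightarrow> mset A + mset B = mset K"
  by (induction K arbitrary: A B s) auto

text \<open>In a Laplace expansion one splitting often has to be separated from all others. Its sign is left
  open, because every use is insensitive to signs.\<close>

lemma splits_isolate: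
  assumes "distinct K"
  shows "\<exists>s rest. (s = 1 \<or> s = -1) \<and>
    mset (splits K) = {#(filter (\<lambda>k. k \<in> S) K, filter (\<lambda>k. k \<notin> S) K, s)#} + mset rest \<and>
    (\<forall>(A, B, s)\<in>set rest. set A \<noteq> S \<inter> set K)"
  using assms
proof (induction K)
  case Nil
  show ?case by (intro exI[of _ 1] exI[of _ "[]"]) simp
next
  case (Cons k K)
  then obtain s rest where IH: "s = 1 \<or> s = -1"
    "mset (splits K) = {#(filter (\<lambda>k. k \<in> S) K, filter (\<lambda>k. k \<notin> S) K, s)#} + mset rest"
    "\<forall>(A, B, s)\<in>set rest. set A \<noteq> S \<inter> set K"
    by (metis distinct.simps(2))
  let ?f = "\<lambda>(A, B, s). (k # A, B, s)" and ?g = "\<lambda>(A, B, s). (A, k # B, (-1) ^ length A * s :: int)"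
  have sub: "set A \<subseteq> set K" if "(A, B, t) \<in> set (splits K)" for A B t
    using splits_mset[OF that] by (metis set_mset_mset set_mset_union sup_ge1)
  have restsub: "set A \<subseteq> set K" if "(A, B, t) \<in> set rest" for A B t
  proof -
    have "(A, B, t) \<in># mset (splits K)" using that IH(2) by simp
    then show ?thesis using sub by simp
  qed
  show ?case
  proof (cases "k \<in> S")
    case True
    let ?rest = "map ?f rest @ map ?g (splits K)"
    have "mset (splits (k # K)) =
      {#(filter (\<lambda>k. k \<in> S) (k # K), filter (\<lambda>k. k \<notin> S) (k # K), s)#} + mset ?rest"
      using True IH(2) by simp
    moreover have "\<forall>(A, B, s)\<in>set ?rest. set A \<noteq> S \<inter> set (k # K)"
    proof -
      have "set (k # A) \<noteq> S \<inter> set (k # K)" if "(A, B, t) \<in> set rest" for A B t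
        using IH(3) restsub[OF that] that True Cons.prems by auto
      moreover have "set A \<noteq> S \<inter> set (k # K)" if "(A, B, t) \<in> set (splits K)" for A B t
        using sub[OF that] True Cons.prems by auto
      ultimately show ?thesis by auto
    qed
    ultimately show ?thesis using IH(1) by blast
  next
    case False
    let ?t = "(-1) ^ length (filter (\<lambda>k. k \<in> S) K) * s"
    let ?rest = "map ?f (splits K) @ map ?g rest"
    have "mset (splits (k # K)) =
      {#(filter (\<lambda>k. k \<in> S) (k # K), filter (\<lambda>k. k \<notin> S) (k # K), ?t)#} + mset ?rest"
      using False IH(2) by simp
    moreover have "\<forall>(A, B, s)\<in>set ?rest. set A \<noteq> S \<inter> set (k # K)"
    proof -
      have "set A \<noteq> S \<inter> set (k # K)" if "(A, B, t) \<in> set rest" for A B t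
        using IH(3) that False by auto
      moreover have "set (k # A) \<noteq> S \<inter> set (k # K)" if "(A, B, t) \<in> set (splits K)" for A B t
        using False by auto
      ultimately show ?thesis by auto
    qed
    moreover have "?t = 1 \<or> ?t = -1"
      using IH(1) by (auto simp: minus_one_power_iff)
    ultimately show ?thesis by blast
  qed
qed

lemma sum_list_splits_isolate:
  fixes F :: "'a list \<times> 'a list \<times> int \<Rightarrow> 'b::comm_monoid_add"
  assumes "distinct K"
  obtains s rest where "s = 1 \<or> s = -1"
    "(\<Sum>x\<leftarrow>splits K. F x) =
       F (filter (\<lambda>k. k \<in> S) K, filter (\<lambda>k. k \<notin> S) K, s) + (\<Sum>x\<leftarrow>rest. F x)"
    "\<And>A B t. (A, B, t) \<in> set rest \<Longrightarrow> (A, B, t) \<in> set (splits K) \<and> set A \<noteq> S \<inter> set K"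
proof -
  obtain s rest where *: "s = 1 \<or> s = -1"
    "mset (splits K) = {#(filter (\<lambda>k. k \<in> S) K, filter (\<lambda>k. k \<notin> S) K, s)#} + mset rest"
    "\<forall>(A, B, s)\<in>set rest. set A \<noteq> S \<inter> set K"
    using splits_isolate[OF assms] by blast
  have "sum_mset (image_mset F (mset (splits K))) =
    F (filter (\<lambda>k. k \<in> S) K, filter (\<lambda>k. k \<notin> S) K, s) + sum_mset (image_mset F (mset rest))"
    unfolding *(2) by simp
  then have sum: "(\<Sum>x\<leftarrow>splits K. F x) =
       F (filter (\<lambda>k. k \<in> S) K, filter (\<lambda>k. k \<notin> S) K, s) + (\<Sum>x\<leftarrow>rest. F x)"
    by (simp only: mset_map[symmetric] sum_mset_sum_list)
  have "set rest \<subseteq> set (splits K)"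
    using *(2) by (metis set_mset_mset set_mset_union sup_ge2)
  then show thesis using that *(1,3) sum by blast
qed

lemma finite_lists_length: "finite P \<Longrightarrow> finite {K. set K \<subseteq> P \<and> length K = n}"
  by (rule finite_lists_length_eq)

text \<open>Multilinearity in the rows alone, with repeated row indices still present: expand along the
  first row.\<close>

lemma minor_matrix_product:
  assumes "finite P"
  shows "minor (\<lambda>j j'. \<Sum>k\<in>P. X k j * Y k j') J J' =
    (\<Sum>K | set K \<subseteq> P \<and> length K = length J.
       (\<Prod>a<length J. X (K ! a) (J ! a)) * minor Y K J')"
proof (induction J arbitrary: J')
  case Nil
  have "{K. set K \<subseteq> P \<and> length K = 0} = {[]}" by auto
  then show ?case by (simp add: minor_Nil)
next
  case (Cons j J)
  let ?G = "\<lambda>j j'. \<Sum>k\<in>P. X k j * Y k j'"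
  let ?L = "\<lambda>n. {K. set K \<subseteq> P \<and> length K = n}"
  have L: "?L (Suc n) = (\<lambda>(k, K). k # K) ` (P \<times> ?L n)" for n
    by (auto simp: length_Suc_conv image_iff)
  have inj: "inj_on (\<lambda>(k, K). k # K) (P \<times> ?L n)" for n
    by (auto simp: inj_on_def)
  have "minor ?G (j # J) J' =
      (\<Sum>b<length J'. \<Sum>k\<in>P. \<Sum>K\<in>?L (length J). (-1) ^ b * (X k j * Y k (J' ! b)) *
        ((\<Prod>a<length J. X (K ! a) (J ! a)) * minor Y K (del b J')))"
    by (simp add: minor_Cons Cons.IH sum_distrib_left sum_distrib_right)
       (rule sum.cong[OF refl], rule sum.swap)
  also have "\<dots> = (\<Sum>k\<in>P. \<Sum>K\<in>?L (length J). \<Sum>b<length J'. (-1) ^ b * (X k j * Y k (J' ! b)) *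
        ((\<Prod>a<length J. X (K ! a) (J ! a)) * minor Y K (del b J')))"
    by (subst sum.swap) (rule sum.cong[OF refl], rule sum.swap)
  also have "\<dots> = (\<Sum>k\<in>P. \<Sum>K\<in>?L (length J).
        X k j * (\<Prod>a<length J. X (K ! a) (J ! a)) * minor Y (k # K) J')"
    by (simp add: minor_Cons sum_distrib_left mult_ac)
  also have "\<dots> = (\<Sum>(k, K)\<in>P \<times> ?L (length J).
        X k j * (\<Prod>a<length J. X (K ! a) (J ! a)) * minor Y (k # K) J')"
    by (simp add: sum.cartesian_product)
  also have "\<dots> = (\<Sum>K\<in>?L (length (j # J)).
       (\<Prod>a<length (j # J). X (K ! a) ((j # J) ! a)) * minor Y K J')"
    unfolding list.size L[of "length J", simplified, folded Suc_eq_plus1] add_Suc_right add_0_right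
    by (subst sum.reindex[OF inj])
       (auto intro!: sum.cong simp: prod.lessThan_Suc_shift simp del: prod.lessThan_Suc)
  finally show ?case .
qed

text \<open>In the preceding expansion, lists with a repeated entry contribute nothing, and the others are
  grouped by their underlying set \<open>S\<close>. For one \<open>S\<close> the coefficients are those of the expansion of the
  minor of \<open>X\<close> with rows \<open>S\<close> against the identity matrix, and \<open>minor_delta\<close> accounts for the signs; so no
  sum over permutations is needed.\<close>

theorem cauchy_binet:
  fixes P :: "'i::linorder set"
  assumes P: "finite P"
  shows "minor (\<lambda>j j'. \<Sum>k\<in>P. X k j * Y k j') J J' =
    (\<Sum>S | S \<subseteq> P \<and> card S = length J.
       minor X (sorted_list_of_set S) J * minor Y (sorted_list_of_set S) J')"
proof -
  let ?n = "length J"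
  let ?sl = sorted_list_of_set
  let ?F = "\<lambda>K. (\<Prod>a<?n. X (K ! a) (J ! a)) * minor Y K J'"
  let ?Ss = "{S. S \<subseteq> P \<and> card S = ?n}"
  have finS: "finite S" if "S \<in> ?Ss" for S using that P finite_subset by auto
  have distinctI: "(\<Sum>K | set K \<subseteq> Q \<and> length K = ?n. ?F K) =
      (\<Sum>K | set K \<subseteq> Q \<and> length K = ?n \<and> distinct K. ?F K)" if "finite Q" for Q
    by (rule sum.mono_neutral_right)
       (use that finite_lists_length[OF that, of ?n] in \<open>auto simp: minor_not_distinct_rows\<close>)
  have one: "minor X (?sl S) J * minor Y (?sl S) J' =
      (\<Sum>K | set K = S \<and> length K = ?n \<and> distinct K. ?F K)" if S: "S \<in> ?Ss" for S
  proof -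
    have fS: "finite S" by (rule finS[OF S])
    have "minor X (?sl S) J = minor (\<lambda>j s. \<Sum>k\<in>S. X k j * (if k = s then 1 else 0)) J (?sl S)"
      by (subst minor_transpose) (rule minor_cong, use fS in \<open>simp add: if_distrib cong: if_cong\<close>)
    also have "\<dots> = (\<Sum>K | set K \<subseteq> S \<and> length K = ?n. (\<Prod>a<?n. X (K ! a) (J ! a)) *
        minor (\<lambda>k s. if k = s then 1 else 0) K (?sl S))"
      by (rule minor_matrix_product[OF fS])
    finally have "minor X (?sl S) J * minor Y (?sl S) J' =
       (\<Sum>K | set K \<subseteq> S \<and> length K = ?n. (\<Prod>a<?n. X (K ! a) (J ! a)) *
        (minor (\<lambda>k s. if k = s then 1 else 0) K (?sl S) * minor Y (?sl S) J'))"
      by (simp only: sum_distrib_right mult.assoc)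
    also have "\<dots> = (\<Sum>K | set K \<subseteq> S \<and> length K = ?n. ?F K)"
    proof (rule sum.cong[OF refl])
      fix K assume "K \<in> {K. set K \<subseteq> S \<and> length K = ?n}"
      then have "minor Y K J' = minor (\<lambda>k s. if k = s then 1 else 0) K (?sl S) * minor Y (?sl S) J'"
        using S fS by (intro minor_delta) auto
      then show "(\<Prod>a<?n. X (K ! a) (J ! a)) *
        (minor (\<lambda>k s. if k = s then 1 else 0) K (?sl S) * minor Y (?sl S) J') = ?F K" by simp
    qed
    also have "\<dots> = (\<Sum>K | set K \<subseteq> S \<and> length K = ?n \<and> distinct K. ?F K)"
      by (rule distinctI[OF fS])
    also have "{K. set K \<subseteq> S \<and> length K = ?n \<and> distinct K} =
        {K. set K = S \<and> length K = ?n \<and> distinct K}"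
    proof -
      have "set K = S" if "set K \<subseteq> S" "length K = ?n" "distinct K" for K
        using that S by (intro card_subset_eq[OF fS]) (auto simp: distinct_card)
      then show ?thesis by auto
    qed
    finally show ?thesis .
  qed
  have "minor (\<lambda>j j'. \<Sum>k\<in>P. X k j * Y k j') J J' =
      (\<Sum>K | set K \<subseteq> P \<and> length K = ?n \<and> distinct K. ?F K)"
    by (simp add: minor_matrix_product[OF P] distinctI[OF P])
  also have "{K. set K \<subseteq> P \<and> length K = ?n \<and> distinct K} =
      (\<Union>S\<in>?Ss. {K. set K = S \<and> length K = ?n \<and> distinct K})"
    by (auto simp: distinct_card)
  also have "sum ?F \<dots> = (\<Sum>S\<in>?Ss. \<Sum>K | set K = S \<and> length K = ?n \<and> distinct K. ?F K)"
  proof (rule sum.UNION_disjoint)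
    show "finite ?Ss" using P by simp
    show "\<forall>S\<in>?Ss. finite {K. set K = S \<and> length K = ?n \<and> distinct K}"
      by (intro ballI finite_subset[OF _ finite_lists_length[OF finS, of _ ?n]]) auto
  qed auto
  also have "\<dots> = (\<Sum>S\<in>?Ss. minor X (?sl S) J * minor Y (?sl S) J')"
    by (rule sum.cong[OF refl]) (simp add: one)
  finally show ?thesis .
qed

section \<open>Exchange relations between minors\<close>

text \<open>Straightening only uses that the target is closed under subtraction, so it is stated for an
  arbitrary additive subgroup in place of a span.\<close>

definition add_subgroup :: "'a::ab_group_add set \<Rightarrow> bool"
  where "add_subgroup W \<longleftrightarrow> 0 \<in> W \<and> (\<forall>a\<in>W. \<forall>b\<in>W. a - b \<in> W)"

lemma add_subgroup_0: "add_subgroup W \<Longrightarrow> 0 \<in> W"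
  by (simp add: add_subgroup_def)

lemma add_subgroup_diff: "add_subgroup W \<Longrightarrow> a \<in> W \<Longrightarrow> b \<in> W \<Longrightarrow> a - b \<in> W"
  by (simp add: add_subgroup_def)

lemma add_subgroup_uminus: "add_subgroup W \<Longrightarrow> a \<in> W \<Longrightarrow> - a \<in> W"
  using add_subgroup_diff[of W 0 a] by (simp add: add_subgroup_0)

lemma add_subgroup_add: "add_subgroup W \<Longrightarrow> a \<in> W \<Longrightarrow> b \<in> W \<Longrightarrow> a + b \<in> W"
  using add_subgroup_diff[of W a "- b"] by (simp add: add_subgroup_uminus)

lemma add_subgroup_sum: "add_subgroup W \<Longrightarrow> (\<And>x. x \<in> A \<Longrightarrow> f x \<in> W) \<Longrightarrow> sum f A \<in> W"
  by (induction A rule: infinite_finite_induct) (auto simp: add_subgroup_0 add_subgroup_add)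

lemma add_subgroup_sum_list:
  "add_subgroup W \<Longrightarrow> (\<And>x. x \<in> set xs \<Longrightarrow> f x \<in> W) \<Longrightarrow> (\<Sum>x\<leftarrow>xs. f x) \<in> W"
  by (induction xs) (auto simp: add_subgroup_0 add_subgroup_add)

lemma add_subgroup_sign:
  "add_subgroup W \<Longrightarrow> a \<in> W \<Longrightarrow> b = a \<or> b = - a \<Longrightarrow> b \<in> W"
  by (auto simp: add_subgroup_uminus)

lemma add_subgroup_of_int:
  fixes a :: "'a::ring_1"
  assumes W: "add_subgroup W" and a: "a \<in> W"
  shows "of_int z * a \<in> W"
proof (induction z rule: int_induct[where k = 0])
  case base then show ?case using W by (simp add: add_subgroup_0)
next
  case (step1 i) then show ?case using W a by (simp add: algebra_simps add_subgroup_add)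
next
  case (step2 i) then show ?case using W a by (simp add: algebra_simps add_subgroup_diff)
qed

text \<open>Rewriting acts on a few factors of a product. Membership of the product in \<open>W\<close> is membership of
  these factors in a residual subgroup.\<close>

lemma add_subgroup_residual:
  "add_subgroup W \<Longrightarrow> add_subgroup {z. z * (r::'a::comm_ring_1) \<in> W}"
  by (auto simp: add_subgroup_def algebra_simps)

subsection \<open>Two columns of one tableau\<close>

text \<open>Outside the common part both sets have the same number of elements, and there every element of
  \<open>K\<close> lies below every element of \<open>C\<close>.\<close>

lemma sum_exchange_less:
  fixes C K :: "nat set"
  assumes fin: "finite C" "finite K" and card: "card K = card C" and ne: "K \<noteq> C"
    and less: "\<And>x y. x \<in> K - C \<Longrightarrow> y \<in> C - K \<Longrightarrow> x < y"
  shows "\<Sum>K < \<Sum>C"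
proof -
  have c: "card (K - C) = card (C - K)"
    using card fin by (metis card_Diff_subset_Int finite_Int inf_commute)
  have ne': "C - K \<noteq> {}"
    using ne card fin by (metis Diff_eq_empty_iff card_subset_eq)
  \<comment> \<open>\<open>b\<close> separates the two differences\<close>
  define b where "b = Min (C - K)"
  have b: "b \<in> C - K" unfolding b_def using ne' fin by (intro Min_in) auto
  have "\<Sum>(K - C) < (\<Sum>x\<in>K - C. b)"
  proof (rule sum_strict_mono)
    show "K - C \<noteq> {}" using c ne' fin by (metis card_0_eq finite_Diff)
  qed (use fin less b in auto)
  also have "\<dots> = (\<Sum>x\<in>C - K. b)" using c by simp
  also have "\<dots> \<le> \<Sum>(C - K)"
    by (rule sum_mono) (use fin in \<open>auto simp: b_def\<close>)
  finally have "\<Sum>(K - C) < \<Sum>(C - K)" .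
  moreover have "\<Sum>K = \<Sum>(K - C) + \<Sum>(K \<inter> C)"
    using fin by (metis Int_Diff_Un Int_Diff_disjoint add.commute finite_Diff finite_Int sum.union_disjoint)
  moreover have "\<Sum>C = \<Sum>(C - K) + \<Sum>(K \<inter> C)"
    using fin by (metis Int_Diff_Un Int_Diff_disjoint add.commute finite_Diff finite_Int inf_commute sum.union_disjoint)
  ultimately show ?thesis by simp
qed

lemma sum_list_distinct_set: "distinct xs \<Longrightarrow> sum_list xs = \<Sum>(set xs)"
  for xs :: "nat list"
  by (metis sum_list_distinct_conv_sum_set map_ident)

lemma sum_list_product:
  fixes f :: "'x \<Rightarrow> 'z::semiring_0"
  shows "(\<Sum>x\<leftarrow>xs. f x) * (\<Sum>y\<leftarrow>ys. g y) = (\<Sum>x\<leftarrow>xs. \<Sum>y\<leftarrow>ys. f x * g y)"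
  by (simp add: sum_list_mult_const[symmetric] sum_list_const_mult)

text \<open>Expand both minors on the left along \<open>J\<close> and \<open>J'\<close>. The factors with rows from \<open>K\<close> then form the
  expansion of a single minor with all the rows \<open>K\<close>.\<close>

lemma garnir_identity:
  "(\<Sum>(K1, K2, s)\<leftarrow>splits K. of_int s * minor X (A @ K1) J * minor X (K2 @ B) J') =
   (\<Sum>(J1, J2, s1)\<leftarrow>splits J. \<Sum>(J3, J4, s2)\<leftarrow>splits J'.
      of_int s1 * of_int s2 * minor X A J1 * minor X B J4 * minor X K (J2 @ J3))"
proof -
  have swap: "(\<Sum>x\<leftarrow>xs. \<Sum>y\<leftarrow>ys. g x y) = (\<Sum>y\<leftarrow>ys. \<Sum>x\<leftarrow>xs. g x y)"
    for xs :: "'x list" and ys :: "'y list" and g :: "'x \<Rightarrow> 'y \<Rightarrow> 'z::comm_monoid_add"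
    by (induction xs) (auto simp: sum_list_addf)
  have "(\<Sum>(K1, K2, s)\<leftarrow>splits K. of_int s * minor X (A @ K1) J * minor X (K2 @ B) J') =
    (\<Sum>(K1, K2, s)\<leftarrow>splits K. \<Sum>(J1, J2, s1)\<leftarrow>splits J. \<Sum>(J3, J4, s2)\<leftarrow>splits J'.
      of_int s * (of_int s1 * minor X A J1 * minor X K1 J2) *
        (of_int s2 * minor X K2 J3 * minor X B J4))"
    unfolding laplace_rows case_prod_unfold mult.assoc
    unfolding sum_list_product
    unfolding sum_list_const_mult[symmetric]
    by (intro arg_cong[where f = sum_list] map_cong refl) (simp add: mult_ac)
  also have "\<dots> = (\<Sum>(J1, J2, s1)\<leftarrow>splits J. \<Sum>(J3, J4, s2)\<leftarrow>splits J'. \<Sum>(K1, K2, s)\<leftarrow>splits K.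
      of_int s * (of_int s1 * minor X A J1 * minor X K1 J2) *
        (of_int s2 * minor X K2 J3 * minor X B J4))"
    unfolding case_prod_unfold
    by (subst swap) (rule arg_cong[where f = sum_list], rule map_cong[OF refl], rule swap)
  also have "\<dots> = (\<Sum>(J1, J2, s1)\<leftarrow>splits J. \<Sum>(J3, J4, s2)\<leftarrow>splits J'.
      of_int s1 * of_int s2 * minor X A J1 * minor X B J4 * minor X K (J2 @ J3))"
    unfolding laplace_cols case_prod_unfold sum_list_const_mult[symmetric]
    by (intro arg_cong[where f = sum_list] map_cong refl) (simp add: mult_ac)
  finally show ?thesis .
qed

text \<open>Let \<open>K\<close> consist of the entries of \<open>I\<close> from position \<open>i\<close> on and of those of \<open>I'\<close> up to position \<open>i\<close>.
  It has one element more than \<open>I\<close>, so the right side of \<open>garnir_identity\<close> consists of products with a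
  longer column. On the left, the entries of \<open>I'\<close> in \<open>K\<close> are smaller than those of \<open>I\<close>, so every
  exchange other than the trivial one makes the left column smaller.\<close>

lemma garnir_step:
  fixes X :: "nat \<Rightarrow> nat \<Rightarrow> 'a::comm_ring_1"
  assumes W: "add_subgroup W"
    and sorted: "sorted_wrt (<) I" "sorted_wrt (<) I'"
    and len: "length J = length I" "length J' = length I'"
    and i: "i < length I" "i < length I'" "I' ! i < I ! i"
    and same: "\<And>K K'. length K = length I \<Longrightarrow> length K' = length I' \<Longrightarrow>
        mset K + mset K' = mset I + mset I' \<Longrightarrow> sum_list K < sum_list I \<Longrightarrow>
        minor X K J * minor X K' J' \<in> W"
    and longer: "\<And>A B K J1 J2 J3. length A = length J1 \<Longrightarrow> length B = length J2 \<Longrightarrow>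
        length K = length J3 \<Longrightarrow> length K = Suc (length I) \<Longrightarrow>
        mset A + mset B + mset K = mset I + mset I' \<Longrightarrow>
        mset J1 + mset J2 + mset J3 = mset J + mset J' \<Longrightarrow>
        minor X A J1 * minor X B J2 * minor X K J3 \<in> W"
  shows "minor X I J * minor X I' J' \<in> W"
proof -
  define A U V B where AUVB: "A = take i I" "U = drop i I" "V = take (Suc i) I'" "B = drop (Suc i) I'"
  have I: "I = A @ U" and I': "I' = V @ B" by (simp_all add: AUVB)
  \<comment> \<open>every entry of \<open>V\<close> is smaller than every entry of \<open>U\<close>, so \<open>U\<close> is the top sublist of \<open>K\<close>\<close>
  define K where "K = U @ V"
  have lU: "length U = length I - i" and lV: "length V = Suc i" and lA: "length A = i"
    and lB: "length B = length I' - Suc i"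
    using i by (simp_all add: AUVB)
  have VU: "v < u" if "u \<in> set U" "v \<in> set V" for u v
  proof -
    obtain a where a: "a < length U" "u = U ! a" using \<open>u \<in> set U\<close> by (metis in_set_conv_nth)
    obtain b where b: "b < length V" "v = V ! b" using \<open>v \<in> set V\<close> by (metis in_set_conv_nth)
    have "v = I' ! b" "b \<le> i" using b lV by (auto simp: AUVB)
    then have "v \<le> I' ! i"
      using sorted_wrt_nth_less[OF sorted(2), of b i] i by (cases "b = i") auto
    moreover have "u = I ! (i + a)" "i + a < length I" using a lU i by (auto simp: AUVB)
    then have "I ! i \<le> u"
      using sorted_wrt_nth_less[OF sorted(1), of i "i + a"] by (cases "a = 0") auto
    ultimately show ?thesis using i by simp
  qed
  have dist: "distinct I" "distinct I'"
    using sorted strict_sorted_iff by blast+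
  then have dK: "distinct K" using VU unfolding K_def I I' by fastforce
  let ?F = "\<lambda>(K1, K2, s). of_int s * minor X (A @ K1) J * minor X (K2 @ B) J'"
  obtain s rest where iso: "s = 1 \<or> s = -1"
    "(\<Sum>x\<leftarrow>splits K. ?F x) = ?F (filter (\<lambda>k. k \<in> set U) K, filter (\<lambda>k. k \<notin> set U) K, s) + (\<Sum>x\<leftarrow>rest. ?F x)"
    "\<And>A B t. (A, B, t) \<in> set rest \<Longrightarrow> (A, B, t) \<in> set (splits K) \<and> set A \<noteq> set U \<inter> set K"
    using sum_list_splits_isolate[OF dK, of ?F "set U"] by metis
  have filt: "filter (\<lambda>k. k \<in> set U) K = U" "filter (\<lambda>k. k \<notin> set U) K = V"
    unfolding K_def using VU by (fastforce simp: filter_id_conv filter_empty_conv)+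
  have "(\<Sum>x\<leftarrow>rest. ?F x) \<in> W"
  proof (rule add_subgroup_sum_list[OF W])
    fix x assume x: "x \<in> set rest"
    obtain K1 K2 t where xeq: "x = (K1, K2, t)" by (cases x)
    have spl: "(K1, K2, t) \<in> set (splits K)" and ne: "set K1 \<noteq> set U \<inter> set K"
      using iso(3) x xeq by auto
    have ms: "mset K1 + mset K2 = mset U + mset V" using splits_mset[OF spl] by (simp add: K_def)
    have "minor X (A @ K1) J * minor X (K2 @ B) J' \<in> W"
    proof (cases "length K1 = length U")
      case True
      have lK2: "length K2 = length V"
        using arg_cong[OF ms, of size] True by simp
      have dK1: "distinct K1"
        using dK splits_mset[OF spl]
        by (metis distinct_append mset_append mset_eq_imp_distinct_iff)
      have "set K1 \<union> set K2 = set U \<union> set V"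
        using arg_cong[OF ms, of set_mset] by simp
      then have sub: "set K1 \<subseteq> set U \<union> set V" by auto
      have dU: "distinct U" using dist unfolding I by simp
      have "\<Sum>(set K1) < \<Sum>(set U)"
      proof (rule sum_exchange_less)
        show "card (set K1) = card (set U)" using True dK1 dU by (simp add: distinct_card)
        show "set K1 \<noteq> set U" using ne by (auto simp: K_def)
      qed (use sub VU in auto)
      then have "sum_list K1 < sum_list U" using dK1 dU by (simp add: sum_list_distinct_set)
      then show ?thesis
        by (intro same) (use True lK2 ms in \<open>simp_all add: I I' add.assoc add.left_commute\<close>)
    next
      case False
      then have "minor X (A @ K1) J = 0" using len by (intro minor_length_neq) (simp add: I)
      then show ?thesis using W by (simp add: add_subgroup_0)
    qed
    then show "?F x \<in> W" using add_subgroup_of_int[OF W] by (simp add: xeq mult.assoc)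
  qed
  moreover have "(\<Sum>x\<leftarrow>splits K. ?F x) \<in> W"
    unfolding garnir_identity[of X A J B J' K]
  proof (rule add_subgroup_sum_list[OF W], clarify, rule add_subgroup_sum_list[OF W], clarify)
    fix J1 J2 s1 J3 J4 s2
    assume s: "(J1, J2, s1) \<in> set (splits J)" "(J3, J4, s2) \<in> set (splits J')"
    have "minor X A J1 * minor X B J4 * minor X K (J2 @ J3) \<in> W"
    proof (cases "length A = length J1 \<and> length B = length J4 \<and> length K = length (J2 @ J3)")
      case True
      have "length K = Suc (length I)" using i by (simp add: K_def lU lV)
      moreover have "mset A + mset B + mset K = mset I + mset I'" by (simp add: K_def I I')
      moreover have "mset J1 + mset J4 + mset (J2 @ J3) = mset J + mset J'"
        by (simp add: splits_mset[OF s(1), symmetric] splits_mset[OF s(2), symmetric])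
      ultimately show ?thesis using True by (intro longer) auto
    next
      case False
      then have "minor X A J1 = 0 \<or> minor X B J4 = 0 \<or> minor X K (J2 @ J3) = 0"
        using minor_length_neq by blast
      then show ?thesis using W by (auto simp: add_subgroup_0)
    qed
    then have "of_int (s1 * s2) * (minor X A J1 * minor X B J4 * minor X K (J2 @ J3)) \<in> W"
      by (rule add_subgroup_of_int[OF W])
    then show "of_int s1 * of_int s2 * minor X A J1 * minor X B J4 * minor X K (J2 @ J3) \<in> W"
      by (simp add: mult.assoc)
  qed
  ultimately have "?F (U, V, s) \<in> W"
    using iso(2) add_subgroup_diff[OF W] unfolding filt by (metis add_diff_cancel_right')
  then show ?thesis
    using iso(1) add_subgroup_uminus[OF W] unfolding I I' by fastforce
qed

subsection \<open>A column of each tableau\<close>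

text \<open>Here \<open>F n\<close> stands for the homogeneous elements of degree \<open>n\<close>, and \<open>Z n\<close> for those elements of degree
  \<open>n\<close> that vanish modulo the relations and \<open>d\<close>. Keeping track of degrees makes the induction possible
  that removes the multiples of \<open>d\<close>.\<close>

locale matrix_pair =
  fixes m :: nat and X Y :: "nat \<Rightarrow> nat \<Rightarrow> 'a::comm_ring_1"
    and F Z :: "nat \<Rightarrow> 'a set"
  assumes F: "add_subgroup (F n)" and F_one: "1 \<in> F 0"
    and F_mult: "a \<in> F k \<Longrightarrow> b \<in> F n \<Longrightarrow> a * b \<in> F (k + n)"
    and Z: "add_subgroup (Z n)"
    and Z_mult: "a \<in> F k \<Longrightarrow> b \<in> Z n \<Longrightarrow> a * b \<in> Z (k + n)"
    and X_F: "i \<in> {1..m} \<Longrightarrow> j \<in> {1..m} \<Longrightarrow> X i j \<in> F 1"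
    and Y_F: "i \<in> {1..m} \<Longrightarrow> j \<in> {1..m} \<Longrightarrow> Y i j \<in> F 1"
    and XtY: "i \<in> {1..m} \<Longrightarrow> j \<in> {1..m} \<Longrightarrow> (\<Sum>l=1..m. X l i * Y l j) \<in> Z 2"
    and XYt: "i \<in> {1..m} \<Longrightarrow> j \<in> {1..m} \<Longrightarrow> (\<Sum>l=1..m. X i l * Y j l) \<in> Z 2"
begin

lemma transpose: "matrix_pair m (\<lambda>i j. X j i) (\<lambda>i j. Y j i) F Z"
  by unfold_locales (use F F_one F_mult Z Z_mult X_F Y_F XtY XYt in auto)

lemma F_sign: "(-1) ^ k \<in> F 0"
  by (induction k) (use F_one F F_mult[of "-1" 0 _ 0] in \<open>auto simp: add_subgroup_uminus\<close>)

lemma minor_F: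
  assumes "\<And>i j. i \<in> set I \<Longrightarrow> j \<in> set J \<Longrightarrow> A i j \<in> F k"
  shows "minor A I J \<in> F (k * length I)"
  using assms
proof (induction I arbitrary: J)
  case Nil
  then show ?case using F_one add_subgroup_0[OF F] by (simp add: minor_Nil)
next
  case (Cons i I)
  have "j \<in> set J" if "j \<in> set (del b J)" for j b
    using that by (auto simp: del_def dest: in_set_takeD in_set_dropD)
  then have "(-1) ^ b * A i (J ! b) * minor A I (del b J) \<in> F (0 + k + k * length I)"
    if "b < length J" for b
    using that by (intro F_mult F_sign Cons.IH Cons.prems) auto
  then show ?case unfolding minor_Cons by (auto intro!: add_subgroup_sum[OF F])
qed

text \<open>Congruent matrices have congruent minors.\<close>

lemma minor_perturb:
  assumes "\<And>i j. i \<in> set I \<Longrightarrow> j \<in> set J \<Longrightarrow> H i j \<in> Z 2"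
    and "\<And>i j. i \<in> set I \<Longrightarrow> j \<in> set J \<Longrightarrow> G i j \<in> F 2"
    and "\<And>i j. i \<in> set I \<Longrightarrow> j \<in> set J \<Longrightarrow> H i j + G i j \<in> F 2"
  shows "minor (\<lambda>i j. H i j + G i j) I J - minor G I J \<in> Z (2 * length I)"
  using assms
proof (induction I arbitrary: J)
  case Nil
  then show ?case using add_subgroup_0[OF Z] by (simp add: minor_Nil)
next
  case (Cons i I)
  let ?HG = "\<lambda>i j. H i j + G i j"
  have dl: "j \<in> set J" if "j \<in> set (del b J)" for j b
    using that by (auto simp: del_def dest: in_set_takeD in_set_dropD)
  have "(-1) ^ b * (minor ?HG I (del b J) * H i (J ! b) +
      G i (J ! b) * (minor ?HG I (del b J) - minor G I (del b J))) \<in> Z (0 + (2 + 2 * length I))"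
    if b: "b < length J" for b
  proof (rule Z_mult[OF F_sign], rule add_subgroup_add[OF Z])
    have "minor ?HG I (del b J) * H i (J ! b) \<in> Z (2 * length I + 2)"
      by (intro Z_mult minor_F Cons.prems) (use b dl in auto)
    then show "minor ?HG I (del b J) * H i (J ! b) \<in> Z (2 + 2 * length I)" by (simp add: add.commute)
    have "minor ?HG I (del b J) - minor G I (del b J) \<in> Z (2 * length I)"
      by (intro Cons.IH Cons.prems) (use dl in auto)
    then show "G i (J ! b) * (minor ?HG I (del b J) - minor G I (del b J)) \<in> Z (2 + 2 * length I)"
      by (rule Z_mult[rotated]) (use b in \<open>auto intro!: Cons.prems\<close>)
  qed
  then have "(\<Sum>b<length J. (-1) ^ b * (minor ?HG I (del b J) * H i (J ! b) +
      G i (J ! b) * (minor ?HG I (del b J) - minor G I (del b J)))) \<in> Z (2 * length (i # I))"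
    by (intro add_subgroup_sum[OF Z]) auto
  also have "(\<Sum>b<length J. (-1) ^ b * (minor ?HG I (del b J) * H i (J ! b) +
      G i (J ! b) * (minor ?HG I (del b J) - minor G I (del b J)))) =
      minor ?HG (i # I) J - minor G (i # I) J"
    unfolding minor_Cons sum_subtractf[symmetric]
    by (intro sum.cong refl) (simp add: algebra_simps)
  finally show ?case .
qed

text \<open>After Laplace expansion in both factors the sum over \<open>K\<close> is, by Cauchy--Binet, a minor of size
  \<open>c\<close> of the matrix product taken over the rows outside \<open>E\<close> only. Since the product over all rows
  vanishes, this is a minor of minus the product over the rows in \<open>E\<close>, which has rank less than \<open>c\<close>.\<close>

lemma contraction:
  assumes E: "E \<subseteq> {1..m}" "card E < c" and AB: "set A \<subseteq> {1..m}" "set B \<subseteq> {1..m}"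
    and J: "set J \<subseteq> {1..m}" "set J' \<subseteq> {1..m}"
  shows "(\<Sum>K | K \<subseteq> {1..m} - E \<and> card K = c.
      minor X (A @ sorted_list_of_set K) J * minor Y (B @ sorted_list_of_set K) J')
      \<in> Z (length J + length J')"
proof -
  let ?sl = sorted_list_of_set
  let ?P = "{1..m} - E"
  let ?Ks = "{K. K \<subseteq> ?P \<and> card K = c}"
  have finE: "finite E" using E(1) finite_subset by blast
  have inner: "(\<Sum>K\<in>?Ks. minor X (?sl K) J2 * minor Y (?sl K) J2') \<in> Z (2 * length J2)"
    if J2: "set J2 \<subseteq> {1..m}" "set J2' \<subseteq> {1..m}" for J2 J2'
  proof (cases "length J2 = c")
    case True
    let ?H = "\<lambda>j j'. \<Sum>k=1..m. X k j * Y k j'"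
    let ?G = "\<lambda>j j'. \<Sum>k\<in>E. (- X k j) * Y k j'"
    have "(\<Sum>K\<in>?Ks. minor X (?sl K) J2 * minor Y (?sl K) J2') =
        minor (\<lambda>j j'. \<Sum>k\<in>?P. X k j * Y k j') J2 J2'"
      by (simp add: cauchy_binet True)
    also have "(\<lambda>j j'. \<Sum>k\<in>?P. X k j * Y k j') = (\<lambda>j j'. ?H j j' + ?G j j')"
      using E(1) finE by (simp add: sum_diff sum_negf)
    finally have eq: "(\<Sum>K\<in>?Ks. minor X (?sl K) J2 * minor Y (?sl K) J2') =
        minor (\<lambda>j j'. ?H j j' + ?G j j') J2 J2'" .
    \<comment> \<open>the rank of the product over the rows in \<open>E\<close> is less than \<open>c\<close>\<close>
    have noS: "{S. S \<subseteq> E \<and> card S = c} = {}"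
    proof -
      have "card S < c" if "S \<subseteq> E" for S
        using card_mono[OF finE that] E(2) by simp
      then show ?thesis by auto
    qed
    have "minor ?G J2 J2' = 0"
      unfolding cauchy_binet[OF finE] True noS by (rule sum.empty)
    moreover have X1: "X k j * Y k j' \<in> F 2" if "k \<in> {1..m}" "j \<in> set J2" "j' \<in> set J2'" for k j j'
    proof -
      have "X k j * Y k j' \<in> F (1 + 1)"
        by (rule F_mult[OF X_F Y_F]) (use that J2 in blast)+
      then show ?thesis by (simp only: one_add_one)
    qed
    have "minor (\<lambda>j j'. ?H j j' + ?G j j') J2 J2' - minor ?G J2 J2' \<in> Z (2 * length J2)"
    proof (rule minor_perturb)
      show "?H j j' \<in> Z 2" if "j \<in> set J2" "j' \<in> set J2'" for j j'
        using that J2 by (intro XtY) auto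
      show G: "?G j j' \<in> F 2" if "j \<in> set J2" "j' \<in> set J2'" for j j'
        using that E(1) X1 by (auto intro!: add_subgroup_sum[OF F] add_subgroup_uminus[OF F])
      show "?H j j' + ?G j j' \<in> F 2" if "j \<in> set J2" "j' \<in> set J2'" for j j'
        using that X1 G by (intro add_subgroup_add[OF F]) (auto intro!: add_subgroup_sum[OF F])
    qed
    ultimately show ?thesis using eq by simp
  next
    case False
    have "minor X (?sl K) J2 = 0" if "K \<in> ?Ks" for K
      using that False by (intro minor_length_neq) auto
    then have "(\<Sum>K\<in>?Ks. minor X (?sl K) J2 * minor Y (?sl K) J2') = 0" by (intro sum.neutral) auto
    then show ?thesis using add_subgroup_0[OF Z] by simp
  qed
  have "(\<Sum>K\<in>?Ks. minor X (A @ ?sl K) J * minor Y (B @ ?sl K) J') =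
      (\<Sum>(J1, J2, s)\<leftarrow>splits J. \<Sum>(J1', J2', s')\<leftarrow>splits J'. \<Sum>K\<in>?Ks.
        of_int s * of_int s' * (minor X A J1 * minor Y B J1') * (minor X (?sl K) J2 * minor Y (?sl K) J2'))"
    unfolding laplace_rows case_prod_unfold sum_list_product sum_sum_list_swap
    by (intro arg_cong[where f = sum_list] map_cong refl sum.cong) (simp add: mult_ac)
  also have "\<dots> \<in> Z (length J + length J')"
  proof (rule add_subgroup_sum_list[OF Z], clarify, rule add_subgroup_sum_list[OF Z], clarify)
    fix J1 J2 s J1' J2' s'
    assume s: "(J1, J2, s) \<in> set (splits J)" "(J1', J2', s') \<in> set (splits J')"
    have m1: "mset J1 + mset J2 = mset J" and m2: "mset J1' + mset J2' = mset J'"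
      using s splits_mset by blast+
    have sets: "set J1 \<union> set J2 = set J" "set J1' \<union> set J2' = set J'"
      using arg_cong[OF m1, of set_mset] arg_cong[OF m2, of set_mset] by simp_all
    have lens: "length J1 + length J2 = length J" "length J1' + length J2' = length J'"
      using arg_cong[OF m1, of size] arg_cong[OF m2, of size] by simp_all
    let ?inner = "\<Sum>K\<in>?Ks. minor X (?sl K) J2 * minor Y (?sl K) J2'"
    let ?outer = "minor X A J1 * minor Y B J1'"
    have "?outer * ?inner \<in> Z (length J + length J')"
    proof (cases "length A = length J1 \<and> length B = length J1' \<and> length J2 = length J2'")
      case True
      have "minor X A J1 \<in> F (1 * length A)" "minor Y B J1' \<in> F (1 * length B)"
        by (rule minor_F, rule X_F, use sets AB J in blast, use sets AB J in blast)
          (rule minor_F, rule Y_F, use sets AB J in blast, use sets AB J in blast)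
      then have "?outer \<in> F (length A + length B)" by (auto intro: F_mult)
      moreover have "?inner \<in> Z (2 * length J2)" by (rule inner) (use sets J in auto)
      ultimately have "?outer * ?inner \<in> Z (length A + length B + 2 * length J2)"
        by (rule Z_mult)
      also have "length A + length B + 2 * length J2 = length J + length J'"
        using True lens by auto
      finally show ?thesis .
    next
      case False
      have "minor X (?sl K) J2 * minor Y (?sl K) J2' = 0" if "length J2 \<noteq> length J2'" for K
        using minor_length_neq that by (metis mult_zero_left mult_zero_right)
      then have "?outer * ?inner = 0"
        using False minor_length_neq[of A J1 X] minor_length_neq[of B J1' Y]
        by (cases "length J2 = length J2'") auto
      then show ?thesis using add_subgroup_0[OF Z] by simp
    qed
    then have "of_int (s * s') * (?outer * ?inner) \<in> Z (length J + length J')"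
      by (rule add_subgroup_of_int[OF Z])
    then show "(\<Sum>K\<in>?Ks. of_int s * of_int s' * ?outer * (minor X (?sl K) J2 * minor Y (?sl K) J2'))
        \<in> Z (length J + length J')"
      by (simp add: sum_distrib_left mult.assoc)
  qed
  finally show ?thesis .
qed

text \<open>The contraction is applied to the common entries of \<open>I\<close> and \<open>I'\<close> that are at most \<open>j\<close>, with
  \<open>E\<close> the numbers up to \<open>j\<close> that occur in neither. In each other summand some common entries are
  traded for numbers above \<open>j\<close>, because no other number up to \<open>j\<close> is available.\<close>

lemma mixed_step:
  assumes W: "add_subgroup W" and ZW: "Z (length J + length J') \<subseteq> W"
    and sorted: "sorted_wrt (<) I" "sorted_wrt (<) I'"
    and sub: "set I \<subseteq> {1..m}" "set I' \<subseteq> {1..m}" "set J \<subseteq> {1..m}" "set J' \<subseteq> {1..m}"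
    and j: "j \<le> m" "j < card {i \<in> set I. i \<le> j} + card {i \<in> set I'. i \<le> j}"
    and larger: "\<And>K K'. length K = length I \<Longrightarrow> length K' = length I' \<Longrightarrow>
      set K \<subseteq> {1..m} \<Longrightarrow> set K' \<subseteq> {1..m} \<Longrightarrow>
      sum_list I + sum_list I' < sum_list K + sum_list K' \<Longrightarrow>
      minor X K J * minor Y K' J' \<in> W"
  shows "minor X I J * minor Y I' J' \<in> W"
proof -
  let ?sl = sorted_list_of_set
  have dist: "distinct I" "distinct I'" using sorted strict_sorted_iff by blast+
  define C where "C = {i \<in> set I \<inter> set I'. i \<le> j}"
  define E where "E = {1..j} - (set I \<union> set I')"
  define A where "A = ?sl (set I - C)"
  define B where "B = ?sl (set I' - C)"
  have fin: "finite C" "finite E" by (auto simp: C_def E_def)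
  have CI: "C \<subseteq> set I" "C \<subseteq> set I'" by (auto simp: C_def)
  \<comment> \<open>the violated pair condition, by inclusion and exclusion\<close>
  have cE: "card E < card C"
  proof -
    let ?I = "{i \<in> set I. i \<le> j}" and ?I' = "{i \<in> set I'. i \<le> j}"
    have "card ?I + card ?I' = card (?I \<union> ?I') + card (?I \<inter> ?I')"
      by (rule card_Un_Int) auto
    moreover have "?I \<inter> ?I' = C" by (auto simp: C_def)
    moreover have "card (?I \<union> ?I') + card E = card {1..j}"
    proof -
      have "(?I \<union> ?I') \<union> E = {1..j}" "(?I \<union> ?I') \<inter> E = {}"
        using sub by (auto simp: E_def)
      then show ?thesis by (metis (no_types, lifting) card_Un_disjoint finite_Un finite_atLeastAtMost)
    qed
    ultimately show ?thesis using j by simp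
  qed
  let ?P = "{1..m} - E"
  let ?Ks = "{K. K \<subseteq> ?P \<and> card K = card C}"
  let ?T = "\<lambda>K. minor X (A @ ?sl K) J * minor Y (B @ ?sl K) J'"
  have finKs: "finite ?Ks" by simp
  have sum: "(\<Sum>K\<in>?Ks. ?T K) \<in> W"
  proof (rule subsetD[OF ZW], rule contraction)
    show "E \<subseteq> {1..m}" using j(1) by (auto simp: E_def)
    show "set A \<subseteq> {1..m}" "set B \<subseteq> {1..m}" using sub by (auto simp: A_def B_def)
  qed (use cE sub in auto)
  have CK: "C \<in> ?Ks" using sub j(1) by (auto simp: C_def E_def)
  have "?T K \<in> W" if K: "K \<in> ?Ks - {C}" for K
  proof (cases "K \<inter> (set A \<union> set B) = {}")
    case True
    have fK: "finite K" using K finite_subset by auto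
    have less: "x < y" if "x \<in> C - K" "y \<in> K - C" for x y
    proof -
      have "y \<in> {1..m}" "y \<notin> E" "y \<notin> set I - C" "y \<notin> set I' - C"
        using that K True by (auto simp: A_def B_def)
      then have "j < y" using that by (auto simp: E_def)
      then show ?thesis using that by (auto simp: C_def)
    qed
    have "\<Sum>C < \<Sum>K"
      by (rule sum_exchange_less) (use fK fin K less in auto)
    moreover have "\<Sum>(set I) = \<Sum>(set I - C) + \<Sum>C" "\<Sum>(set I') = \<Sum>(set I' - C) + \<Sum>C"
      using CI by (simp_all add: sum.subset_diff)
    moreover have "sum_list (?sl K) = \<Sum>K" if "finite K" for K :: "nat set"
      using that by (simp add: sum_list_distinct_set)
    ultimately have "sum_list I + sum_list I' < sum_list (A @ ?sl K) + sum_list (B @ ?sl K)"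
      using fK by (simp add: A_def B_def sum_list_distinct_set dist)
    moreover have "length (A @ ?sl K) = length I"
      using CI(1) K dist card_mono[OF _ CI(1)] fin by (simp add: A_def card_Diff_subset distinct_card)
    moreover have "length (B @ ?sl K) = length I'"
      using CI(2) K dist card_mono[OF _ CI(2)] fin by (simp add: B_def card_Diff_subset distinct_card)
    ultimately show ?thesis
      using K sub fK by (intro larger) (auto simp: A_def B_def)
  next
    case False
    have fK: "finite K" using K finite_subset by auto
    have "\<not> distinct (A @ ?sl K) \<or> \<not> distinct (B @ ?sl K)"
      using False fK by auto
    then have "?T K = 0" by (metis minor_not_distinct_rows mult_zero_left mult_zero_right)
    then show ?thesis using W by (simp add: add_subgroup_0)
  qed
  then have rest: "(\<Sum>K\<in>?Ks - {C}. ?T K) \<in> W" by (intro add_subgroup_sum[OF W])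
  have split: "(\<Sum>K\<in>?Ks. ?T K) = ?T C + (\<Sum>K\<in>?Ks - {C}. ?T K)"
    by (rule sum.remove[OF finKs CK])
  have TC: "?T C \<in> W"
    using add_subgroup_diff[OF W sum rest] by (simp only: split add_diff_cancel_right')
  have "mset (A @ ?sl C) = mset I"
    by (rule set_eq_iff_mset_eq_distinct[THEN iffD1])
       (use dist CI fin in \<open>auto simp: A_def\<close>)
  moreover have "mset (B @ ?sl C) = mset I'"
    by (rule set_eq_iff_mset_eq_distinct[THEN iffD1])
       (use dist CI fin in \<open>auto simp: B_def\<close>)
  ultimately have "minor X I J * minor Y I' J' = ?T C \<or> minor X I J * minor Y I' J' = - ?T C"
    using minor_permute_rows[of I "A @ ?sl C" X J] minor_permute_rows[of I' "B @ ?sl C" Y J'] by auto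
  then show ?thesis using add_subgroup_sign[OF W TC] by blast
qed

end

section \<open>Straightening products of minors\<close>

type_synonym bicolumns = "(nat list \<times> nat list) list"

definition minor_prod :: "(nat \<Rightarrow> nat \<Rightarrow> 'a::comm_ring_1) \<Rightarrow> bicolumns \<Rightarrow> 'a"
  where "minor_prod X L = (\<Prod>(I, J)\<leftarrow>L. minor X I J)"

definition bicols :: "nat \<Rightarrow> bicolumns \<Rightarrow> bool"
  where "bicols m L \<longleftrightarrow>
    (\<forall>I J. (I, J) \<in> set L \<longrightarrow> length I = length J \<and> set I \<subseteq> {1..m} \<and> set J \<subseteq> {1..m})"

definition bideg :: "bicolumns \<Rightarrow> nat"
  where "bideg L = (\<Sum>(I, J)\<leftarrow>L. length I)"

definition col_le :: "nat list \<Rightarrow> nat list \<Rightarrow> bool"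
  where "col_le c c' \<longleftrightarrow> length c' \<le> length c \<and> (\<forall>i<length c'. c ! i \<le> c' ! i)"

definition std_cols :: "nat \<Rightarrow> nat list list \<Rightarrow> bool"
  where "std_cols m Cs \<longleftrightarrow>
    (\<forall>c\<in>set Cs. c \<noteq> [] \<and> sorted_wrt (<) c \<and> set c \<subseteq> {1..m}) \<and> sorted_wrt col_le Cs"

definition head_col :: "nat list list \<Rightarrow> nat list"
  where "head_col Cs = (case Cs of [] \<Rightarrow> [] | c # _ \<Rightarrow> c)"

definition pair_std :: "nat \<Rightarrow> nat list \<Rightarrow> nat list \<Rightarrow> bool"
  where "pair_std m I I' \<longleftrightarrow>
    (\<forall>j\<in>{1..m}. card {i \<in> set I. i \<le> j} + card {i \<in> set I'. i \<le> j} \<le> j)"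

definition rat_std :: "nat \<Rightarrow> nat list list \<Rightarrow> nat list list \<Rightarrow> bool"
  where "rat_std m Cs Cs' \<longleftrightarrow>
    std_cols m Cs \<and> std_cols m Cs' \<and> pair_std m (head_col Cs) (head_col Cs')"

text \<open>For fixed total length this decreases when columns of lengths \<open>l \<le> k\<close> are replaced by columns one
  of which has length \<open>k + 1\<close>, since \<open>3\<^bsup>k + 1\<^esup>\<close> exceeds \<open>3\<^sup>k + 3\<^sup>l\<close>. The linear term keeps the values
  nonnegative and the summand \<open>1\<close> makes empty columns count zero.\<close>

definition shape_meas :: "nat \<Rightarrow> bicolumns \<Rightarrow> nat"
  where "shape_meas m L = (\<Sum>(I, J)\<leftarrow>L. length I * 3 ^ m + 1 - 3 ^ length I)"

definition entry_meas :: "nat \<Rightarrow> bicolumns \<Rightarrow> nat"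
  where "entry_meas m L = (\<Sum>(I, J)\<leftarrow>L. (\<Sum>i\<leftarrow>I. m - i) + (\<Sum>j\<leftarrow>J. m - j))"

text \<open>Columns further to the left weigh more, so this decreases when entries become smaller in a column
  and larger by the same amount in the next one.\<close>

fun pos_meas :: "bicolumns \<Rightarrow> nat"
  where
    "pos_meas [] = 0"
  | "pos_meas ((I, J) # L) = (sum_list I + sum_list J) * Suc (length L) + pos_meas L"

definition young :: "bicolumns \<Rightarrow> bool"
  where "young L \<longleftrightarrow> sorted_wrt (\<lambda>c c'. length (fst c') \<le> length (fst c)) L \<and>
    (\<forall>I J. (I, J) \<in> set L \<longrightarrow> I \<noteq> [])"

definition strict_cols :: "bicolumns \<Rightarrow> bool"
  where "strict_cols L \<longleftrightarrow>
    (\<forall>I J. (I, J) \<in> set L \<longrightarrow> sorted_wrt (<) I \<and> sorted_wrt (<) J)"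

lemma bicols_simps:
  "bicols m []"
  "bicols m ((I, J) # L) \<longleftrightarrow>
    length I = length J \<and> set I \<subseteq> {1..m} \<and> set J \<subseteq> {1..m} \<and> bicols m L"
  "bicols m (L @ L') \<longleftrightarrow> bicols m L \<and> bicols m L'"
  unfolding bicols_def by (simp, (simp, blast), (simp, blast))

lemma bicolsD:
  assumes "bicols m L" "(I, J) \<in> set L"
  shows "length I = length J" "set I \<subseteq> {1..m}" "set J \<subseteq> {1..m}"
  using assms unfolding bicols_def by blast+

lemma minor_prod_Cons: "minor_prod X ((I, J) # L) = minor X I J * minor_prod X L"
  by (simp add: minor_prod_def)

lemma minor_prod_append: "minor_prod X (L @ L') = minor_prod X L * minor_prod X L'"
  by (simp add: minor_prod_def)

lemma minor_prod_Nil: "minor_prod X [] = 1"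
  by (simp add: minor_prod_def)

lemma minor_prod_swap: "minor_prod (\<lambda>i j. X j i) (map prod.swap L) = minor_prod X L"
proof (induction L)
  case (Cons a L)
  then show ?case by (cases a) (simp add: minor_prod_Cons minor_transpose[of X])
qed (simp add: minor_prod_Nil)

lemma minor_prod_zero:
  assumes "(I, J) \<in> set L" "\<not> distinct I \<or> \<not> distinct J"
  shows "minor_prod X L = 0"
  using assms
proof (induction L)
  case (Cons a L)
  then show ?case
    by (cases a) (auto simp: minor_prod_Cons minor_not_distinct_rows minor_not_distinct_cols)
qed simp

lemma swap_measures:
  assumes "bicols m L"
  shows "bicols m (map prod.swap L)" "bideg (map prod.swap L) = bideg L"
    "shape_meas m (map prod.swap L) = shape_meas m L"
    "entry_meas m (map prod.swap L) = entry_meas m L"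
    "pos_meas (map prod.swap L) = pos_meas L" "young (map prod.swap L) = young L"
proof -
  show "bicols m (map prod.swap L)" using assms by (auto simp: bicols_def)
  have len: "length J = length I" if "(I, J) \<in> set L" for I J
    using assms that by (auto simp: bicols_def)
  show "bideg (map prod.swap L) = bideg L" "shape_meas m (map prod.swap L) = shape_meas m L"
    unfolding bideg_def shape_meas_def using len
    by (auto intro!: arg_cong[where f = sum_list] simp: comp_def case_prod_unfold)
  show "entry_meas m (map prod.swap L) = entry_meas m L"
    unfolding entry_meas_def
    by (auto intro!: arg_cong[where f = sum_list] simp: comp_def case_prod_unfold)
  show "pos_meas (map prod.swap L) = pos_meas L"
    by (induction L) (auto simp: add.commute)
  have "sorted_wrt (\<lambda>c c'. length (snd c') \<le> length (snd c)) L =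
      sorted_wrt (\<lambda>c c'. length (fst c') \<le> length (fst c)) L"
    using len by (auto intro!: iffI elim!: sorted_wrt_mono_rel[rotated])
  moreover have "(\<forall>I J. (I, J) \<in> set L \<longrightarrow> J \<noteq> []) = (\<forall>I J. (I, J) \<in> set L \<longrightarrow> I \<noteq> [])"
    using len by (metis length_0_conv)
  ultimately show "young (map prod.swap L) = young L"
    by (auto simp: young_def sorted_wrt_map)
qed

lemma pos_meas_mono:
  "length R = length R' \<Longrightarrow> pos_meas R' < pos_meas R \<Longrightarrow> pos_meas (P @ R') < pos_meas (P @ R)"
  by (induction P) auto

lemma length_strict_le:
  assumes "sorted_wrt (<) I" "set I \<subseteq> {1..m}"
  shows "length I \<le> m"
proof -
  have "card (set I) \<le> card {1..m}" using assms(2) by (intro card_mono) auto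
  moreover have "distinct I" using assms(1) strict_sorted_iff by blast
  ultimately show ?thesis by (simp add: distinct_card)
qed

lemma shape_meas_longer:
  fixes k l p q m :: nat
  assumes "p + q + Suc k = k + l" "l \<le> k" "Suc k \<le> m"
  defines "f \<equiv> \<lambda>x::nat. x * 3 ^ m + 1 - (3::nat) ^ x"
  shows "f p + f q + f (Suc k) < f k + f l"
proof -
  have ex: "int (f x) = int x * 3 ^ m + 1 - 3 ^ x" if "x \<le> m" for x
  proof -
    have "(3::nat) ^ x \<le> x * 3 ^ m + 1"
    proof (cases x)
      case (Suc y)
      have "(3::nat) ^ x \<le> 3 ^ m" using that by (intro power_increasing) auto
      then show ?thesis using Suc by (simp add: trans_le_add1)
    qed simp
    then show ?thesis by (simp add: f_def of_nat_diff)
  qed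
  have "(3::int) ^ l \<le> 3 ^ k" using assms by (intro power_increasing) auto
  moreover have "(3::int) ^ p \<ge> 1" "(3::int) ^ q \<ge> 1" "(3::int) ^ k \<ge> 1" by simp_all
  moreover have "int p * 3 ^ m + int q * 3 ^ m + int (Suc k) * 3 ^ m = int k * 3 ^ m + int l * 3 ^ m"
  proof -
    have "(int p + int q + int (Suc k)) * 3 ^ m = (int k + int l) * 3 ^ m"
      using assms(1) by (metis of_nat_add)
    then show ?thesis by (simp add: algebra_simps)
  qed
  moreover have "int (f p + f q + f (Suc k)) =
      int p * 3 ^ m + int q * 3 ^ m + int (Suc k) * 3 ^ m + 3 - 3 ^ p - 3 ^ q - 3 * 3 ^ k"
    using ex[of p] ex[of q] ex[of "Suc k"] assms(1,2,3) by simp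
  moreover have "int (f k + f l) = int k * 3 ^ m + int l * 3 ^ m + 2 - 3 ^ k - 3 ^ l"
    using ex[of k] ex[of l] assms(2,3) by simp
  ultimately have "int (f p + f q + f (Suc k)) < int (f k + f l)" by linarith
  then show ?thesis by simp
qed

lemma col_le_trans: "col_le a b \<Longrightarrow> col_le b c \<Longrightarrow> col_le a c"
  unfolding col_le_def
proof (elim conjE, intro conjI allI impI)
  fix i assume "\<forall>i<length b. a ! i \<le> b ! i" "\<forall>i<length c. b ! i \<le> c ! i" "i < length c"
    "length c \<le> length b"
  then have "a ! i \<le> b ! i" "b ! i \<le> c ! i" by auto
  then show "a ! i \<le> c ! i" by simp
qed simp

lemma sum_list_map_mset_eq:
  fixes f :: "'a \<Rightarrow> nat"
  assumes "mset A + mset B = mset C + mset D"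
  shows "sum_list (map f A) + sum_list (map f B) = sum_list (map f C) + sum_list (map f D)"
proof -
  have "sum_mset (image_mset f (mset A + mset B)) = sum_mset (image_mset f (mset C + mset D))"
    by (simp only: assms)
  then show ?thesis by (simp add: sum_mset_sum_list flip: mset_map)
qed

lemma garnir_side:
  fixes X :: "nat \<Rightarrow> nat \<Rightarrow> 'a::comm_ring_1"
  assumes W: "add_subgroup W" and L: "bicols m L" "young L" "strict_cols L"
    and nstd: "\<not> std_cols m (map fst L)"
    and longer: "\<And>L'. bicols m L' \<Longrightarrow> bideg L' = bideg L \<Longrightarrow> shape_meas m L' < shape_meas m L \<Longrightarrow>
      minor_prod X L' \<in> W"
    and same: "\<And>L'. bicols m L' \<Longrightarrow> young L' \<Longrightarrow> bideg L' = bideg L \<Longrightarrow>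
      shape_meas m L' = shape_meas m L \<Longrightarrow> entry_meas m L' = entry_meas m L \<Longrightarrow>
      pos_meas L' < pos_meas L \<Longrightarrow> minor_prod X L' \<in> W"
  shows "minor_prod X L \<in> W"
proof -
  have "\<not> sorted_wrt col_le (map fst L)"
  proof
    assume "sorted_wrt col_le (map fst L)"
    moreover have "c \<noteq> [] \<and> sorted_wrt (<) c \<and> set c \<subseteq> {1..m}" if c: "c \<in> set (map fst L)" for c
    proof -
      obtain p where p: "p \<in> set L" "c = fst p" using c by auto
      have "(c, snd p) \<in> set L" using p by simp
      then show ?thesis
        using L bicolsD(2)[OF L(1)] unfolding young_def strict_cols_def by blast
    qed
    ultimately show False using nstd unfolding std_cols_def by blast
  qed
  moreover have "transp col_le" by (rule transpI) (rule col_le_trans)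
  ultimately obtain k where k: "Suc k < length L" "\<not> col_le (fst (L ! k)) (fst (L ! Suc k))"
    by (auto simp: sorted_wrt_iff_nth_Suc_transp)
  obtain I J where IJ: "L ! k = (I, J)" by (cases "L ! k")
  obtain I' J' where IJ': "L ! Suc k = (I', J')" by (cases "L ! Suc k")
  define P where "P = take k L"
  define Q where "Q = drop (Suc (Suc k)) L"
  have Leq: "L = P @ (I, J) # (I', J') # Q"
    using k(1) unfolding P_def Q_def
    by (metis IJ IJ' Cons_nth_drop_Suc Suc_lessD append_take_drop_id)
  have nle: "\<not> col_le I I'" using k(2) IJ IJ' by simp
  have len: "length I' \<le> length I" using L(2) by (simp add: young_def Leq sorted_wrt_append)
  obtain i where i: "i < length I'" "I' ! i < I ! i"
    using nle len by (auto simp: col_le_def not_le)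
  have c: "length J = length I" "length J' = length I'" "set I \<subseteq> {1..m}" "set I' \<subseteq> {1..m}"
    "set J \<subseteq> {1..m}" "set J' \<subseteq> {1..m}"
    using L(1) by (simp_all add: bicols_simps Leq)
  have srt: "sorted_wrt (<) I" "sorted_wrt (<) I'"
    using L(3) by (auto simp: strict_cols_def Leq)
  define r where "r = minor_prod X (P @ Q)"
  have "minor X I J * minor X I' J' \<in> {z. z * r \<in> W}"
  proof (rule garnir_step[OF add_subgroup_residual[OF W] srt c(1,2) _ i])
    show "i < length I" using i len by simp
  next
    fix K K'
    assume K: "length K = length I" "length K' = length I'"
      "mset K + mset K' = mset I + mset I'" "sum_list K < sum_list I"
    let ?L = "P @ (K, J) # (K', J') # Q"
    have sets: "set K \<union> set K' = set I \<union> set I'"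
      using arg_cong[OF K(3), of set_mset] by simp
    have sums: "sum_list K + sum_list K' = sum_list I + sum_list I'"
      using sum_list_map_mset_eq[OF K(3), of "\<lambda>x. x"] by simp
    have "minor_prod X ?L \<in> W"
    proof (rule same)
      show "bicols m ?L" using L(1) sets c K by (auto simp: bicols_simps Leq simp del: atLeastAtMost_iff)
      show "young ?L" using L(2) K by (auto simp: young_def Leq sorted_wrt_append)
      show "bideg ?L = bideg L" by (simp add: bideg_def Leq K)
      show "shape_meas m ?L = shape_meas m L" by (simp add: shape_meas_def Leq K)
      show "entry_meas m ?L = entry_meas m L"
        using sum_list_map_mset_eq[OF K(3), of "\<lambda>i. m - i"] by (simp add: entry_meas_def Leq)
      have "pos_meas ((K, J) # (K', J') # Q) < pos_meas ((I, J) # (I', J') # Q)"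
      proof -
        have "sum_list K * Suc (length Q) + sum_list K' * Suc (length Q) =
            sum_list I * Suc (length Q) + sum_list I' * Suc (length Q)"
          using sums by (metis add_mult_distrib)
        then show ?thesis using K(4) by (simp add: algebra_simps)
      qed
      then show "pos_meas ?L < pos_meas L" unfolding Leq by (rule pos_meas_mono[rotated]) simp
    qed
    then show "minor X K J * minor X K' J' \<in> {z. z * r \<in> W}"
      by (simp add: r_def minor_prod_append minor_prod_Cons mult_ac)
  next
    fix A B K J1 J2 J3
    assume K: "length A = length J1" "length B = length J2" "length K = length J3"
      "length K = Suc (length I)" "mset A + mset B + mset K = mset I + mset I'"
      "mset J1 + mset J2 + mset J3 = mset J + mset J'"
    have sets: "set A \<union> set B \<union> set K = set I \<union> set I'" "set J1 \<union> set J2 \<union> set J3 = set J \<union> set J'"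
      using arg_cong[OF K(5), of set_mset] arg_cong[OF K(6), of set_mset] by simp_all
    have lens: "length A + length B + length K = length I + length I'"
      using arg_cong[OF K(5), of size] by simp
    show "minor X A J1 * minor X B J2 * minor X K J3 \<in> {z. z * r \<in> W}"
    proof (cases "distinct K")
      case True
      let ?L = "(A, J1) # (B, J2) # (K, J3) # P @ Q"
      have "card (set K) \<le> card {1..m}" using sets c by (intro card_mono) auto
      then have "Suc (length I) \<le> m" using True K(4) by (simp add: distinct_card)
      then have lt: "(length A * 3 ^ m + 1 - 3 ^ length A) + (length B * 3 ^ m + 1 - 3 ^ length B) +
          (length K * 3 ^ m + 1 - 3 ^ length K) <
          (length I * 3 ^ m + 1 - 3 ^ length I) + (length I' * 3 ^ m + 1 - 3 ^ length I')"
        using shape_meas_longer[of "length A" "length B" "length I" "length I'" m] lens len K(4)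
        by simp
      have "minor_prod X ?L \<in> W"
      proof (rule longer)
        show "bicols m ?L" using L(1) sets c K by (auto simp: bicols_simps Leq simp del: atLeastAtMost_iff)
        show "bideg ?L = bideg L" using lens by (simp add: bideg_def Leq)
        show "shape_meas m ?L < shape_meas m L" using lt by (simp add: shape_meas_def Leq)
      qed
      then show ?thesis by (simp add: r_def minor_prod_Cons minor_prod_append mult_ac)
    next
      case False
      then show ?thesis using W by (simp add: minor_not_distinct_rows add_subgroup_0)
    qed
  qed
  then show ?thesis by (simp add: r_def Leq minor_prod_Cons minor_prod_append mult_ac)
qed

text \<open>Transposition of \<open>X\<close> exchanges the two components of a bitableau.\<close>

lemma garnir_side_cols:
  fixes X :: "nat \<Rightarrow> nat \<Rightarrow> 'a::comm_ring_1"
  assumes W: "add_subgroup W" and L: "bicols m L" "young L" "strict_cols L"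
    and nstd: "\<not> std_cols m (map snd L)"
    and longer: "\<And>L'. bicols m L' \<Longrightarrow> bideg L' = bideg L \<Longrightarrow> shape_meas m L' < shape_meas m L \<Longrightarrow>
      minor_prod X L' \<in> W"
    and same: "\<And>L'. bicols m L' \<Longrightarrow> young L' \<Longrightarrow> bideg L' = bideg L \<Longrightarrow>
      shape_meas m L' = shape_meas m L \<Longrightarrow> entry_meas m L' = entry_meas m L \<Longrightarrow>
      pos_meas L' < pos_meas L \<Longrightarrow> minor_prod X L' \<in> W"
  shows "minor_prod X L \<in> W"
proof -
  have transfer: "minor_prod (\<lambda>i j. X j i) L' = minor_prod X (map prod.swap L')" for L'
    using minor_prod_swap[of X "map prod.swap L'"] by (simp add: comp_def)
  note sw = swap_measures[OF L(1)]
  have "minor_prod (\<lambda>i j. X j i) (map prod.swap L) \<in> W"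
  proof (rule garnir_side[OF W, of m])
    show "bicols m (map prod.swap L)" "young (map prod.swap L)"
      using L sw by simp_all
    show "strict_cols (map prod.swap L)" using L(3) by (auto simp: strict_cols_def)
    show "\<not> std_cols m (map fst (map prod.swap L))" using nstd by (simp add: comp_def)
  next
    fix L' assume "bicols m L'" "bideg L' = bideg (map prod.swap L)"
      "shape_meas m L' < shape_meas m (map prod.swap L)"
    then show "minor_prod (\<lambda>i j. X j i) L' \<in> W"
      unfolding transfer sw by (intro longer) (simp_all add: swap_measures[of m])
  next
    fix L' assume "bicols m L'" "young L'" "bideg L' = bideg (map prod.swap L)"
      "shape_meas m L' = shape_meas m (map prod.swap L)"
      "entry_meas m L' = entry_meas m (map prod.swap L)"
      "pos_meas L' < pos_meas (map prod.swap L)"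
    then show "minor_prod (\<lambda>i j. X j i) L' \<in> W"
      unfolding transfer sw by (intro same) (simp_all add: swap_measures[of m])
  qed
  then show ?thesis by (simp add: minor_prod_swap)
qed

context matrix_pair
begin

lemma minor_prod_F:
  assumes "bicols m L" "\<And>i j. i \<in> {1..m} \<Longrightarrow> j \<in> {1..m} \<Longrightarrow> A i j \<in> F 1"
  shows "minor_prod A L \<in> F (bideg L)"
  using assms(1)
proof (induction L)
  case Nil then show ?case using F_one by (simp add: minor_prod_Nil bideg_def)
next
  case (Cons c L)
  obtain I J where c: "c = (I, J)" by (cases c)
  have "minor A I J \<in> F (1 * length I)"
    by (rule minor_F, rule assms(2)) (use Cons.prems in \<open>unfold c bicols_simps, blast+\<close>)
  moreover have "minor_prod A L \<in> F (bideg L)"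
    using Cons by (simp add: c bicols_simps)
  ultimately have "minor A I J * minor_prod A L \<in> F (length I + bideg L)"
    by (auto intro: F_mult)
  then show ?case by (simp add: c minor_prod_Cons bideg_def)
qed

lemma mixed_side:
  assumes V: "add_subgroup V" and ZV: "Z (bideg L1 + bideg L2) \<subseteq> V"
    and L: "bicols m L1" "bicols m L2" "young L1" "young L2" "strict_cols L1" "strict_cols L2"
    and npair: "\<not> pair_std m (head_col (map fst L1)) (head_col (map fst L2))"
    and larger: "\<And>L1' L2'. bicols m L1' \<Longrightarrow> bicols m L2' \<Longrightarrow> young L1' \<Longrightarrow> young L2' \<Longrightarrow>
      bideg L1' = bideg L1 \<Longrightarrow> bideg L2' = bideg L2 \<Longrightarrow>
      shape_meas m L1' = shape_meas m L1 \<Longrightarrow> shape_meas m L2' = shape_meas m L2 \<Longrightarrow>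
      entry_meas m L1' + entry_meas m L2' < entry_meas m L1 + entry_meas m L2 \<Longrightarrow>
      minor_prod X L1' * minor_prod Y L2' \<in> V"
  shows "minor_prod X L1 * minor_prod Y L2 \<in> V"
proof -
  obtain j where j: "j \<in> {1..m}"
    "j < card {i \<in> set (head_col (map fst L1)). i \<le> j} + card {i \<in> set (head_col (map fst L2)). i \<le> j}"
    using npair by (auto simp: pair_std_def not_le)
  have bound: "card {i \<in> set I. i \<le> j} \<le> j" if "set I \<subseteq> {1..m}" for I
  proof -
    have "card {i \<in> set I. i \<le> j} \<le> card {1..j}" using that by (intro card_mono) auto
    then show ?thesis by simp
  qed
  have sub: "set (head_col (map fst L1)) \<subseteq> {1..m}" "set (head_col (map fst L2)) \<subseteq> {1..m}"
  proof -
    have "set (head_col (map fst L)) \<subseteq> {1..m}" if "bicols m L" for L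
      using that by (cases L) (auto simp: bicols_simps head_col_def simp del: atLeastAtMost_iff)
    then show "set (head_col (map fst L1)) \<subseteq> {1..m}" "set (head_col (map fst L2)) \<subseteq> {1..m}"
      using L(1,2) by blast+
  qed
  have "L1 \<noteq> []" "L2 \<noteq> []"
    using j(2) bound[OF sub(1)] bound[OF sub(2)] by (auto simp: head_col_def)
  then obtain I J R1 I' J' R2 where eq: "L1 = (I, J) # R1" "L2 = (I', J') # R2"
    by (metis list.exhaust prod.exhaust)
  have c: "length J = length I" "length J' = length I'" "set I \<subseteq> {1..m}" "set I' \<subseteq> {1..m}"
    "set J \<subseteq> {1..m}" "set J' \<subseteq> {1..m}"
    using L(1,2) by (simp_all add: bicols_simps eq)
  have srt: "sorted_wrt (<) I" "sorted_wrt (<) I'"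
    using L(5,6) by (auto simp: strict_cols_def eq)
  define r where "r = minor_prod X R1 * minor_prod Y R2"
  have bR: "bicols m R1" "bicols m R2" using L(1,2) by (simp_all add: bicols_simps eq)
  have r: "r \<in> F (bideg R1 + bideg R2)"
    unfolding r_def by (intro F_mult minor_prod_F bR X_F Y_F)
  have conv: "sum_list A + (\<Sum>i\<leftarrow>A. m - i) = m * length A" if "set A \<subseteq> {1..m}" for A :: "nat list"
    using that by (induction A) auto
  have "minor X I J * minor Y I' J' \<in> {z. z * r \<in> V}"
  proof (rule mixed_step[OF add_subgroup_residual[OF V] _ srt c(3-6), where j = j])
    show "Z (length J + length J') \<subseteq> {z. z * r \<in> V}"
    proof clarify
      fix z assume "z \<in> Z (length J + length J')"
      then have "r * z \<in> Z (bideg R1 + bideg R2 + (length J + length J'))"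
        using Z_mult[OF r] by blast
      also have "bideg R1 + bideg R2 + (length J + length J') = bideg L1 + bideg L2"
        using c by (simp add: eq bideg_def)
      finally show "z * r \<in> V" using ZV by (auto simp: mult.commute)
    qed
    show "j \<le> m" using j by simp
    show "j < card {i \<in> set I. i \<le> j} + card {i \<in> set I'. i \<le> j}"
      using j by (simp add: eq head_col_def)
  next
    fix K K' assume K: "length K = length I" "length K' = length I'" "set K \<subseteq> {1..m}" "set K' \<subseteq> {1..m}"
      "sum_list I + sum_list I' < sum_list K + sum_list K'"
    have "minor_prod X ((K, J) # R1) * minor_prod Y ((K', J') # R2) \<in> V"
    proof (rule larger)
      show "bicols m ((K, J) # R1)" "bicols m ((K', J') # R2)"
        using bR c K by (simp_all add: bicols_simps)
      show "young ((K, J) # R1)" "young ((K', J') # R2)"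
        using L(3,4) K by (auto simp: young_def eq)
      show "bideg ((K, J) # R1) = bideg L1" "bideg ((K', J') # R2) = bideg L2"
        "shape_meas m ((K, J) # R1) = shape_meas m L1" "shape_meas m ((K', J') # R2) = shape_meas m L2"
        by (simp_all add: eq bideg_def shape_meas_def K)
      have "(\<Sum>i\<leftarrow>K. m - i) + (\<Sum>i\<leftarrow>K'. m - i) < (\<Sum>i\<leftarrow>I. m - i) + (\<Sum>i\<leftarrow>I'. m - i)"
        using conv[OF K(3)] conv[OF K(4)] conv[OF c(3)] conv[OF c(4)] K by simp
      then show "entry_meas m ((K, J) # R1) + entry_meas m ((K', J') # R2) < entry_meas m L1 + entry_meas m L2"
        by (simp add: entry_meas_def eq)
    qed
    then show "minor X K J * minor Y K' J' \<in> {z. z * r \<in> V}"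
      by (simp add: minor_prod_Cons r_def mult_ac)
  qed
  then show ?thesis by (simp add: eq minor_prod_Cons r_def mult_ac)
qed

end

lemma mixed_side_cols:
  assumes M: "matrix_pair m X Y F Z"
    and V: "add_subgroup V" and ZV: "Z (bideg L1 + bideg L2) \<subseteq> V"
    and L: "bicols m L1" "bicols m L2" "young L1" "young L2" "strict_cols L1" "strict_cols L2"
    and npair: "\<not> pair_std m (head_col (map snd L1)) (head_col (map snd L2))"
    and larger: "\<And>L1' L2'. bicols m L1' \<Longrightarrow> bicols m L2' \<Longrightarrow> young L1' \<Longrightarrow> young L2' \<Longrightarrow>
      bideg L1' = bideg L1 \<Longrightarrow> bideg L2' = bideg L2 \<Longrightarrow>
      shape_meas m L1' = shape_meas m L1 \<Longrightarrow> shape_meas m L2' = shape_meas m L2 \<Longrightarrow>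
      entry_meas m L1' + entry_meas m L2' < entry_meas m L1 + entry_meas m L2 \<Longrightarrow>
      minor_prod X L1' * minor_prod Y L2' \<in> V"
  shows "minor_prod X L1 * minor_prod Y L2 \<in> V"
proof -
  interpret T: matrix_pair m "\<lambda>i j. X j i" "\<lambda>i j. Y j i" F Z
    by (rule matrix_pair.transpose[OF M])
  have transfer: "minor_prod (\<lambda>i j. A j i) L' = minor_prod A (map prod.swap L')"
    for L' and A :: "nat \<Rightarrow> nat \<Rightarrow> 'a"
    using minor_prod_swap[of A "map prod.swap L'"] by (simp add: comp_def)
  note sw = swap_measures[OF L(1)] swap_measures[OF L(2)]
  have "minor_prod (\<lambda>i j. X j i) (map prod.swap L1) * minor_prod (\<lambda>i j. Y j i) (map prod.swap L2) \<in> V"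
  proof (rule T.mixed_side[OF V])
    show "\<not> pair_std m (head_col (map fst (map prod.swap L1))) (head_col (map fst (map prod.swap L2)))"
      using npair by (simp add: comp_def)
  next
    fix L1' L2'
    assume "bicols m L1'" "bicols m L2'" "young L1'" "young L2'"
      "bideg L1' = bideg (map prod.swap L1)" "bideg L2' = bideg (map prod.swap L2)"
      "shape_meas m L1' = shape_meas m (map prod.swap L1)" "shape_meas m L2' = shape_meas m (map prod.swap L2)"
      "entry_meas m L1' + entry_meas m L2' < entry_meas m (map prod.swap L1) + entry_meas m (map prod.swap L2)"
    then show "minor_prod (\<lambda>i j. X j i) L1' * minor_prod (\<lambda>i j. Y j i) L2' \<in> V"
      unfolding transfer[of X] transfer[of Y] sw by (intro larger) (simp_all add: swap_measures[of m])
  qed (use L ZV in \<open>simp_all add: sw\<close>, auto simp: strict_cols_def)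
  then show ?thesis by (simp add: minor_prod_swap)
qed

text \<open>Exchange steps can destroy the order of the columns by length and create empty columns; this
  restores both without changing the product or its shape measure.\<close>

definition normalize_cols :: "bicolumns \<Rightarrow> bicolumns"
  where "normalize_cols L = rev (sort_key (length \<circ> fst) (filter (\<lambda>c. fst c \<noteq> []) L))"

lemma sum_list_normalize:
  fixes f :: "nat list \<times> nat list \<Rightarrow> nat"
  assumes "\<And>c. c \<in> set L \<Longrightarrow> fst c = [] \<Longrightarrow> f c = 0"
  shows "(\<Sum>c\<leftarrow>normalize_cols L. f c) = (\<Sum>c\<leftarrow>L. f c)"
proof -
  have "(\<Sum>c\<leftarrow>normalize_cols L. f c) = sum_mset (image_mset f (mset (normalize_cols L)))"
    by (simp flip: mset_map add: sum_mset_sum_list)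
  also have "mset (normalize_cols L) = mset (filter (\<lambda>c. fst c \<noteq> []) L)"
    by (simp add: normalize_cols_def)
  also have "sum_mset (image_mset f \<dots>) = (\<Sum>c\<leftarrow>filter (\<lambda>c. fst c \<noteq> []) L. f c)"
    by (simp flip: mset_map add: sum_mset_sum_list del: mset_filter)
  also have "\<dots> = (\<Sum>c\<leftarrow>L. f c)"
    using assms by (induction L) auto
  finally show ?thesis .
qed

lemma normalize_cols:
  assumes "bicols m L"
  shows "bicols m (normalize_cols L)" "young (normalize_cols L)" "bideg (normalize_cols L) = bideg L"
    "shape_meas m (normalize_cols L) = shape_meas m L"
    "minor_prod X (normalize_cols L) = minor_prod X L"
proof -
  show "bicols m (normalize_cols L)" using assms by (auto simp: bicols_def normalize_cols_def)
  have "sorted (map (length \<circ> fst) (sort_key (length \<circ> fst) (filter (\<lambda>c. fst c \<noteq> []) L)))" by simp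
  then show "young (normalize_cols L)"
    by (auto simp: young_def normalize_cols_def sorted_wrt_rev sorted_map)
  show "bideg (normalize_cols L) = bideg L" "shape_meas m (normalize_cols L) = shape_meas m L"
    unfolding bideg_def shape_meas_def by (rule sum_list_normalize; force)+
  have "minor_prod X (normalize_cols L) =
      prod_mset (image_mset (\<lambda>(I, J). minor X I J) (mset (normalize_cols L)))"
    by (simp flip: mset_map add: prod_mset_prod_list minor_prod_def)
  also have "mset (normalize_cols L) = mset (filter (\<lambda>c. fst c \<noteq> []) L)"
    by (simp add: normalize_cols_def)
  also have "prod_mset (image_mset (\<lambda>(I, J). minor X I J) \<dots>) = minor_prod X (filter (\<lambda>c. fst c \<noteq> []) L)"
    by (simp flip: mset_map add: prod_mset_prod_list minor_prod_def del: mset_filter)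
  also have "\<dots> = minor_prod X L"
    using assms
  proof (induction L)
    case (Cons c L)
    obtain I J where c: "c = (I, J)" by (cases c)
    have "minor X I J = 1" if "I = []" using Cons.prems that by (auto simp: c bicols_simps minor_Nil)
    moreover have "minor_prod X (filter (\<lambda>c. fst c \<noteq> []) L) = minor_prod X L"
      using Cons by (simp add: c bicols_simps)
    ultimately show ?case by (auto simp: c minor_prod_Cons)
  qed simp
  finally show "minor_prod X (normalize_cols L) = minor_prod X L" .
qed

lemma sort_cols:
  assumes "bicols m L" "young L" "\<forall>I J. (I, J) \<in> set L \<longrightarrow> distinct I \<and> distinct J"
  defines "S \<equiv> map (map_prod sort sort) L"
  shows "bicols m S" "young S" "strict_cols S" "bideg S = bideg L"
    "shape_meas m S = shape_meas m L" "entry_meas m S = entry_meas m L" "pos_meas S = pos_meas L"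
    "minor_prod X L = minor_prod X S \<or> minor_prod X L = - minor_prod X S"
proof -
  show "bicols m S" using assms(1) unfolding bicols_def S_def by fastforce
  have "sort I = [] \<longleftrightarrow> I = []" for I :: "nat list"
    by (metis length_0_conv length_sort)
  then show "young S" using assms(2) by (auto simp: young_def S_def sorted_wrt_map)
  show "strict_cols S" using assms(3) by (auto simp: strict_cols_def S_def strict_sorted_iff)
  show "bideg S = bideg L" "shape_meas m S = shape_meas m L"
    by (simp_all add: bideg_def shape_meas_def S_def comp_def case_prod_unfold)
  have s: "(\<Sum>i\<leftarrow>sort I. f i) = (\<Sum>i\<leftarrow>I. f i)" for I and f :: "nat \<Rightarrow> nat"
    using sum_list_map_mset_eq[of "sort I" "[]" I "[]" f] by simp
  show "entry_meas m S = entry_meas m L"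
    by (simp add: entry_meas_def S_def comp_def case_prod_unfold s)
  have s': "sum_list (sort I) = sum_list I" for I :: "nat list" using s[of "\<lambda>x. x" I] by simp
  show "pos_meas S = pos_meas L" unfolding S_def by (induction L) (auto simp: s')
  show "minor_prod X L = minor_prod X S \<or> minor_prod X L = - minor_prod X S"
    unfolding S_def
  proof (induction L)
    case (Cons c L)
    obtain I J where c: "c = (I, J)" by (cases c)
    have "minor X I J = minor X (sort I) J \<or> minor X I J = - minor X (sort I) J"
      by (rule minor_permute_rows) simp
    moreover have "minor X (sort I) J = minor X (sort I) (sort J) \<or>
        minor X (sort I) J = - minor X (sort I) (sort J)"
      unfolding minor_transpose[of X "sort I"] by (rule minor_permute_rows) simp
    ultimately show ?case using Cons.IH by (auto simp: c minor_prod_Cons)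
  qed simp
qed

text \<open>The induction is on the lexicographic combination of three measures. The exchange inside one
  tableau lowers the first, or keeps the first two and lowers the third; the exchange between the
  two tableaux keeps the first and lowers the second.\<close>

theorem (in matrix_pair) straightening:
  assumes V: "add_subgroup V" and ZV: "Z n \<subseteq> V"
    and std: "\<And>L1 L2. bicols m L1 \<Longrightarrow> bicols m L2 \<Longrightarrow> bideg L1 + bideg L2 = n \<Longrightarrow>
      rat_std m (map fst L1) (map fst L2) \<Longrightarrow> rat_std m (map snd L1) (map snd L2) \<Longrightarrow>
      minor_prod X L1 * minor_prod Y L2 \<in> V"
    and L: "bicols m L1" "bicols m L2" "bideg L1 + bideg L2 = n"
  shows "minor_prod X L1 * minor_prod Y L2 \<in> V"
proof -
  define \<mu> where "\<mu> = measures [\<lambda>(L1, L2). shape_meas m L1 + shape_meas m L2,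
    \<lambda>(L1, L2). entry_meas m L1 + entry_meas m L2, \<lambda>(L1, L2). pos_meas L1 + pos_meas L2]"
  have wf: "wf \<mu>" by (simp add: \<mu>_def)
  have main: "minor_prod X (fst LL) * minor_prod Y (snd LL) \<in> V"
    if "bicols m (fst LL)" "bicols m (snd LL)" "young (fst LL)" "young (snd LL)"
      "bideg (fst LL) + bideg (snd LL) = n" for LL
    using wf that
  proof (induction LL rule: wf_induct_rule)
    case (less LL)
    obtain L1 L2 where LL: "LL = (L1, L2)" by (cases LL)
    have b: "bicols m L1" "bicols m L2" "young L1" "young L2" "bideg L1 + bideg L2 = n"
      using less.prems by (simp_all add: LL)
    have IH: "minor_prod X L1' * minor_prod Y L2' \<in> V"
      if "((L1', L2'), (L1, L2)) \<in> \<mu>" "bicols m L1'" "bicols m L2'" "young L1'" "young L2'"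
        "bideg L1' + bideg L2' = n" for L1' L2'
      using less.IH[of "(L1', L2')"] that by (simp add: LL)
    have IHs: "minor_prod X L1' * minor_prod Y L2' \<in> V"
      if "shape_meas m L1' + shape_meas m L2' < shape_meas m L1 + shape_meas m L2"
        "bicols m L1'" "bicols m L2'" "bideg L1' + bideg L2' = n" for L1' L2'
      using IH[of "normalize_cols L1'" "normalize_cols L2'"] that
      by (simp add: normalize_cols[of m] \<mu>_def)
    show ?case
    proof (cases "\<exists>(I, J)\<in>set L1 \<union> set L2. \<not> distinct I \<or> \<not> distinct J")
      case True
      then have "minor_prod X L1 = 0 \<or> minor_prod Y L2 = 0"
        using minor_prod_zero by blast
      then show ?thesis using V by (auto simp: LL add_subgroup_0)
    next
      case False
      define S1 where "S1 = map (map_prod sort sort) L1"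
      define S2 where "S2 = map (map_prod sort sort) L2"
      have d1: "\<forall>I J. (I, J) \<in> set L1 \<longrightarrow> distinct I \<and> distinct J"
        and d2: "\<forall>I J. (I, J) \<in> set L2 \<longrightarrow> distinct I \<and> distinct J"
        using False by auto
      note s1 = sort_cols[OF b(1,3) d1, folded S1_def]
      note s2 = sort_cols[OF b(2,4) d2, folded S2_def]
      have deg: "bideg S1 + bideg S2 = n" using b s1 s2 by simp
      have W1: "add_subgroup {z. z * minor_prod Y S2 \<in> V}"
        by (rule add_subgroup_residual[OF V])
      have W2: "add_subgroup {z. z * minor_prod X S1 \<in> V}"
        by (rule add_subgroup_residual[OF V])
      have "minor_prod X S1 * minor_prod Y S2 \<in> V"
      proof -
        consider (std) "rat_std m (map fst S1) (map fst S2)" "rat_std m (map snd S1) (map snd S2)"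
          | (x) "\<not> std_cols m (map fst S1) \<or> \<not> std_cols m (map snd S1)"
          | (y) "\<not> std_cols m (map fst S2) \<or> \<not> std_cols m (map snd S2)"
          | (fp) "\<not> pair_std m (head_col (map fst S1)) (head_col (map fst S2))"
          | (sp) "\<not> pair_std m (head_col (map snd S1)) (head_col (map snd S2))"
          unfolding rat_std_def by blast
        then show ?thesis
        proof cases
          case std
          then show ?thesis using assms(3) s1 s2 deg by blast
        next
          case x
          let ?W = "{z. z * minor_prod Y S2 \<in> V}"
          have longer: "minor_prod X L' \<in> ?W"
            if "bicols m L'" "bideg L' = bideg S1" "shape_meas m L' < shape_meas m S1" for L'
            using IHs[of L' S2] that s1 s2 deg by simp
          have same: "minor_prod X L' \<in> ?W"
            if "bicols m L'" "young L'" "bideg L' = bideg S1" "shape_meas m L' = shape_meas m S1"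
              "entry_meas m L' = entry_meas m S1" "pos_meas L' < pos_meas S1" for L'
            using IH[of L' S2] that s1 s2 deg by (simp add: \<mu>_def)
          have "minor_prod X S1 \<in> ?W"
            using x
          proof
            assume "\<not> std_cols m (map fst S1)"
            then show ?thesis by (rule garnir_side[OF W1 s1(1-3) _ longer same])
          next
            assume "\<not> std_cols m (map snd S1)"
            then show ?thesis by (rule garnir_side_cols[OF W1 s1(1-3) _ longer same])
          qed
          then show ?thesis by simp
        next
          case y
          let ?W = "{z. z * minor_prod X S1 \<in> V}"
          have longer: "minor_prod Y L' \<in> ?W"
            if "bicols m L'" "bideg L' = bideg S2" "shape_meas m L' < shape_meas m S2" for L'
            using IHs[of S1 L'] that s1 s2 deg by (simp add: mult.commute)
          have same: "minor_prod Y L' \<in> ?W"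
            if "bicols m L'" "young L'" "bideg L' = bideg S2" "shape_meas m L' = shape_meas m S2"
              "entry_meas m L' = entry_meas m S2" "pos_meas L' < pos_meas S2" for L'
            using IH[of S1 L'] that s1 s2 deg by (simp add: \<mu>_def mult.commute)
          have "minor_prod Y S2 \<in> ?W"
            using y
          proof
            assume "\<not> std_cols m (map fst S2)"
            then show ?thesis by (rule garnir_side[OF W2 s2(1-3) _ longer same])
          next
            assume "\<not> std_cols m (map snd S2)"
            then show ?thesis by (rule garnir_side_cols[OF W2 s2(1-3) _ longer same])
          qed
          then show ?thesis by (simp add: mult.commute)
        next
          case fp
          show ?thesis
          proof (rule mixed_side[OF V _ s1(1) s2(1) s1(2) s2(2) s1(3) s2(3) fp])
            show "Z (bideg S1 + bideg S2) \<subseteq> V" using ZV deg by simp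
          next
            fix L1' L2'
            assume "bicols m L1'" "bicols m L2'" "young L1'" "young L2'"
              "bideg L1' = bideg S1" "bideg L2' = bideg S2"
              "shape_meas m L1' = shape_meas m S1" "shape_meas m L2' = shape_meas m S2"
              "entry_meas m L1' + entry_meas m L2' < entry_meas m S1 + entry_meas m S2"
            then show "minor_prod X L1' * minor_prod Y L2' \<in> V"
              using s1 s2 deg by (intro IH) (simp_all add: \<mu>_def)
          qed
        next
          case sp
          show ?thesis
          proof (rule mixed_side_cols[OF matrix_pair_axioms V _ s1(1) s2(1) s1(2) s2(2) s1(3) s2(3) sp])
            show "Z (bideg S1 + bideg S2) \<subseteq> V" using ZV deg by simp
          next
            fix L1' L2'
            assume "bicols m L1'" "bicols m L2'" "young L1'" "young L2'"
              "bideg L1' = bideg S1" "bideg L2' = bideg S2"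
              "shape_meas m L1' = shape_meas m S1" "shape_meas m L2' = shape_meas m S2"
              "entry_meas m L1' + entry_meas m L2' < entry_meas m S1 + entry_meas m S2"
            then show "minor_prod X L1' * minor_prod Y L2' \<in> V"
              using s1 s2 deg by (intro IH) (simp_all add: \<mu>_def)
          qed
        qed
      qed
      then have "minor_prod X S1 * minor_prod Y S2 \<in> V" .
      moreover have "minor_prod X L1 * minor_prod Y L2 = minor_prod X S1 * minor_prod Y S2 \<or>
          minor_prod X L1 * minor_prod Y L2 = - (minor_prod X S1 * minor_prod Y S2)"
        using s1(8)[of X] s2(8)[of Y] by auto
      ultimately show ?thesis using add_subgroup_sign[OF V] by (simp add: LL)
    qed
  qed
  show ?thesis
    using main[of "(normalize_cols L1, normalize_cols L2)"] L by (simp add: normalize_cols[of m])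
qed

section \<open>Tableaux as lists of columns\<close>

text \<open>Passing from the entries to their ranks \<open>r\<close>, with inverse \<open>s\<close>, turns the given order into the
  usual one.\<close>

locale ranking =
  fixes m :: nat and ord :: "nat rel" and r s :: "nat \<Rightarrow> nat"
  assumes m: "1 \<le> m"
    and r_range: "i \<in> {1..m} \<Longrightarrow> r i \<in> {1..m}" and s_range: "i \<in> {1..m} \<Longrightarrow> s i \<in> {1..m}"
    and r_s: "i \<in> {1..m} \<Longrightarrow> r (s i) = i" and s_r: "i \<in> {1..m} \<Longrightarrow> s (r i) = i"
    and ord_s: "i \<in> {1..m} \<Longrightarrow> j \<in> {1..m} \<Longrightarrow> (s i, s j) \<in> ord \<longleftrightarrow> i \<le> j"

lemma ranking_exists:
  assumes "1 \<le> m" and lin: "linear_order_on {1..m} ord"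
  obtains r s where "ranking m ord r s"
proof -
  define r where "r i = card {k \<in> {1..m}. (k, i) \<in> ord}" for i
  have refl: "(i, i) \<in> ord" if "i \<in> {1..m}" for i
    using lin that by (auto simp: order_on_defs refl_on_def)
  have trans: "trans ord" and antisym: "antisym ord" and total: "total_on {1..m} ord"
    using lin by (auto simp: order_on_defs)
  have mono: "r i < r j" if "(i, j) \<in> ord" "i \<noteq> j" "i \<in> {1..m}" "j \<in> {1..m}" for i j
    unfolding r_def
  proof (rule psubset_card_mono)
    have "j \<notin> {k \<in> {1..m}. (k, i) \<in> ord}" using that antisymD[OF antisym] by auto
    moreover have "j \<in> {k \<in> {1..m}. (k, j) \<in> ord}" using that refl by auto
    moreover have "{k \<in> {1..m}. (k, i) \<in> ord} \<subseteq> {k \<in> {1..m}. (k, j) \<in> ord}"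
      using that transD[OF trans] by blast
    ultimately show "{k \<in> {1..m}. (k, i) \<in> ord} \<subset> {k \<in> {1..m}. (k, j) \<in> ord}" by blast
  qed simp
  have iff: "(i, j) \<in> ord \<longleftrightarrow> r i \<le> r j" if "i \<in> {1..m}" "j \<in> {1..m}" for i j
  proof (cases "i = j")
    case True then show ?thesis using refl that by simp
  next
    case False
    then have "(i, j) \<in> ord \<or> (j, i) \<in> ord" using total that by (auto simp: total_on_def)
    then show ?thesis using mono[of i j] mono[of j i] False that by fastforce
  qed
  have inj: "inj_on r {1..m}"
  proof (rule inj_onI)
    fix i j assume ij: "i \<in> {1..m}" "j \<in> {1..m}" "r i = r j"
    then have "(i, j) \<in> ord" "(j, i) \<in> ord" using iff by auto
    then show "i = j" using antisym by (auto dest: antisymD)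
  qed
  have range: "r i \<in> {1..m}" if "i \<in> {1..m}" for i
  proof -
    have "r i \<le> card {1..m}" unfolding r_def by (rule card_mono) auto
    moreover have "0 < r i" unfolding r_def card_gt_0_iff using refl that by auto
    ultimately show ?thesis by simp
  qed
  have bij: "bij_betw r {1..m} {1..m}"
    using inj endo_inj_surj[OF _ _ inj] range by (simp add: bij_betw_def image_subset_iff)
  define s where "s = inv_into {1..m} r"
  have "ranking m ord r s"
  proof
    show rs: "r (s i) = i" and sr: "s i \<in> {1..m}" if "i \<in> {1..m}" for i
      using that bij unfolding s_def bij_betw_def by (metis f_inv_into_f, metis inv_into_into)
    show "s (r i) = i" if "i \<in> {1..m}" for i
      using that inj by (simp add: s_def)
    show "(s i, s j) \<in> ord \<longleftrightarrow> i \<le> j" if "i \<in> {1..m}" "j \<in> {1..m}" for i j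
      using iff[of "s i" "s j"] rs sr that by simp
  qed (use assms(1) range in auto)
  then show thesis by (rule that)
qed

text \<open>The tableau whose columns are the images under \<open>s\<close> of the given lists of ranks.\<close>

definition tab_of :: "(nat \<Rightarrow> nat) \<Rightarrow> nat list list \<Rightarrow> tableau"
  where "tab_of s Cs = (\<lambda>(i, j).
    if 1 \<le> i \<and> 1 \<le> j \<and> j - 1 < length Cs \<and> i - 1 < length (Cs ! (j - 1))
    then Some (s (Cs ! (j - 1) ! (i - 1))) else None)"

definition tabcols :: "nat \<Rightarrow> nat list list \<Rightarrow> bool"
  where "tabcols m Cs \<longleftrightarrow> (\<forall>c\<in>set Cs. c \<noteq> [] \<and> length c \<le> m \<and> set c \<subseteq> {1..m}) \<and>
    sorted_wrt (\<lambda>c c'. length c' \<le> length c) Cs"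

definition shape_of :: "nat \<Rightarrow> nat list list \<Rightarrow> nat list"
  where "shape_of m Cs = map (\<lambda>i. length (filter (\<lambda>c. i < length c) Cs)) [0..<m]"

lemma tabcols_entry:
  assumes "tabcols m Cs" "j < length Cs" "i < length (Cs ! j)"
  shows "Cs ! j ! i \<in> {1..m}"
proof -
  have "set (Cs ! j) \<subseteq> {1..m}" using assms by (simp add: tabcols_def)
  moreover have "Cs ! j ! i \<in> set (Cs ! j)" using assms by simp
  ultimately show ?thesis by blast
qed

text \<open>In a chain, the elements with a property that is inherited downwards form an initial segment, so
  their number tells where they end.\<close>

lemma length_filter_prefix:
  assumes "sorted_wrt (\<lambda>a b. P b \<longrightarrow> P a) xs"
  shows "j < length (filter P xs) \<longleftrightarrow> j < length xs \<and> P (xs ! j)"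
  using assms
proof (induction xs arbitrary: j)
  case (Cons x xs)
  show ?case
  proof (cases "P x")
    case True
    then show ?thesis using Cons by (cases j) auto
  next
    case False
    then have "\<not> P y" if "y \<in> set xs" for y using Cons.prems that by auto
    then have "filter P xs = []" "\<And>k. k < length xs \<Longrightarrow> \<not> P (xs ! k)" by (auto simp: filter_empty_conv)
    then show ?thesis using False by (cases j) auto
  qed
qed simp

lemma shape_of_less:
  assumes "sorted_wrt (\<lambda>c c'. length c' \<le> length c) Cs" "i < m"
  shows "j < shape_of m Cs ! i \<longleftrightarrow> j < length Cs \<and> i < length (Cs ! j)"
proof -
  have "sorted_wrt (\<lambda>c c'. i < length c' \<longrightarrow> i < length c) Cs"
    by (rule sorted_wrt_mono_rel[OF _ assms(1)]) auto
  then show ?thesis using assms(2) length_filter_prefix[of "\<lambda>c. i < length c" Cs j]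
    by (simp add: shape_of_def)
qed

lemma tab_of_Suc: "tab_of s Cs (Suc i, Suc j) =
    (if j < length Cs \<and> i < length (Cs ! j) then Some (s (Cs ! j ! i)) else None)"
  by (simp add: tab_of_def)

lemma dom_tab_of: "dom (tab_of s Cs) = {(Suc i, Suc j) | i j. j < length Cs \<and> i < length (Cs ! j)}"
proof (intro equalityI subsetI)
  fix x assume "x \<in> dom (tab_of s Cs)"
  then obtain i j where "x = (Suc i, Suc j)" "tab_of s Cs (Suc i, Suc j) \<noteq> None"
    by (cases x; cases "fst x"; cases "snd x") (auto simp: tab_of_def split: if_splits)
  then show "x \<in> {(Suc i, Suc j) | i j. j < length Cs \<and> i < length (Cs ! j)}"
    by (auto simp: tab_of_Suc split: if_splits)
qed (auto simp: tab_of_Suc)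

lemma shape_of_partition: "shape_of m Cs \<in> partitions m"
proof -
  have "length (filter (\<lambda>c. j < length c) Cs) \<le> length (filter (\<lambda>c. i < length c) Cs)" if "i < j" for i j
    using that by (induction Cs) auto
  then show ?thesis
    unfolding partitions_def by (auto simp: shape_of_def sorted_wrt_iff_nth_less)
qed

lemma sum_shape_of:
  "j \<le> m \<Longrightarrow> sum_list (take j (shape_of m Cs)) = (\<Sum>c\<leftarrow>Cs. min j (length c))"
proof (induction Cs)
  case Nil
  then show ?case by (simp add: shape_of_def take_map sum_list_triv)
next
  case (Cons c Cs)
  have "sum_list (map (\<lambda>i. if i < length c then 1 else 0) [0..<j]) = min j (length c)"
    by (induction j) auto
  moreover have "sum_list (take j (shape_of m (c # Cs))) =
      sum_list (map (\<lambda>i. if i < length c then 1 else 0) [0..<j]) + sum_list (take j (shape_of m Cs))"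
    using Cons.prems by (simp add: shape_of_def take_map take_upt sum_list_addf[symmetric])
      (rule arg_cong[where f = sum_list], simp)
  ultimately show ?case using Cons by simp
qed

lemma sum_list_shape_of:
  assumes "tabcols m Cs"
  shows "sum_list (shape_of m Cs) = (\<Sum>c\<leftarrow>Cs. length c)"
proof -
  have "sum_list (shape_of m Cs) = (\<Sum>c\<leftarrow>Cs. min m (length c))"
    using sum_shape_of[of m m Cs] by (simp add: shape_of_def)
  also have "\<dots> = (\<Sum>c\<leftarrow>Cs. length c)"
    using assms by (intro arg_cong[where f = sum_list] map_cong) (auto simp: tabcols_def)
  finally show ?thesis .
qed

lemma length_shape_of[simp]: "length (shape_of m Cs) = m"
  by (simp add: shape_of_def)

lemma young_diagram_shape_of:
  assumes "tabcols m Cs"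
  shows "young_diagram (shape_of m Cs) = dom (tab_of s Cs)"
proof -
  have srt: "sorted_wrt (\<lambda>c c'. length c' \<le> length c) Cs" using assms by (simp add: tabcols_def)
  have len: "length (Cs ! j) \<le> m" if "j < length Cs" for j
    using assms that by (simp add: tabcols_def)
  have "(Suc i, Suc j) \<in> young_diagram (shape_of m Cs) \<longleftrightarrow> j < length Cs \<and> i < length (Cs ! j)" for i j
    using shape_of_less[OF srt, of i m j] len[of j]
    by (auto simp: young_diagram_def Suc_le_eq)
  moreover have "\<exists>i j. x = (Suc i, Suc j)" if "x \<in> young_diagram (shape_of m Cs)" for x
    using that by (cases x; cases "fst x"; cases "snd x") (auto simp: young_diagram_def)
  ultimately show ?thesis unfolding dom_tab_of by blast
qed

lemma column_length_tab_of:
  assumes "j < length Cs"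
  shows "column_length (tab_of s Cs) (Suc j) = length (Cs ! j)"
proof -
  have "{a. (a, Suc j) \<in> dom (tab_of s Cs)} = Suc ` {..<length (Cs ! j)}"
    using assms by (auto simp: dom_tab_of)
  then show ?thesis by (simp add: column_length_def card_image)
qed

lemma snd_dom_tab_of:
  assumes "\<forall>c\<in>set Cs. c \<noteq> []"
  shows "snd ` dom (tab_of s Cs) = Suc ` {..<length Cs}"
proof
  show "Suc ` {..<length Cs} \<subseteq> snd ` dom (tab_of s Cs)"
  proof (clarify)
    fix j assume "j < length Cs"
    then have "(Suc 0, Suc j) \<in> dom (tab_of s Cs)" using assms by (auto simp: dom_tab_of)
    then show "Suc j \<in> snd ` dom (tab_of s Cs)" by force
  qed
qed (auto simp: dom_tab_of)

lemma map_length_eq: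
  assumes "dom (tab_of s Cs) = dom (tab_of s Ds)" "tabcols m Cs" "tabcols m Ds"
  shows "map length Cs = map length Ds"
proof -
  have "Suc ` {..<length Cs} = Suc ` {..<length Ds}"
    using snd_dom_tab_of[of Cs s] snd_dom_tab_of[of Ds s] assms by (simp add: tabcols_def)
  then have len: "length Cs = length Ds" by (metis card_image card_lessThan inj_Suc inj_on_subset subset_UNIV)
  show ?thesis
  proof (rule nth_equalityI)
    fix j assume "j < length (map length Cs)"
    then show "map length Cs ! j = map length Ds ! j"
      using column_length_tab_of[of j Cs s] column_length_tab_of[of j Ds s] len assms(1)
      by (simp add: column_length_def)
  qed (simp add: len)
qed

lemma part_length_shape_of:
  assumes "tabcols m Cs"
  shows "part_length (shape_of m Cs) = length (head_col Cs)"
proof -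
  have srt: "sorted_wrt (\<lambda>c c'. length c' \<le> length c) Cs" using assms by (simp add: tabcols_def)
  have "{i. i < m \<and> shape_of m Cs ! i \<noteq> 0} = {..<length (head_col Cs)}"
  proof (cases Cs)
    case Nil
    then show ?thesis by (simp add: shape_of_def head_col_def)
  next
    case (Cons c Ds)
    have "length c \<le> m" using assms Cons by (simp add: tabcols_def)
    then show ?thesis
      using shape_of_less[OF srt, of _ m 0] by (auto simp: Cons head_col_def)
  qed
  then show ?thesis by (simp add: part_length_def)
qed

lemma first_column_tab_of: "first_column (tab_of s Cs) = s ` set (head_col Cs)"
proof -
  have *: "k \<in> first_column (tab_of s Cs) \<longleftrightarrow> (\<exists>i. tab_of s Cs (Suc i, Suc 0) = Some k)" for k
  proof -
    have "tab_of s Cs (0, Suc 0) = None" by (simp add: tab_of_def)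
    then show ?thesis
      unfolding first_column_def by (simp, metis not0_implies_Suc option.distinct(1))
  qed
  then show ?thesis
  proof (cases Cs)
    case (Cons c Ds)
    have "s ` set c = {s (c ! i) | i. i < length c}" by (auto simp: set_conv_nth)
    moreover have "k \<in> first_column (tab_of s Cs) \<longleftrightarrow> (\<exists>i<length c. s (c ! i) = k)" for k
      unfolding * by (auto simp: tab_of_Suc Cons)
    ultimately show ?thesis by (auto simp: head_col_def Cons)
  qed (auto simp: tab_of_Suc head_col_def)
qed

lemma std_cols_tabcols: "std_cols m Cs \<Longrightarrow> tabcols m Cs"
  unfolding std_cols_def tabcols_def
  by (auto simp: length_strict_le col_le_def elim!: sorted_wrt_mono_rel[rotated])

context ranking
begin

lemma s_inj: "i \<in> {1..m} \<Longrightarrow> j \<in> {1..m} \<Longrightarrow> s i = s j \<longleftrightarrow> i = j"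
  using r_s by metis

lemma is_tableau_tab_of:
  assumes "tabcols m Cs"
  shows "is_tableau m (shape_of m Cs) (tab_of s Cs)"
proof -
  have "ran (tab_of s Cs) \<subseteq> {1..m}"
  proof
    fix k assume "k \<in> ran (tab_of s Cs)"
    then obtain x where x: "tab_of s Cs x = Some k" by (auto simp: ran_def)
    then have "x \<in> dom (tab_of s Cs)" by auto
    then obtain i j where ij: "x = (Suc i, Suc j)" "j < length Cs" "i < length (Cs ! j)"
      by (auto simp: dom_tab_of)
    have "set (Cs ! j) \<subseteq> {1..m}" using assms ij by (simp add: tabcols_def)
    then have "Cs ! j ! i \<in> {1..m}" using ij nth_mem by blast
    moreover have "s (Cs ! j ! i) = k" using x ij by (simp add: tab_of_Suc)
    ultimately show "k \<in> {1..m}" using s_range by metis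
  qed
  then show ?thesis using young_diagram_shape_of[OF assms] by (simp add: is_tableau_def)
qed

lemma tableau_columns_exist:
  assumes p: "p \<in> partitions m" and T: "is_tableau m p T"
  obtains Cs where "tabcols m Cs" "T = tab_of s Cs" "p = shape_of m Cs"
proof -
  have lp: "length p = m" and sp: "sorted_wrt (\<ge>) p" using p by (auto simp: partitions_def)
  define l where "l j = length (filter (\<lambda>x. j < x) p)" for j
  have l: "i < l j \<longleftrightarrow> i < m \<and> j < p ! i" for i j
  proof -
    have "sorted_wrt (\<lambda>a b. j < b \<longrightarrow> j < a) p"
      by (rule sorted_wrt_mono_rel[OF _ sp]) auto
    then show ?thesis unfolding l_def by (simp add: length_filter_prefix lp)
  qed
  have p0: "p ! i \<le> p ! 0" if "i < m" for i
    using sorted_wrt_nth_less[OF sp, of 0 i] that lp by (cases "i = 0") auto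
  define Cs where "Cs = map (\<lambda>j. map (\<lambda>i. r (entry T (Suc i) (Suc j))) [0..<l j]) [0..<p ! 0]"
  have len: "length Cs = p ! 0" "\<And>j. j < p ! 0 \<Longrightarrow> length (Cs ! j) = l j"
    by (simp_all add: Cs_def)
  have dom: "(Suc i, Suc j) \<in> dom T \<longleftrightarrow> i < l j" for i j
    using T by (auto simp: l is_tableau_def young_diagram_def lp)
  have ent: "entry T (Suc i) (Suc j) \<in> {1..m}" if "i < l j" for i j
  proof -
    have "(Suc i, Suc j) \<in> dom T" using that dom by simp
    then have "entry T (Suc i) (Suc j) \<in> ran T" by (auto intro: ranI)
    then show ?thesis using T by (auto simp: is_tableau_def)
  qed
  have lm: "l j \<le> m" for j using length_filter_le[of "\<lambda>x. j < x" p] lp by (simp add: l_def)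
  have "tabcols m Cs"
    unfolding tabcols_def
  proof (intro conjI ballI)
    fix c assume "c \<in> set Cs"
    then obtain j where j: "j < p ! 0" "c = map (\<lambda>i. r (entry T (Suc i) (Suc j))) [0..<l j]"
      by (auto simp: Cs_def)
    have "0 < l j" using j m by (simp add: l)
    then show "c \<noteq> []" using j by simp
    show "length c \<le> m" using j lm by simp
    show "set c \<subseteq> {1..m}"
    proof
      fix k assume "k \<in> set c"
      then obtain i where "i < l j" "k = r (entry T (Suc i) (Suc j))" using j by auto
      then show "k \<in> {1..m}" using r_range[OF ent] by simp
    qed
  next
    have "l j' \<le> l j" if "j < j'" for j j'
      using l[of _ j] l[of _ j'] that by (metis less_trans not_le order_less_irrefl)
    then show "sorted_wrt (\<lambda>c c'. length c' \<le> length c) Cs"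
      by (simp add: sorted_wrt_iff_nth_less len)
  qed
  moreover have "T = tab_of s Cs"
  proof
    fix x
    show "T x = tab_of s Cs x"
    proof (cases "\<exists>i j. x = (Suc i, Suc j)")
      case True
      then obtain i j where x: "x = (Suc i, Suc j)" by blast
      show ?thesis
      proof (cases "i < l j")
        case True
        then have j: "j < p ! 0" using p0[of i] by (auto simp: l)
        have "(Suc i, Suc j) \<in> dom T" using True dom by simp
        then have "T x = Some (entry T (Suc i) (Suc j))" by (auto simp: x)
        moreover have "Cs ! j ! i = r (entry T (Suc i) (Suc j))" using True j by (simp add: Cs_def)
        ultimately show ?thesis using True j ent len s_r by (simp add: x tab_of_Suc)
      next
        case False
        then have "(Suc i, Suc j) \<notin> dom T" using dom by simp
        then have "T x = None" by (simp add: x domIff)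
        moreover have "tab_of s Cs x = None" using False len by (auto simp: x tab_of_Suc)
        ultimately show ?thesis by simp
      qed
    next
      case False
      have "x \<notin> dom T"
        using False T by (cases x; cases "fst x"; cases "snd x") (auto simp: is_tableau_def young_diagram_def)
      moreover have "x \<notin> dom (tab_of s Cs)" using False by (auto simp: dom_tab_of)
      ultimately show ?thesis by (simp add: domIff)
    qed
  qed
  moreover have "p = shape_of m Cs"
  proof (rule nth_equalityI)
    fix i assume "i < length p"
    then have i: "i < m" using lp by simp
    have srt: "sorted_wrt (\<lambda>c c'. length c' \<le> length c) Cs"
      using \<open>tabcols m Cs\<close> by (simp add: tabcols_def)
    have "j < p ! i \<longleftrightarrow> j < shape_of m Cs ! i" for j
      using shape_of_less[OF srt i, of j] len p0[OF i] i by (auto simp: l)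
    then show "p ! i = shape_of m Cs ! i" by (metis linorder_neqE_nat order_less_irrefl)
  qed (simp add: lp)
  ultimately show thesis by (rule that)
qed

lemma tab_entry:
  "j < length Cs \<Longrightarrow> i < length (Cs ! j) \<Longrightarrow> entry (tab_of s Cs) (Suc i) (Suc j) = s (Cs ! j ! i)"
  by (simp add: tab_of_Suc)

lemma standard_tableau_tab_of:
  assumes C: "tabcols m Cs"
  shows "standard_tableau ord (tab_of s Cs) \<longleftrightarrow> std_cols m Cs"
proof -
  have ent: "Cs ! j ! i \<in> {1..m}" if "j < length Cs" "i < length (Cs ! j)" for i j
    using tabcols_entry[OF C that] .
  let ?D = "\<lambda>i j. j < length Cs \<and> i < length (Cs ! j)"
  have "standard_tableau ord (tab_of s Cs) \<longleftrightarrow>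
     (\<forall>i i' j. ?D i j \<and> ?D i' j \<and> i < i' \<longrightarrow> Cs ! j ! i < Cs ! j ! i') \<and>
     (\<forall>i j j'. ?D i j \<and> ?D i j' \<and> j < j' \<longrightarrow> Cs ! j ! i \<le> Cs ! j' ! i)"
    (is "_ \<longleftrightarrow> ?A \<and> ?B")
  proof -
    have "(\<forall>i i' j. (i, j) \<in> dom (tab_of s Cs) \<and> (i', j) \<in> dom (tab_of s Cs) \<and> i < i' \<longrightarrow>
       (entry (tab_of s Cs) i j, entry (tab_of s Cs) i' j) \<in> ord \<and>
       entry (tab_of s Cs) i j \<noteq> entry (tab_of s Cs) i' j) \<longleftrightarrow> ?A"
    proof -
      have "(\<forall>i i' j. (i, j) \<in> dom (tab_of s Cs) \<and> (i', j) \<in> dom (tab_of s Cs) \<and> i < i' \<longrightarrow>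
         (entry (tab_of s Cs) i j, entry (tab_of s Cs) i' j) \<in> ord \<and>
         entry (tab_of s Cs) i j \<noteq> entry (tab_of s Cs) i' j) \<longleftrightarrow>
        (\<forall>i i' j. ?D i j \<and> ?D i' j \<and> i < i' \<longrightarrow>
         (s (Cs ! j ! i), s (Cs ! j ! i')) \<in> ord \<and> s (Cs ! j ! i) \<noteq> s (Cs ! j ! i'))"
        (is "?L \<longleftrightarrow> ?R")
      proof
        assume H: ?L
        show ?R
        proof (intro allI impI)
          fix i i' j assume *: "?D i j \<and> ?D i' j \<and> i < i'"
          have "(Suc i, Suc j) \<in> dom (tab_of s Cs) \<and> (Suc i', Suc j) \<in> dom (tab_of s Cs) \<and> Suc i < Suc i'"
            using * by (simp add: dom_tab_of)
          from H[rule_format, OF this]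
          show "(s (Cs ! j ! i), s (Cs ! j ! i')) \<in> ord \<and> s (Cs ! j ! i) \<noteq> s (Cs ! j ! i')"
            using * by (simp add: tab_entry)
        qed
      qed (auto simp: dom_tab_of tab_entry)
      also have "\<dots> \<longleftrightarrow> ?A"
        using ent ord_s s_inj by (auto simp: less_le)
      finally show ?thesis .
    qed
    moreover have "(\<forall>i j j'. (i, j) \<in> dom (tab_of s Cs) \<and> (i, j') \<in> dom (tab_of s Cs) \<and> j < j' \<longrightarrow>
       (entry (tab_of s Cs) i j, entry (tab_of s Cs) i j') \<in> ord) \<longleftrightarrow> ?B"
    proof -
      have "(\<forall>i j j'. (i, j) \<in> dom (tab_of s Cs) \<and> (i, j') \<in> dom (tab_of s Cs) \<and> j < j' \<longrightarrow>
         (entry (tab_of s Cs) i j, entry (tab_of s Cs) i j') \<in> ord) \<longleftrightarrow>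
        (\<forall>i j j'. ?D i j \<and> ?D i j' \<and> j < j' \<longrightarrow> (s (Cs ! j ! i), s (Cs ! j' ! i)) \<in> ord)"
        (is "?L \<longleftrightarrow> ?R")
      proof
        assume H: ?L
        show ?R
        proof (intro allI impI)
          fix i j j' assume *: "?D i j \<and> ?D i j' \<and> j < j'"
          have "(Suc i, Suc j) \<in> dom (tab_of s Cs) \<and> (Suc i, Suc j') \<in> dom (tab_of s Cs) \<and> Suc j < Suc j'"
            using * by (simp add: dom_tab_of)
          from H[rule_format, OF this] show "(s (Cs ! j ! i), s (Cs ! j' ! i)) \<in> ord"
            using * by (simp add: tab_entry)
        qed
      qed (auto simp: dom_tab_of tab_entry)
      also have "\<dots> \<longleftrightarrow> ?B" using ent ord_s by auto
      finally show ?thesis .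
    qed
    ultimately show ?thesis unfolding standard_tableau_def by blast
  qed
  also have "\<dots> \<longleftrightarrow> std_cols m Cs"
  proof
    assume AB: "?A \<and> ?B"
    show "std_cols m Cs"
      unfolding std_cols_def
    proof (intro conjI ballI)
      fix c assume "c \<in> set Cs"
      then obtain j where j: "j < length Cs" "c = Cs ! j" by (metis in_set_conv_nth)
      show "c \<noteq> []" "set c \<subseteq> {1..m}" using C \<open>c \<in> set Cs\<close> by (auto simp: tabcols_def)
      show "sorted_wrt (<) c" using AB j by (auto simp: sorted_wrt_iff_nth_less)
    next
      have "length (Cs ! j') \<le> length (Cs ! j)" if "j < j'" "j' < length Cs" for j j'
        using C that unfolding tabcols_def by (simp add: sorted_wrt_iff_nth_less)
      then show "sorted_wrt col_le Cs"
        using AB unfolding sorted_wrt_iff_nth_less col_le_def by (meson less_le_trans less_trans)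
    qed
  next
    assume std: "std_cols m Cs"
    have ?A
    proof (intro allI impI)
      fix i i' j assume *: "?D i j \<and> ?D i' j \<and> i < i'"
      then have "sorted_wrt (<) (Cs ! j)" using std by (simp add: std_cols_def)
      then show "Cs ! j ! i < Cs ! j ! i'" using * by (simp add: sorted_wrt_iff_nth_less)
    qed
    moreover have ?B
      using std unfolding std_cols_def sorted_wrt_iff_nth_less col_le_def by blast
    ultimately show "?A \<and> ?B" ..
  qed
  finally show ?thesis .
qed

lemma standard_pair_tab_of:
  assumes "set I \<subseteq> {1..m}" "set I' \<subseteq> {1..m}"
  shows "standard_pair m ord (s ` set I) (s ` set I') \<longleftrightarrow> pair_std m I I'"
proof -
  have c: "card {i \<in> s ` A. (i, s j) \<in> ord} = card {i \<in> A. i \<le> j}" if "A \<subseteq> {1..m}" "j \<in> {1..m}" for A j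
  proof -
    have "{i \<in> s ` A. (i, s j) \<in> ord} = s ` {i \<in> A. i \<le> j}"
      using that ord_s by blast
    moreover have "inj_on s {i \<in> A. i \<le> j}"
      using that s_inj by (intro inj_onI) blast
    ultimately show ?thesis by (simp add: card_image)
  qed
  have im: "{1..m} = s ` {1..m}"
  proof
    show "{1..m} \<subseteq> s ` {1..m}" using s_r r_range by (metis image_eqI subsetI)
  qed (use s_range in blast)
  have z: "card {i \<in> {1..m}. (i, s j) \<in> ord} = j" if "j \<in> {1..m}" for j
  proof -
    have "card {i \<in> s ` {1..m}. (i, s j) \<in> ord} = card {i \<in> {1..m}. i \<le> j}"
      using that by (intro c) auto
    also have "{i \<in> {1..m}. i \<le> j} = {1..j}" using that by auto
    finally show ?thesis using im by simp
  qed
  have "standard_pair m ord (s ` set I) (s ` set I') \<longleftrightarrow>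
    (\<forall>j\<in>s ` {1..m}. card {i \<in> s ` set I. (i, j) \<in> ord} + card {i \<in> s ` set I'. (i, j) \<in> ord}
       \<le> card {i \<in> {1..m}. (i, j) \<in> ord})"
    unfolding standard_pair_def using im by simp
  also have "\<dots> \<longleftrightarrow> pair_std m I I'"
    unfolding pair_std_def using c[OF assms(1)] c[OF assms(2)] z by auto
  finally show ?thesis .
qed

lemma head_col_range: "tabcols m Cs \<Longrightarrow> set (head_col Cs) \<subseteq> {1..m}"
  by (cases Cs) (simp_all add: tabcols_def head_col_def)

lemma standard_rat_tableau_tab_of:
  assumes "tabcols m Cs" "tabcols m Ds"
  shows "standard_rat_tableau m ord (tab_of s Cs, tab_of s Ds) \<longleftrightarrow> rat_std m Cs Ds"
  unfolding standard_rat_tableau_def rat_std_def fst_conv snd_conv first_column_tab_of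
  by (simp only: standard_tableau_tab_of standard_pair_tab_of head_col_range assms)

lemma tableau_weight_tab_of:
  assumes C: "tabcols m Cs"
  shows "tableau_weight m (tab_of s Cs) = map (\<lambda>k. int (count_list (concat Cs) (r k))) [1..<Suc m]"
proof -
  have "card {c. tab_of s Cs c = Some k} = count_list (concat Cs) (r k)" if k: "k \<in> {1..m}" for k
  proof -
    have ent: "Cs ! j ! i \<in> {1..m}" if "j < length Cs" "i < length (Cs ! j)" for i j
      using tabcols_entry[OF C that] .
    have "{c. tab_of s Cs c = Some k} =
       (\<lambda>(j, i). (Suc i, Suc j)) ` (SIGMA j:{..<length Cs}. {i. i < length (Cs ! j) \<and> Cs ! j ! i = r k})"
      (is "?L = ?f ` ?R")
    proof
      show "?L \<subseteq> ?f ` ?R"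
      proof
        fix c assume c: "c \<in> ?L"
        then have "c \<in> dom (tab_of s Cs)" by auto
        then obtain i j where ij: "c = (Suc i, Suc j)" "j < length Cs" "i < length (Cs ! j)"
          by (auto simp: dom_tab_of)
        then have "s (Cs ! j ! i) = k" using c by (simp add: tab_of_Suc)
        then have "Cs ! j ! i = r k" using r_s[OF ent] ij by metis
        then show "c \<in> ?f ` ?R" using ij by force
      qed
      show "?f ` ?R \<subseteq> ?L" using s_r[OF k] by (auto simp: tab_of_Suc)
    qed
    moreover have "inj_on ?f ?R" by (auto simp: inj_on_def)
    ultimately have "card ?L = card ?R" by (simp add: card_image)
    also have "\<dots> = (\<Sum>j<length Cs. card {i. i < length (Cs ! j) \<and> Cs ! j ! i = r k})"
      by simp
    also have "\<dots> = (\<Sum>j<length Cs. count_list (Cs ! j) (r k))"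
      by (simp add: count_list_eq_length_filter length_filter_conv_card eq_commute)
    also have "\<dots> = (\<Sum>c\<leftarrow>Cs. count_list c (r k))"
      by (simp add: sum_list_sum_nth atLeast0LessThan)
    also have "\<dots> = count_list (concat Cs) (r k)"
      by (induction Cs) auto
    finally show ?thesis .
  qed
  then show ?thesis unfolding tableau_weight_def by (intro map_cong) auto
qed

lemma bidet_part_tab_of:
  assumes "tabcols m Cs" "tabcols m Ds" "map length Cs = map length Ds"
  shows "bidet_part z (tab_of s Cs) (tab_of s Ds) = minor_prod (\<lambda>i j. z (s i) (s j)) (zip Cs Ds)"
proof -
  have len: "length Cs = length Ds" using assms(3) by (metis length_map)
  have lenj: "length (Cs ! j) = length (Ds ! j)" if "j < length Cs" for j
    using assms(3) that len by (metis nth_map)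
  have ne: "\<forall>c\<in>set Cs. c \<noteq> []" using assms by (simp add: tabcols_def)
  have "bidet_part z (tab_of s Cs) (tab_of s Ds) =
      (\<Prod>j<length Cs. minor (\<lambda>i j. z (s i) (s j)) (Cs ! j) (Ds ! j))"
    unfolding bidet_part_def snd_dom_tab_of[OF ne]
  proof (subst prod.reindex, simp, unfold comp_def, rule prod.cong[OF refl])
    fix j assume "j \<in> {..<length Cs}"
    then have j: "j < length Cs" by simp
    have "mat (length (Cs ! j)) (length (Cs ! j))
        (\<lambda>(a, b). z (entry (tab_of s Cs) (Suc a) (Suc j)) (entry (tab_of s Ds) (Suc b) (Suc j))) =
      mat (length (Cs ! j)) (length (Cs ! j)) (\<lambda>(a, b). z (s (Cs ! j ! a)) (s (Ds ! j ! b)))"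
      using j len lenj by (intro eq_matI) (auto simp: tab_of_Suc)
    then show "det (mat (column_length (tab_of s Cs) (Suc j)) (column_length (tab_of s Cs) (Suc j))
        (\<lambda>(a, b). z (entry (tab_of s Cs) (Suc a) (Suc j)) (entry (tab_of s Ds) (Suc b) (Suc j)))) =
      minor (\<lambda>i j. z (s i) (s j)) (Cs ! j) (Ds ! j)"
      using j lenj by (simp add: column_length_tab_of minor_def)
  qed
  also have "\<dots> = minor_prod (\<lambda>i j. z (s i) (s j)) (zip Cs Ds)"
    using len by (simp add: minor_prod_def prod.list_conv_set_nth atLeast0LessThan)
  finally show ?thesis .
qed

end

section \<open>The coordinate ring\<close>

lemma poly_ring_simps [simp]:
  "monoid.mult (poly_ring m) = (*)" "one (poly_ring m) = 1" "zero (poly_ring m) = 0" "add (poly_ring m) = (+)"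
  by (simp_all add: poly_ring_def)

lemma poly_carrier:
  "p \<in> carrier (poly_ring m) \<longleftrightarrow> (\<forall>u\<in>Poly_Mapping.keys p. Poly_Mapping.keys u \<subseteq> matrix_vars m)"
  by (simp add: poly_ring_def)

lemma poly_carrier_ring:
  "0 \<in> carrier (poly_ring m)" "1 \<in> carrier (poly_ring m)"
  "p \<in> carrier (poly_ring m) \<Longrightarrow> - p \<in> carrier (poly_ring m)"
  "p \<in> carrier (poly_ring m) \<Longrightarrow> q \<in> carrier (poly_ring m) \<Longrightarrow> p + q \<in> carrier (poly_ring m)"
  "p \<in> carrier (poly_ring m) \<Longrightarrow> q \<in> carrier (poly_ring m) \<Longrightarrow> p - q \<in> carrier (poly_ring m)"
  "p \<in> carrier (poly_ring m) \<Longrightarrow> q \<in> carrier (poly_ring m) \<Longrightarrow> p * q \<in> carrier (poly_ring m)"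
proof -
  show "p * q \<in> carrier (poly_ring m)" if "p \<in> carrier (poly_ring m)" "q \<in> carrier (poly_ring m)"
    unfolding poly_carrier
  proof
    fix u assume "u \<in> Poly_Mapping.keys (p * q)"
    then obtain a b where "u = a + b" "a \<in> Poly_Mapping.keys p" "b \<in> Poly_Mapping.keys q"
      using keys_mult[of p q] by blast
    then show "Poly_Mapping.keys u \<subseteq> matrix_vars m"
      using that Poly_Mapping.keys_add[of a b] unfolding poly_carrier by blast
  qed
qed (use Poly_Mapping.keys_add[of p q] keys_diff[of p q] in \<open>auto simp: poly_carrier\<close>)

lemma poly_carrier_subgroup: "add_subgroup (carrier (poly_ring m))"
  by (simp add: add_subgroup_def poly_carrier_ring)

lemma poly_carrier_power: "p \<in> carrier (poly_ring m) \<Longrightarrow> p ^ n \<in> carrier (poly_ring m)"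
  by (induction n) (simp_all add: poly_carrier_ring)

lemma poly_carrier_of_int_mult:
  "p \<in> carrier (poly_ring m) \<Longrightarrow> of_int k * p \<in> carrier (poly_ring m)"
  by (rule add_subgroup_of_int[OF poly_carrier_subgroup])

lemma poly_carrier_mvar: "v \<in> matrix_vars m \<Longrightarrow> mvar v \<in> carrier (poly_ring m)"
  by (simp add: poly_carrier mvar_def)

lemma matrix_vars_iff: "VX i j \<in> matrix_vars m \<longleftrightarrow> i \<in> {1..m} \<and> j \<in> {1..m}"
  "VY i j \<in> matrix_vars m \<longleftrightarrow> i \<in> {1..m} \<and> j \<in> {1..m}"
  by (auto simp: matrix_vars_def)

lemma h_carrier:
  assumes "i \<in> {1..m}" "j \<in> {1..m}"
  shows "h m i j \<in> carrier (poly_ring m)" "h_bar m i j \<in> carrier (poly_ring m)"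
  unfolding h_def h_bar_def
  using assms by (auto intro!: add_subgroup_sum[OF poly_carrier_subgroup] poly_carrier_ring
      poly_carrier_mvar simp: matrix_vars_iff)

lemma poly_ring_cring: "cring (poly_ring m)"
proof (rule cringI)
  show "abelian_group (poly_ring m)"
  proof (rule abelian_groupI)
    fix x assume "x \<in> carrier (poly_ring m)"
    then show "\<exists>y\<in>carrier (poly_ring m). y \<oplus>\<^bsub>poly_ring m\<^esub> x = \<zero>\<^bsub>poly_ring m\<^esub>"
      by (intro bexI[of _ "- x"]) (simp_all add: poly_carrier_ring)
  qed (simp_all add: poly_carrier_ring algebra_simps)
  show "comm_monoid (poly_ring m)"
    by (rule comm_monoidI) (simp_all add: poly_carrier_ring algebra_simps)
qed (simp_all add: algebra_simps)

lemma monoid_relations_carrier: "monoid_relations m \<subseteq> carrier (poly_ring m)"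
  unfolding monoid_relations_def by (auto intro!: h_carrier poly_carrier_ring)

lemma monoid_ideal_ideal: "ideal (monoid_ideal m) (poly_ring m)"
  unfolding monoid_ideal_def
  by (rule ring.genideal_ideal[OF cring.axioms(1)[OF poly_ring_cring] monoid_relations_carrier])

lemma monoid_relations_ideal: "monoid_relations m \<subseteq> monoid_ideal m"
  unfolding monoid_ideal_def
  by (rule ring.genideal_self[OF cring.axioms(1)[OF poly_ring_cring] monoid_relations_carrier])

lemma relations_in_ideal:
  assumes "i \<in> {1..m}" "j \<in> {1..m}"
  shows "i \<noteq> j \<Longrightarrow> h m i j \<in> monoid_ideal m" "i \<noteq> j \<Longrightarrow> h_bar m i j \<in> monoid_ideal m"
    "h m i i - h_bar m j j \<in> monoid_ideal m"
  by (rule subsetD[OF monoid_relations_ideal], use assms in \<open>unfold monoid_relations_def, blast\<close>)+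

lemma monoid_ideal_mult:
  "c \<in> carrier (poly_ring m) \<Longrightarrow> p \<in> monoid_ideal m \<Longrightarrow> c * p \<in> monoid_ideal m"
  using ideal.I_l_closed[OF monoid_ideal_ideal] by simp

lemma monoid_ideal_subgroup: "add_subgroup (monoid_ideal m)"
proof -
  interpret ideal "monoid_ideal m" "poly_ring m" by (rule monoid_ideal_ideal)
  have "0 \<in> monoid_ideal m" using additive_subgroup.zero_closed[OF is_additive_subgroup] by simp
  moreover have "p - q \<in> monoid_ideal m" if "p \<in> monoid_ideal m" "q \<in> monoid_ideal m" for p q
  proof -
    have "(- 1) * q \<in> monoid_ideal m"
      using that by (intro monoid_ideal_mult) (simp_all add: poly_carrier_ring)
    then have "p \<oplus>\<^bsub>poly_ring m\<^esub> (- 1) * q \<in> monoid_ideal m"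
      by (rule additive_subgroup.a_closed[OF is_additive_subgroup that(1)])
    then show ?thesis by simp
  qed
  ultimately show ?thesis by (simp add: add_subgroup_def)
qed

subsection \<open>Residue classes\<close>

lemma coord_class_eq:
  assumes "p \<in> carrier (poly_ring m)" "q \<in> carrier (poly_ring m)"
  shows "coord_class m p = coord_class m q \<longleftrightarrow> p - q \<in> monoid_ideal m"
proof -
  note J = monoid_ideal_subgroup[of m]
  have cc: "coord_class m p = {j + p | j. j \<in> monoid_ideal m}" for p
    by (auto simp: coord_class_def a_r_coset_def')
  show ?thesis
  proof
    assume eq: "coord_class m p = coord_class m q"
    have "p \<in> coord_class m p" unfolding cc using add_subgroup_0[OF J] by force
    then have "p \<in> {j + q | j. j \<in> monoid_ideal m}" by (simp only: eq cc[of q])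
    then show "p - q \<in> monoid_ideal m" by auto
  next
    assume pq: "p - q \<in> monoid_ideal m"
    show "coord_class m p = coord_class m q"
      unfolding cc
    proof (intro equalityI subsetI)
      fix z assume "z \<in> {j + p | j. j \<in> monoid_ideal m}"
      then obtain j where "j \<in> monoid_ideal m" "z = (j + (p - q)) + q" by auto
      then show "z \<in> {j + q | j. j \<in> monoid_ideal m}" using add_subgroup_add[OF J _ pq] by blast
    next
      fix z assume "z \<in> {j + q | j. j \<in> monoid_ideal m}"
      then obtain j where "j \<in> monoid_ideal m" "z = (j - (p - q)) + p" by auto
      then show "z \<in> {j + p | j. j \<in> monoid_ideal m}" using add_subgroup_diff[OF J _ pq] by blast
    qed
  qed
qed

lemma coord_ring_cring: "cring (coord_ring m)"
  unfolding coord_ring_def by (rule ideal.quotient_is_cring[OF monoid_ideal_ideal poly_ring_cring])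

lemma coord_class_hom: "coord_class m \<in> Ring.ring_hom (poly_ring m) (coord_ring m)"
proof -
  have "coord_class m = (+>\<^bsub>poly_ring m\<^esub>) (monoid_ideal m)"
    by (rule ext) (simp add: coord_class_def)
  then show ?thesis unfolding coord_ring_def
    using ideal.rcos_ring_hom[OF monoid_ideal_ideal] by simp
qed

lemma coord_class_carrier:
  "p \<in> carrier (poly_ring m) \<Longrightarrow> coord_class m p \<in> carrier (coord_ring m)"
  using ring_hom_closed[OF coord_class_hom] .

lemma coord_class_mult:
  "p \<in> carrier (poly_ring m) \<Longrightarrow> q \<in> carrier (poly_ring m) \<Longrightarrow>
   coord_class m p \<otimes>\<^bsub>coord_ring m\<^esub> coord_class m q = coord_class m (p * q)"
  using ring_hom_mult[OF coord_class_hom, of p m q] by simp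

lemma coord_class_add:
  "p \<in> carrier (poly_ring m) \<Longrightarrow> q \<in> carrier (poly_ring m) \<Longrightarrow>
   coord_class m p \<oplus>\<^bsub>coord_ring m\<^esub> coord_class m q = coord_class m (p + q)"
  using ring_hom_add[OF coord_class_hom, of p m q] by simp

lemma coord_class_one: "coord_class m 1 = \<one>\<^bsub>coord_ring m\<^esub>"
  using ring_hom_one[OF coord_class_hom, of m] by simp

lemma coord_class_zero: "coord_class m 0 = \<zero>\<^bsub>coord_ring m\<^esub>"
  using ring_hom_zero[OF coord_class_hom] cring.axioms(1)[OF poly_ring_cring]
    cring.axioms(1)[OF coord_ring_cring] by simp

lemma coord_class_power:
  assumes "p \<in> carrier (poly_ring m)"
  shows "coord_class m p [^]\<^bsub>coord_ring m\<^esub> (n::nat) = coord_class m (p ^ n)"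
proof (induction n)
  case 0 then show ?case by (simp add: coord_class_one)
next
  case (Suc n)
  then show ?case using assms
    by (simp add: coord_class_mult poly_carrier_power mult.commute)
qed

lemma coord_class_of_int:
  assumes p: "p \<in> carrier (poly_ring m)"
  shows "[k] \<cdot>\<^bsub>coord_ring m\<^esub> coord_class m p = coord_class m (of_int k * p)"
proof -
  interpret R: cring "coord_ring m" by (rule coord_ring_cring)
  let ?A = "add_monoid (coord_ring m)"
  have nat: "coord_class m p [^]\<^bsub>?A\<^esub> (n::nat) = coord_class m (of_nat n * p)" for n
  proof (induction n)
    case 0 then show ?case by (simp add: coord_class_zero)
  next
    case (Suc n)
    have "of_nat n * p \<in> carrier (poly_ring m)"
      using poly_carrier_of_int_mult[OF p, of "int n"] by simp
    then show ?case using Suc p by (simp add: coord_class_add algebra_simps)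
  qed
  show ?thesis
  proof (cases "k < 0")
    case True
    define n where "n = nat (- k)"
    have k: "k = - int n" using True by (simp add: n_def)
    have c: "of_nat n * p \<in> carrier (poly_ring m)" "of_int k * p \<in> carrier (poly_ring m)"
      using poly_carrier_of_int_mult[OF p, of "int n"] poly_carrier_of_int_mult[OF p, of k] by simp_all
    have inv: "inv\<^bsub>?A\<^esub> (coord_class m (of_nat n * p)) = coord_class m (of_int k * p)"
    proof (rule group.inv_equality[OF R.a_group])
      show "coord_class m (of_int k * p) \<otimes>\<^bsub>?A\<^esub> coord_class m (of_nat n * p) = \<one>\<^bsub>?A\<^esub>"
        using c by (simp add: coord_class_add coord_class_zero[symmetric] k)
    qed (use c coord_class_carrier in simp_all)
    have "coord_class m p [^]\<^bsub>?A\<^esub> k = inv\<^bsub>?A\<^esub> (coord_class m p [^]\<^bsub>?A\<^esub> n)"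
      unfolding int_pow_def2 n_def by (simp only: True if_True)
    then show ?thesis by (simp only: add_pow_def nat inv)
  next
    case False
    then have "k = int (nat k)" by simp
    then show ?thesis using nat[of "nat k"] by (metis add_pow_def int_pow_int of_int_of_nat_eq)
  qed
qed

lemma int_lincomb_coord_class:
  assumes "finite F" "\<And>i. i \<in> F \<Longrightarrow> b i \<in> carrier (poly_ring m)"
  shows "int_lincomb (coord_ring m) F a (\<lambda>i. coord_class m (b i)) =
    coord_class m (\<Sum>i\<in>F. of_int (a i) * b i)"
  using assms
proof (induction F)
  case empty
  interpret R: cring "coord_ring m" by (rule coord_ring_cring)
  show ?case by (simp add: int_lincomb_def coord_class_zero)
next
  case (insert x F)
  interpret R: cring "coord_ring m" by (rule coord_ring_cring)
  have c: "of_int (a i) * b i \<in> carrier (poly_ring m)" if "i \<in> insert x F" for i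
    using insert that by (intro poly_carrier_of_int_mult) auto
  have e: "[a i] \<cdot>\<^bsub>coord_ring m\<^esub> coord_class m (b i) = coord_class m (of_int (a i) * b i)"
    if "i \<in> insert x F" for i
    using insert that by (intro coord_class_of_int) auto
  have "int_lincomb (coord_ring m) (insert x F) a (\<lambda>i. coord_class m (b i)) =
      coord_class m (of_int (a x) * b x) \<oplus>\<^bsub>coord_ring m\<^esub>
      int_lincomb (coord_ring m) F a (\<lambda>i. coord_class m (b i))"
    unfolding int_lincomb_def
    using insert(1,2) e c coord_class_carrier by (subst R.finsum_insert) auto
  also have "\<dots> = coord_class m (\<Sum>i\<in>insert x F. of_int (a i) * b i)"
    using insert c by (simp add: coord_class_add add_subgroup_sum[OF poly_carrier_subgroup])
  finally show ?case .
qed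

lemma coord_ring_carrierE:
  assumes "v \<in> carrier (coord_ring m)"
  obtains p where "p \<in> carrier (poly_ring m)" "v = coord_class m p"
  using assms unfolding coord_ring_def FactRing_def A_RCOSETS_def'
  by (auto simp: coord_class_def)

subsection \<open>Bideterminants as polynomials\<close>

text \<open>An index \<open>(t, (S, T))\<close> stands for \<open>d\<^sup>t (S | T)\<close>, which is represented by a polynomial.\<close>

type_synonym bitableau_index = "nat \<times> rat_tableau \<times> rat_tableau"

definition bidet_poly :: "nat \<Rightarrow> bitableau_index \<Rightarrow> int_mpoly"
  where "bidet_poly m = (\<lambda>(t, ST). h m 1 1 ^ t *
    (bidet_part x_var (fst (fst ST)) (fst (snd ST)) * bidet_part y_var (snd (fst ST)) (snd (snd ST))))"

definition std_index :: "nat \<Rightarrow> nat rel \<Rightarrow> bitableau_index set"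
  where "std_index m ord =
    {(t, ST). (\<exists>lam1\<in>partitions m. \<exists>lam2\<in>partitions m. is_rat_bitableau m lam1 lam2 ST) \<and>
      standard_rat_bitableau m ord ST}"

text \<open>Polynomials whose classes are integral combinations of the elements \<open>d\<^sup>t (S | T)\<close>.\<close>

definition lincombs :: "nat \<Rightarrow> nat rel \<Rightarrow> int_mpoly set"
  where "lincombs m ord = {p. \<exists>F a. finite F \<and> F \<subseteq> std_index m ord \<and>
    p - (\<Sum>i\<in>F. of_int (a i) * bidet_poly m i) \<in> monoid_ideal m}"

lemma lincombs_ideal: "p \<in> monoid_ideal m \<Longrightarrow> p \<in> lincombs m ord"
  unfolding lincombs_def by (intro CollectI exI[of _ "{}"]) simp

lemma lincombs_basis: "i \<in> std_index m ord \<Longrightarrow> bidet_poly m i \<in> lincombs m ord"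
  unfolding lincombs_def
  by (intro CollectI exI[of _ "{i}"] exI[of _ "\<lambda>_. 1"]) (simp add: add_subgroup_0[OF monoid_ideal_subgroup])

lemma lincombs_subgroup: "add_subgroup (lincombs m ord)"
proof -
  have "p - q \<in> lincombs m ord" if pq: "p \<in> lincombs m ord" "q \<in> lincombs m ord" for p q
  proof -
    obtain F a where F: "finite F" "F \<subseteq> std_index m ord"
      "p - (\<Sum>i\<in>F. of_int (a i) * bidet_poly m i) \<in> monoid_ideal m"
      using pq(1) unfolding lincombs_def by blast
    obtain G b where G: "finite G" "G \<subseteq> std_index m ord"
      "q - (\<Sum>i\<in>G. of_int (b i) * bidet_poly m i) \<in> monoid_ideal m"
      using pq(2) unfolding lincombs_def by blast
    define c where "c i = (if i \<in> F then a i else 0) - (if i \<in> G then b i else 0)" for i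
    have "(\<Sum>i\<in>F. of_int (a i) * bidet_poly m i) =
        (\<Sum>i\<in>F \<union> G. of_int (if i \<in> F then a i else 0) * bidet_poly m i)"
      by (rule sum.mono_neutral_cong_left) (use F G in auto)
    moreover have "(\<Sum>i\<in>G. of_int (b i) * bidet_poly m i) =
        (\<Sum>i\<in>F \<union> G. of_int (if i \<in> G then b i else 0) * bidet_poly m i)"
      by (rule sum.mono_neutral_cong_left) (use F G in auto)
    ultimately have "(\<Sum>i\<in>F \<union> G. of_int (c i) * bidet_poly m i) =
        (\<Sum>i\<in>F. of_int (a i) * bidet_poly m i) - (\<Sum>i\<in>G. of_int (b i) * bidet_poly m i)"
      by (simp add: c_def left_diff_distrib sum_subtractf)
    then have "p - q - (\<Sum>i\<in>F \<union> G. of_int (c i) * bidet_poly m i) =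
        (p - (\<Sum>i\<in>F. of_int (a i) * bidet_poly m i)) - (q - (\<Sum>i\<in>G. of_int (b i) * bidet_poly m i))"
      by (simp only: diff_diff_eq2 diff_diff_eq) (simp add: algebra_simps)
    then have "p - q - (\<Sum>i\<in>F \<union> G. of_int (c i) * bidet_poly m i) \<in> monoid_ideal m"
      using add_subgroup_diff[OF monoid_ideal_subgroup F(3) G(3)] by (simp only:)
    moreover have "F \<union> G \<subseteq> std_index m ord" "finite (F \<union> G)" using F G by auto
    ultimately show ?thesis unfolding lincombs_def by blast
  qed
  moreover have "0 \<in> lincombs m ord"
    by (rule lincombs_ideal) (rule add_subgroup_0[OF monoid_ideal_subgroup])
  ultimately show ?thesis by (simp add: add_subgroup_def)
qed

lemma lincombs_d_mult:
  assumes "1 \<le> m" "p \<in> lincombs m ord"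
  shows "h m 1 1 * p \<in> lincombs m ord"
proof -
  obtain F a where F: "finite F" "F \<subseteq> std_index m ord"
    "p - (\<Sum>i\<in>F. of_int (a i) * bidet_poly m i) \<in> monoid_ideal m"
    using assms(2) unfolding lincombs_def by blast
  let ?g = "\<lambda>(t, ST). (Suc t, ST)"
  have inj: "inj_on ?g F" by (auto simp: inj_on_def)
  have "h m 1 1 * (p - (\<Sum>i\<in>F. of_int (a i) * bidet_poly m i)) \<in> monoid_ideal m"
    using assms(1) by (intro monoid_ideal_mult F h_carrier) auto
  also have "h m 1 1 * (p - (\<Sum>i\<in>F. of_int (a i) * bidet_poly m i)) =
      h m 1 1 * p - (\<Sum>i\<in>?g ` F. of_int (a (fst i - 1, snd i)) * bidet_poly m i)"
    unfolding sum.reindex[OF inj]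
    by (auto simp: right_diff_distrib sum_distrib_left bidet_poly_def mult_ac case_prod_unfold intro!: sum.cong)
  finally show ?thesis
    unfolding lincombs_def using F
    by (intro CollectI exI[of _ "?g ` F"] exI[of _ "\<lambda>i. a (fst i - 1, snd i)"])
       (auto simp: std_index_def)
qed

subsection \<open>Degrees\<close>

definition mdeg :: "('a \<Rightarrow>\<^sub>0 nat) \<Rightarrow> nat"
  where "mdeg u = (\<Sum>v\<in>Poly_Mapping.keys u. Poly_Mapping.lookup u v)"

lemma mdeg_superset:
  "finite A \<Longrightarrow> Poly_Mapping.keys u \<subseteq> A \<Longrightarrow> mdeg u = (\<Sum>v\<in>A. Poly_Mapping.lookup u v)"
  unfolding mdeg_def by (rule sum.mono_neutral_left) (auto simp: in_keys_iff)

lemma mdeg_add: "mdeg (u + w) = mdeg u + mdeg w"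
proof -
  let ?A = "Poly_Mapping.keys u \<union> Poly_Mapping.keys w"
  have "mdeg x = (\<Sum>v\<in>?A. Poly_Mapping.lookup x v)" if "Poly_Mapping.keys x \<subseteq> ?A" for x
    using that by (intro mdeg_superset) auto
  then show ?thesis using Poly_Mapping.keys_add[of u w] by (simp add: lookup_add sum.distrib)
qed

lemma mdeg_single: "mdeg (Poly_Mapping.single v n) = n"
  by (simp add: mdeg_def)

definition homogeneous :: "nat \<Rightarrow> nat \<Rightarrow> int_mpoly set"
  where "homogeneous m n =
    {p. \<forall>u\<in>Poly_Mapping.keys p. Poly_Mapping.keys u \<subseteq> matrix_vars m \<and> mdeg u = n}"

lemma homogeneous_carrier: "homogeneous m n \<subseteq> carrier (poly_ring m)"
  by (auto simp: homogeneous_def poly_carrier)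

lemma homogeneous_subgroup: "add_subgroup (homogeneous m n)"
  unfolding add_subgroup_def
proof (intro conjI ballI)
  fix a b assume "a \<in> homogeneous m n" "b \<in> homogeneous m n"
  then show "a - b \<in> homogeneous m n" using keys_diff[of a b] by (auto simp: homogeneous_def)
qed (simp add: homogeneous_def)

lemma homogeneous_mult:
  assumes "a \<in> homogeneous m k" "b \<in> homogeneous m n"
  shows "a * b \<in> homogeneous m (k + n)"
  unfolding homogeneous_def
proof (intro CollectI ballI)
  fix u assume "u \<in> Poly_Mapping.keys (a * b)"
  then obtain x y where xy: "u = x + y" "x \<in> Poly_Mapping.keys a" "y \<in> Poly_Mapping.keys b"
    using keys_mult[of a b] by blast
  have "Poly_Mapping.keys x \<subseteq> matrix_vars m \<and> mdeg x = k"
    "Poly_Mapping.keys y \<subseteq> matrix_vars m \<and> mdeg y = n"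
    using assms xy unfolding homogeneous_def by blast+
  then show "Poly_Mapping.keys u \<subseteq> matrix_vars m \<and> mdeg u = k + n"
    using Poly_Mapping.keys_add[of x y] unfolding xy(1) mdeg_add by blast
qed

lemma homogeneous_mvar: "v \<in> matrix_vars m \<Longrightarrow> mvar v \<in> homogeneous m 1"
  by (simp add: homogeneous_def mvar_def mdeg_single)

text \<open>The part of degree \<open>n\<close> of the ideal generated by the relations and \<open>d\<close>. The cofactor of \<open>d\<close> has
  degree \<open>n - 2\<close>, so there is none below degree two.\<close>

definition relations_mod_d :: "nat \<Rightarrow> nat \<Rightarrow> int_mpoly set"
  where "relations_mod_d m n = {j + h m 1 1 * g | j g. j \<in> monoid_ideal m \<and>
    (if 2 \<le> n then g \<in> homogeneous m (n - 2) else g = 0)}"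

lemma relations_mod_d_subgroup: "add_subgroup (relations_mod_d m n)"
proof -
  define G where "G = (if 2 \<le> n then homogeneous m (n - 2) else {0})"
  have G: "add_subgroup G"
    unfolding G_def by (auto simp: homogeneous_subgroup) (simp add: add_subgroup_def)
  have eq: "relations_mod_d m n = {j + h m 1 1 * g | j g. j \<in> monoid_ideal m \<and> g \<in> G}"
    by (auto simp: relations_mod_d_def G_def)
  show ?thesis
    unfolding add_subgroup_def
  proof (intro conjI ballI)
    show "0 \<in> relations_mod_d m n"
      unfolding eq using add_subgroup_0[OF G] add_subgroup_0[OF monoid_ideal_subgroup[of m]] by force
    fix a b assume "a \<in> relations_mod_d m n" "b \<in> relations_mod_d m n"
    then obtain j g j' g' where *: "a = j + h m 1 1 * g" "j \<in> monoid_ideal m" "g \<in> G"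
      "b = j' + h m 1 1 * g'" "j' \<in> monoid_ideal m" "g' \<in> G" unfolding eq by blast
    have "a - b = (j - j') + h m 1 1 * (g - g')" using * by (simp add: algebra_simps)
    then show "a - b \<in> relations_mod_d m n"
      unfolding eq using add_subgroup_diff[OF G *(3,6)]
        add_subgroup_diff[OF monoid_ideal_subgroup *(2,5)] by blast
  qed
qed

context ranking
begin

definition xs :: "nat \<Rightarrow> nat \<Rightarrow> int_mpoly" where "xs i j = x_var (s i) (s j)"

definition ys :: "nat \<Rightarrow> nat \<Rightarrow> int_mpoly" where "ys i j = y_var (s i) (s j)"

lemma s_bij: "bij_betw s {1..m} {1..m}"
  by (rule bij_betwI[of _ _ _ r]) (use r_range s_range r_s s_r in auto)

lemma sum_s: "(\<Sum>l=1..m. f (s l)) = (\<Sum>l=1..m. f l)"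
  by (rule sum.reindex_bij_betw[OF s_bij])

text \<open>The diagonal relations identify all \<open>h m k k\<close> and \<open>h_bar m k k\<close> with \<open>h m 1 1\<close>, which represents \<open>d\<close>.\<close>

lemma matrix_pair: "matrix_pair m xs ys (homogeneous m) (relations_mod_d m)"
proof
  have rel: "p \<in> relations_mod_d m 2" if "p = j + h m 1 1 * g" "j \<in> monoid_ideal m" "g = 0 \<or> g = 1" for p j g
    using that unfolding relations_mod_d_def
    by (intro CollectI exI[of _ j] exI[of _ g]) (auto simp: homogeneous_def mdeg_def)
  have one: "1 \<in> {1..m}" using m by simp
  fix i j assume ij: "i \<in> {1..m}" "j \<in> {1..m}"
  have s: "s i \<in> {1..m}" "s j \<in> {1..m}" using ij s_range by auto
  show "xs i j \<in> homogeneous m 1" "ys i j \<in> homogeneous m 1"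
    using s unfolding xs_def ys_def by (auto simp only: matrix_vars_iff intro!: homogeneous_mvar)
  have hh: "h m (s i) (s j) \<in> relations_mod_d m 2"
  proof (cases "s i = s j")
    case True
    have "h m (s i) (s i) - h_bar m 1 1 \<in> monoid_ideal m" "h m 1 1 - h_bar m 1 1 \<in> monoid_ideal m"
      by (rule relations_in_ideal; use s one in simp)+
    then have "(h m (s i) (s i) - h_bar m 1 1) - (h m 1 1 - h_bar m 1 1) \<in> monoid_ideal m"
      by (rule add_subgroup_diff[OF monoid_ideal_subgroup])
    then show ?thesis by (rule rel[rotated, where g = 1]) (use True in simp_all)
  next
    case False
    have "h m (s i) (s j) \<in> monoid_ideal m"
      using s False by (intro relations_in_ideal)
    then show ?thesis by (rule rel[rotated, where g = 0]) simp_all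
  qed
  then show "(\<Sum>l = 1..m. xs l i * ys l j) \<in> relations_mod_d m 2"
    using sum_s[of "\<lambda>l. x_var l (s i) * y_var l (s j)"] by (simp add: xs_def ys_def h_def)
  have "h_bar m (s i) (s j) \<in> relations_mod_d m 2"
  proof (cases "s i = s j")
    case True
    have "h m 1 1 - h_bar m (s i) (s i) \<in> monoid_ideal m"
      using s one by (intro relations_in_ideal)
    then have "- (h m 1 1 - h_bar m (s i) (s i)) \<in> monoid_ideal m"
      by (rule add_subgroup_uminus[OF monoid_ideal_subgroup])
    then show ?thesis by (rule rel[rotated, where g = 1]) (use True in simp_all)
  next
    case False
    have "h_bar m (s i) (s j) \<in> monoid_ideal m"
      using s False by (intro relations_in_ideal)
    then show ?thesis by (rule rel[rotated, where g = 0]) simp_all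
  qed
  then show "(\<Sum>l = 1..m. xs i l * ys j l) \<in> relations_mod_d m 2"
    using sum_s[of "\<lambda>l. x_var (s i) l * y_var (s j) l"] by (simp add: xs_def ys_def h_bar_def)
next
  fix a b k n assume a: "a \<in> homogeneous m k" and b: "b \<in> relations_mod_d m n"
  obtain j g where jg: "b = j + h m 1 1 * g" "j \<in> monoid_ideal m"
    "if 2 \<le> n then g \<in> homogeneous m (n - 2) else g = 0"
    using b unfolding relations_mod_d_def by blast
  have "a * b = a * j + h m 1 1 * (a * g)" using jg(1) by (simp add: algebra_simps)
  moreover have "a * j \<in> monoid_ideal m"
    using a homogeneous_carrier jg(2) by (intro monoid_ideal_mult) auto
  moreover have "if 2 \<le> k + n then a * g \<in> homogeneous m (k + n - 2) else a * g = 0"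
  proof (cases "2 \<le> n")
    case True
    then have "a * g \<in> homogeneous m (k + (n - 2))" using jg(3) a by (intro homogeneous_mult) auto
    then show ?thesis using True by simp
  next
    case False
    then show ?thesis using jg(3) add_subgroup_0[OF homogeneous_subgroup] by simp
  qed
  ultimately show "a * b \<in> relations_mod_d m (k + n)" unfolding relations_mod_d_def by blast
qed (simp_all add: homogeneous_subgroup homogeneous_mult relations_mod_d_subgroup,
    simp add: homogeneous_def mdeg_def)

text \<open>A variable is a minor of size one.\<close>

lemma monomial_minor_prod:
  assumes "Poly_Mapping.keys u \<subseteq> matrix_vars m"
  obtains L1 L2 where "bicols m L1" "bicols m L2" "bideg L1 + bideg L2 = mdeg u"
    "Poly_Mapping.single u 1 = minor_prod xs L1 * minor_prod ys L2"
proof -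
  have "\<exists>L1 L2. bicols m L1 \<and> bicols m L2 \<and> bideg L1 + bideg L2 = n \<and>
    Poly_Mapping.single u 1 = minor_prod xs L1 * minor_prod ys L2" if "mdeg u = n" for n
    using assms that
  proof (induction n arbitrary: u)
    case 0
    then have "u = 0" by (auto simp: mdeg_def in_keys_iff intro!: poly_mapping_eqI)
    then show ?case
      by (intro exI[of _ "[]"]) (simp add: bicols_simps bideg_def minor_prod_Nil)
  next
    case (Suc n)
    then obtain v where v: "v \<in> Poly_Mapping.keys u" by (force simp: mdeg_def)
    define w where "w = u - Poly_Mapping.single v 1"
    have u: "u = Poly_Mapping.single v 1 + w"
      using v by (intro poly_mapping_eqI)
        (auto simp: w_def lookup_add lookup_minus lookup_single in_keys_iff when_def)
    have kw: "Poly_Mapping.keys w \<subseteq> matrix_vars m"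
    proof
      fix x assume "x \<in> Poly_Mapping.keys w"
      then have "x \<in> Poly_Mapping.keys u" by (auto simp: w_def in_keys_iff lookup_minus)
      then show "x \<in> matrix_vars m" using Suc.prems by blast
    qed
    have dw: "mdeg w = n"
      using Suc.prems(2) u mdeg_add[of "Poly_Mapping.single v 1" w] by (simp add: mdeg_single)
    obtain L1 L2 where L: "bicols m L1" "bicols m L2" "bideg L1 + bideg L2 = n"
      "Poly_Mapping.single w 1 = minor_prod xs L1 * minor_prod ys L2"
      using Suc.IH[OF kw dw] by blast
    have prod: "Poly_Mapping.single u 1 = mvar v * (minor_prod xs L1 * minor_prod ys L2)"
      unfolding L(4)[symmetric] by (simp add: u mvar_def mult_single)
    have one: "minor X [i] [j] = X i j" for X :: "nat \<Rightarrow> nat \<Rightarrow> int_mpoly" and i j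
      by (simp add: minor_Cons minor_Nil del_def)
    have "v \<in> matrix_vars m" using v Suc.prems by blast
    then obtain i j where ij: "i \<in> {1..m}" "j \<in> {1..m}" "v = VX i j \<or> v = VY i j"
      unfolding matrix_vars_def by blast
    have c: "bicols m [([r i], [r j])]" using ij r_range by (simp add: bicols_simps)
    from ij(3) show ?case
    proof
      assume "v = VX i j"
      then have "mvar v = minor xs [r i] [r j]" using ij by (simp add: one xs_def s_r)
      then show ?thesis using L c prod
        by (intro exI[of _ "([r i], [r j]) # L1"] exI[of _ L2])
          (simp add: bicols_simps bideg_def minor_prod_Cons mult_ac)
    next
      assume "v = VY i j"
      then have "mvar v = minor ys [r i] [r j]" using ij by (simp add: one ys_def s_r)
      then show ?thesis using L c prod
        by (intro exI[of _ L1] exI[of _ "([r i], [r j]) # L2"])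
          (simp add: bicols_simps bideg_def minor_prod_Cons mult_ac)
    qed
  qed
  then show thesis using that by blast
qed

lemma std_products_lincombs:
  assumes "rat_std m (map fst L1) (map fst L2)" "rat_std m (map snd L1) (map snd L2)"
    "bicols m L1" "bicols m L2"
  shows "minor_prod xs L1 * minor_prod ys L2 \<in> lincombs m ord"
proof -
  let ?A1 = "map fst L1" and ?A2 = "map fst L2" and ?B1 = "map snd L1" and ?B2 = "map snd L2"
  let ?S = "(tab_of s ?A1, tab_of s ?A2)" and ?T = "(tab_of s ?B1, tab_of s ?B2)"
  have t: "tabcols m ?A1" "tabcols m ?A2" "tabcols m ?B1" "tabcols m ?B2"
    using assms by (auto simp: rat_std_def std_cols_tabcols)
  have len: "map length ?A1 = map length ?B1" "map length ?A2 = map length ?B2"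
    using assms(3,4) by (auto simp: bicols_def)
  have shape: "shape_of m C = shape_of m D" if "map length C = map length D" for C D
  proof -
    have "shape_of m E = map (\<lambda>i. length (filter ((<) i) (map length E))) [0..<m]" for E
      by (simp add: shape_of_def filter_map comp_def)
    then show ?thesis using that by (simp only:)
  qed
  have "is_rat_bitableau m (shape_of m ?A1) (shape_of m ?A2) (?S, ?T)"
    using is_tableau_tab_of[OF t(1)] is_tableau_tab_of[OF t(2)] is_tableau_tab_of[OF t(3)]
      is_tableau_tab_of[OF t(4)] shape[OF len(1)] shape[OF len(2)]
    by (simp add: is_rat_bitableau_def is_rat_tableau_def)
  moreover have "standard_rat_bitableau m ord (?S, ?T)"
    using assms(1,2) t standard_rat_tableau_tab_of by (simp add: standard_rat_bitableau_def)
  ultimately have "(0, (?S, ?T)) \<in> std_index m ord"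
    unfolding std_index_def using shape_of_partition by blast
  then have "bidet_poly m (0, (?S, ?T)) \<in> lincombs m ord" by (rule lincombs_basis)
  also have "bidet_poly m (0, (?S, ?T)) = minor_prod xs L1 * minor_prod ys L2"
    using bidet_part_tab_of[OF t(1,3) len(1), of x_var] bidet_part_tab_of[OF t(2,4) len(2), of y_var]
    by (simp add: bidet_poly_def xs_def[abs_def] ys_def[abs_def] zip_map_fst_snd)
  finally show ?thesis .
qed

text \<open>By induction on the degree: an element that vanishes modulo the relations and \<open>d\<close> is congruent to
  \<open>d\<close> times an element of lower degree, so straightening applies.\<close>

theorem standard_bideterminants_span:
  assumes "p \<in> carrier (poly_ring m)"
  shows "p \<in> lincombs m ord"
proof -
  interpret M: matrix_pair m xs ys "homogeneous m" "relations_mod_d m" by (rule matrix_pair)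
  note V = lincombs_subgroup[of m ord]
  \<comment> \<open>It suffices to treat products of minors of the degrees that occur.\<close>
  have monomials: "q \<in> lincombs m ord"
    if mono: "\<And>L1 L2. bicols m L1 \<Longrightarrow> bicols m L2 \<Longrightarrow> Q (bideg L1 + bideg L2) \<Longrightarrow>
        minor_prod xs L1 * minor_prod ys L2 \<in> lincombs m ord"
      and q: "q \<in> carrier (poly_ring m)" "\<forall>u\<in>Poly_Mapping.keys q. Q (mdeg u)" for q Q
  proof -
    have "(\<Sum>u\<in>Poly_Mapping.keys q. of_int (Poly_Mapping.lookup q u) * Poly_Mapping.single u 1) \<in> lincombs m ord"
    proof (intro add_subgroup_sum[OF V] add_subgroup_of_int[OF V])
      fix u assume u: "u \<in> Poly_Mapping.keys q"
      then have "Poly_Mapping.keys u \<subseteq> matrix_vars m" using q by (simp add: poly_carrier)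
      then obtain L1 L2 where "bicols m L1" "bicols m L2" "bideg L1 + bideg L2 = mdeg u"
        "Poly_Mapping.single u 1 = minor_prod xs L1 * minor_prod ys L2" by (rule monomial_minor_prod)
      then show "Poly_Mapping.single u 1 \<in> lincombs m ord" using mono q u by auto
    qed
    also have "(\<Sum>u\<in>Poly_Mapping.keys q. of_int (Poly_Mapping.lookup q u) * Poly_Mapping.single u 1) = q"
    proof (rule poly_mapping_eqI)
      fix w
      have "Poly_Mapping.lookup (of_int k * Poly_Mapping.single u 1) w = (k when u = w)" for k :: int and u :: "var \<Rightarrow>\<^sub>0 nat"
      proof -
        have "(of_int k :: int_mpoly) = Poly_Mapping.single 0 k" 
          by (intro poly_mapping_eqI) (simp add: lookup_of_int lookup_single when_def)
        then show ?thesis by (simp add: mult_single lookup_single)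
      qed
      then show "Poly_Mapping.lookup (\<Sum>u\<in>Poly_Mapping.keys q. of_int (Poly_Mapping.lookup q u) * Poly_Mapping.single u 1) w =
          Poly_Mapping.lookup q w"
        by (simp add: lookup_sum when_def in_keys_iff)
    qed
    finally show ?thesis .
  qed
  have products: "minor_prod xs L1 * minor_prod ys L2 \<in> lincombs m ord"
    if "bicols m L1" "bicols m L2" "bideg L1 + bideg L2 = n" for L1 L2 n
    using that
  proof (induction n arbitrary: L1 L2 rule: less_induct)
    case (less n)
    have "relations_mod_d m n \<subseteq> lincombs m ord"
    proof
      fix z assume "z \<in> relations_mod_d m n"
      then obtain j g where jg: "z = j + h m 1 1 * g" "j \<in> monoid_ideal m"
        "if 2 \<le> n then g \<in> homogeneous m (n - 2) else g = 0"
        unfolding relations_mod_d_def by blast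
      have "g \<in> lincombs m ord"
      proof (cases "2 \<le> n")
        case True
        then have g: "g \<in> homogeneous m (n - 2)" using jg(3) by simp
        show ?thesis
        proof (rule monomials[where Q = "\<lambda>k. k = n - 2"])
          show "minor_prod xs L1 * minor_prod ys L2 \<in> lincombs m ord"
            if "bicols m L1" "bicols m L2" "bideg L1 + bideg L2 = n - 2" for L1 L2
            using less.IH[OF _ that] True by simp
          show "g \<in> carrier (poly_ring m)" using g homogeneous_carrier by blast
          show "\<forall>u\<in>Poly_Mapping.keys g. mdeg u = n - 2" using g by (simp add: homogeneous_def)
        qed
      next
        case False
        then show ?thesis using jg(3) add_subgroup_0[OF V] by simp
      qed
      then show "z \<in> lincombs m ord"
        unfolding jg(1)
        by (intro add_subgroup_add[OF V lincombs_ideal[OF jg(2)]] lincombs_d_mult[OF m])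
    qed
    then show ?case
      using M.straightening[OF V _ _ less.prems] std_products_lincombs by blast
  qed
  show ?thesis
    by (rule monomials[where Q = "\<lambda>_. True"]) (use products assms in auto)
qed

end

section \<open>Evaluation of polynomials\<close>

definition meval :: "('v \<Rightarrow> 'b::comm_ring_1) \<Rightarrow> ('v \<Rightarrow>\<^sub>0 nat) \<Rightarrow> 'b"
  where "meval \<phi> u = (\<Prod>v\<in>Poly_Mapping.keys u. \<phi> v ^ Poly_Mapping.lookup u v)"

definition peval :: "('v \<Rightarrow> 'b::comm_ring_1) \<Rightarrow> (('v \<Rightarrow>\<^sub>0 nat) \<Rightarrow>\<^sub>0 int) \<Rightarrow> 'b"
  where "peval \<phi> p = (\<Sum>u\<in>Poly_Mapping.keys p. of_int (Poly_Mapping.lookup p u) * meval \<phi> u)"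

lemma meval_superset:
  "finite A \<Longrightarrow> Poly_Mapping.keys u \<subseteq> A \<Longrightarrow> meval \<phi> u = (\<Prod>v\<in>A. \<phi> v ^ Poly_Mapping.lookup u v)"
  unfolding meval_def by (rule prod.mono_neutral_left) (auto simp: in_keys_iff)

lemma meval_add: "meval \<phi> (u + w) = meval \<phi> u * meval \<phi> w"
proof -
  let ?A = "Poly_Mapping.keys u \<union> Poly_Mapping.keys w"
  have "meval \<phi> x = (\<Prod>v\<in>?A. \<phi> v ^ Poly_Mapping.lookup x v)" if "Poly_Mapping.keys x \<subseteq> ?A" for x
    using that by (intro meval_superset) auto
  then show ?thesis
    using Poly_Mapping.keys_add[of u w] by (simp add: lookup_add power_add prod.distrib)
qed

lemma peval_superset:
  "finite A \<Longrightarrow> Poly_Mapping.keys p \<subseteq> A \<Longrightarrow>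
   peval \<phi> p = (\<Sum>u\<in>A. of_int (Poly_Mapping.lookup p u) * meval \<phi> u)"
  unfolding peval_def by (rule sum.mono_neutral_left) (auto simp: in_keys_iff)

lemma peval_add: "peval \<phi> (p + q) = peval \<phi> p + peval \<phi> q"
proof -
  let ?A = "Poly_Mapping.keys p \<union> Poly_Mapping.keys q"
  have "peval \<phi> x = (\<Sum>u\<in>?A. of_int (Poly_Mapping.lookup x u) * meval \<phi> u)"
    if "Poly_Mapping.keys x \<subseteq> ?A" for x
    using that by (intro peval_superset) auto
  then show ?thesis
    using Poly_Mapping.keys_add[of p q] by (simp add: lookup_add distrib_right sum.distrib)
qed

lemma peval_zero: "peval \<phi> 0 = 0"
  by (simp add: peval_def)

lemma peval_sum: "peval \<phi> (sum f A) = (\<Sum>x\<in>A. peval \<phi> (f x))"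
  by (induction A rule: infinite_finite_induct) (simp_all add: peval_zero peval_add)

lemma peval_single: "peval \<phi> (Poly_Mapping.single u c) = of_int c * meval \<phi> u"
  by (simp add: peval_def)

lemma poly_mapping_sum_singles:
  "(\<Sum>u\<in>Poly_Mapping.keys p. Poly_Mapping.single u (Poly_Mapping.lookup p u)) = p"
  by (rule poly_mapping_eqI) (simp add: lookup_sum lookup_single when_def in_keys_iff)

lemma peval_mult: "peval \<phi> (p * q) = peval \<phi> p * peval \<phi> q"
proof -
  let ?s = "\<lambda>p. \<Sum>u\<in>Poly_Mapping.keys p. Poly_Mapping.single u (Poly_Mapping.lookup p u)"
  have "peval \<phi> (?s p * ?s q) = peval \<phi> (?s p) * peval \<phi> (?s q)"
    by (simp add: sum_product peval_sum mult_single peval_single meval_add mult_ac)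
  then show ?thesis by (simp only: poly_mapping_sum_singles)
qed

lemma peval_one: "peval \<phi> 1 = 1"
proof -
  have "peval \<phi> (Poly_Mapping.single 0 1) = 1"
    unfolding peval_single by (simp add: meval_def)
  then show ?thesis by simp
qed

lemma peval_mvar: "peval \<phi> (mvar v) = \<phi> v"
  by (simp add: mvar_def peval_single meval_def)

lemma peval_hom: "comm_ring_hom (peval \<phi>)"
  by unfold_locales (simp_all add: peval_add peval_mult peval_one peval_zero)

lemma hom_minor:
  assumes "comm_ring_hom f"
  shows "f (minor X I J) = minor (\<lambda>i j. f (X i j)) I J"
proof (cases "length I = length J")
  case True
  interpret comm_ring_hom f by (rule assms)
  have "map_mat f (mat (length I) (length I) (\<lambda>(a, b). X (I ! a) (J ! b))) =
      mat (length I) (length I) (\<lambda>(a, b). f (X (I ! a) (J ! b)))"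
    by (intro eq_matI) auto
  then show ?thesis using True by (simp add: minor_def flip: hom_det)
next
  case False
  interpret comm_ring_hom f by (rule assms)
  show ?thesis using False by (simp add: minor_length_neq)
qed

lemma hom_minor_prod:
  assumes "comm_ring_hom f"
  shows "f (minor_prod X L) = minor_prod (\<lambda>i j. f (X i j)) L"
proof -
  interpret comm_ring_hom f by (rule assms)
  show ?thesis
    by (induction L) (auto simp: minor_prod_Nil minor_prod_Cons hom_mult hom_minor[OF assms])
qed

section \<open>Complementary minors\<close>

lemma minor_scale_rows:
  "minor (\<lambda>k i. c k * X k i) K I = (\<Prod>k\<leftarrow>K. c k) * minor X K I"
proof (induction K arbitrary: I)
  case (Cons k K)
  then show ?case by (simp add: minor_Cons sum_distrib_left mult_ac)
qed (simp add: minor_Nil)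

definition compl_cols :: "nat \<Rightarrow> nat list \<Rightarrow> nat list"
  where "compl_cols m I = filter (\<lambda>k. k \<notin> set I) [1..<Suc m]"

lemma set_compl_cols: "set (compl_cols m I) = {1..m} - set I"
  by (auto simp: compl_cols_def)

lemma sorted_compl_cols: "sorted_wrt (<) (compl_cols m I)"
  by (simp add: compl_cols_def sorted_wrt_filter del: upt_Suc)

lemma filter_upt_eq:
  assumes "sorted_wrt (<) I" "set I \<subseteq> {1..m}"
  shows "filter (\<lambda>k. k \<in> set I) [1..<Suc m] = I"
proof (rule sorted_distinct_set_unique)
  show "sorted (filter (\<lambda>k. k \<in> set I) [1..<Suc m])" by (intro sorted_wrt_filter) (simp del: upt_Suc)
  show "sorted I" "distinct I" using assms(1) by (auto simp: strict_sorted_iff)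
qed (use assms(2) in \<open>auto simp del: upt_Suc\<close>)

lemma compl_compl_cols:
  assumes "sorted_wrt (<) I" "set I \<subseteq> {1..m}"
  shows "compl_cols m (compl_cols m I) = I"
proof -
  have "compl_cols m (compl_cols m I) = filter (\<lambda>k. k \<in> set I) [1..<Suc m]"
    unfolding compl_cols_def[of m "compl_cols m I"] set_compl_cols
    by (rule filter_cong) auto
  then show ?thesis using filter_upt_eq[OF assms] by simp
qed

lemma length_compl_cols:
  assumes "distinct I" "set I \<subseteq> {1..m}"
  shows "length (compl_cols m I) = m - length I"
proof -
  have "length (compl_cols m I) = card ({1..m} - set I)"
    using distinct_card[of "compl_cols m I"] sorted_compl_cols[of m I]
    by (simp add: set_compl_cols strict_sorted_iff)
  then show ?thesis using assms by (simp add: card_Diff_subset distinct_card)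
qed

text \<open>In the Laplace expansion the unit rows force the second factor to use exactly the columns outside
  \<open>I\<close>, so a single splitting survives.\<close>

lemma minor_single_split:
  fixes Y :: "nat \<Rightarrow> nat \<Rightarrow> 'a::comm_ring_1" and c :: 'a
  assumes I: "sorted_wrt (<) I" "set I \<subseteq> {1..m}"
    and len: "length J = length I"
  shows "minor (case_sum (\<lambda>j i. Y i j) (\<lambda>k i. if i = k then c else 0))
      (map Inl J @ map Inr (compl_cols m I)) [1..<Suc m] = c ^ (m - length I) * minor Y I J \<or>
    minor (case_sum (\<lambda>j i. Y i j) (\<lambda>k i. if i = k then c else 0))
      (map Inl J @ map Inr (compl_cols m I)) [1..<Suc m] = - (c ^ (m - length I) * minor Y I J)"
proof -
  let ?c = "compl_cols m I" and ?full = "[1..<Suc m]"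
  let ?Z = "case_sum (\<lambda>j i. Y i j) (\<lambda>k i. if i = k then c else 0) :: nat + nat \<Rightarrow> nat \<Rightarrow> 'a"
  let ?D = "\<lambda>k i. if i = k then c else 0"
  let ?F = "\<lambda>(A, B, s). of_int s * minor ?Z (map Inl J) A * minor ?Z (map Inr ?c) B"
  have d: "distinct ?full" by simp
  obtain s rest where iso: "s = 1 \<or> s = -1"
    "(\<Sum>x\<leftarrow>splits ?full. ?F x) =
       ?F (filter (\<lambda>k. k \<in> set I) ?full, filter (\<lambda>k. k \<notin> set I) ?full, s) + (\<Sum>x\<leftarrow>rest. ?F x)"
    "\<And>A B t. (A, B, t) \<in> set rest \<Longrightarrow> (A, B, t) \<in> set (splits ?full) \<and> set A \<noteq> set I \<inter> set ?full"
    using sum_list_splits_isolate[OF d, of ?F "set I"] by metis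
  have inr: "minor ?Z (map Inr ?c) B = minor ?D ?c B" for B
    using minor_map[of ?Z Inr ?c "\<lambda>x. x" B] by simp
  have inl: "minor ?Z (map Inl J) A = minor Y A J" for A
    using minor_map[of ?Z Inl J "\<lambda>x. x" A] minor_transpose[of "\<lambda>j i. Y i j" J A] by simp
  have zero: "?F x = 0" if x: "x \<in> set rest" for x
  proof -
    obtain A B t where xeq: "x = (A, B, t)" by (cases x)
    have spl: "(A, B, t) \<in> set (splits ?full)" and ne: "set A \<noteq> set I \<inter> set ?full"
      using iso(3) x xeq by auto
    have ms: "mset A + mset B = mset ?full" by (rule splits_mset[OF spl])
    have dAB: "distinct (A @ B)" using ms d by (metis mset_append mset_eq_imp_distinct_iff)
    have sAB: "set A \<union> set B = {1..m}"
      using arg_cong[OF ms, of set_mset] by (simp del: upt_Suc) auto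
    show ?thesis
    proof (cases "length B = length ?c")
      case True
      have "\<not> set ?c \<subseteq> set B"
      proof
        assume "set ?c \<subseteq> set B"
        moreover have "card (set B) = card (set ?c)"
          using True dAB sorted_compl_cols[of m I] by (simp add: distinct_card strict_sorted_iff)
        ultimately have "set B = set ?c" by (metis card_subset_eq List.finite_set)
        then have "set A = set I" using sAB dAB I(2) by (auto simp: set_compl_cols)
        then show False using ne I(2) by (simp del: upt_Suc) (auto simp del: upt_Suc)
      qed
      then obtain k where k: "k \<in> set ?c" "k \<notin> set B" by blast
      have "minor ?D ?c B = 0" by (rule minor_zero_row[OF k(1)]) (use k(2) in auto)
      then show ?thesis by (simp add: xeq inr)
    next
      case False
      then have "minor ?D ?c B = 0" by (intro minor_length_neq) simp
      then show ?thesis by (simp add: xeq inr)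
    qed
  qed
  have "(\<Sum>x\<leftarrow>rest. ?F x) = 0"
    using zero by (induction rest) auto
  then have "minor ?Z (map Inl J @ map Inr ?c) ?full =
      ?F (filter (\<lambda>k. k \<in> set I) ?full, filter (\<lambda>k. k \<notin> set I) ?full, s)"
    using iso(2) by (simp only: laplace_rows[symmetric] case_prod_unfold add_0_right) (simp add: laplace_rows case_prod_unfold)
  also have "filter (\<lambda>k. k \<in> set I) ?full = I" by (rule filter_upt_eq[OF I])
  also have "filter (\<lambda>k. k \<notin> set I) ?full = ?c" by (simp add: compl_cols_def)
  also have "?F (I, ?c, s) = of_int s * minor Y I J * minor ?D ?c ?c"
    by (simp add: inl inr)
  also have "minor ?D ?c ?c = c ^ (m - length I)"
  proof -
    have dc: "distinct ?c" using sorted_compl_cols[of m I] by (simp add: strict_sorted_iff)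
    have "minor ?D ?c ?c = minor (\<lambda>k i. c * (if k = i then 1 else 0)) ?c ?c"
      by (rule minor_cong) auto
    also have "\<dots> = c ^ length ?c * minor (\<lambda>k i. if k = i then 1 else 0) ?c ?c"
      by (subst minor_scale_rows) (simp add: map_replicate_const prod_list_replicate)
    also have "\<dots> = c ^ length ?c" by (simp add: minor_delta_self[OF dc])
    finally show ?thesis
      using I by (simp add: length_compl_cols strict_sorted_iff)
  qed
  finally show ?thesis using iso(1) by (auto simp: mult_ac)
qed

text \<open>Jacobi's theorem. Complete the columns \<open>J\<close> of \<open>Y\<close> by the unit vectors outside \<open>I\<close> to a square
  matrix. Its determinant is the minor of \<open>Y\<close> up to sign, and its product with the transpose of \<open>X\<close> has
  \<open>d\<close> times unit vectors next to columns of the transpose of \<open>X\<close>, hence determinant \<open>d\<close> to the power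
  \<open>length I\<close> times the complementary minor.\<close>

theorem complementary_minor:
  fixes X Y :: "nat \<Rightarrow> nat \<Rightarrow> 'a::comm_ring_1"
  assumes XY: "\<And>i j. i \<in> {1..m} \<Longrightarrow> j \<in> {1..m} \<Longrightarrow>
      (\<Sum>l=1..m. X l i * Y l j) = (if i = j then d else 0)"
    and I: "sorted_wrt (<) I" "set I \<subseteq> {1..m}" and J: "sorted_wrt (<) J" "set J \<subseteq> {1..m}"
    and len: "length J = length I"
  defines "D \<equiv> minor X [1..<Suc m] [1..<Suc m]"
    and "c \<equiv> minor X (compl_cols m I) (compl_cols m J)"
  shows "D * minor Y I J = d ^ length I * c \<or> D * minor Y I J = - (d ^ length I * c)"
proof -
  let ?full = "[1..<Suc m]" and ?cI = "compl_cols m I" and ?cJ = "compl_cols m J"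
  \<comment> \<open>\<open>Inl j\<close> names column \<open>j\<close> of \<open>Y\<close>, and \<open>Inr k\<close> the unit vector with index \<open>k\<close>\<close>
  let ?Z = "case_sum (\<lambda>j i. Y i j) (\<lambda>k i. if i = k then 1 else 0) :: nat + nat \<Rightarrow> nat \<Rightarrow> 'a"
  let ?cols = "map Inl J @ map Inr ?cI"
  have dI: "distinct I" "distinct J" using I J by (auto simp: strict_sorted_iff)
  have lc: "length ?cI = m - length I" "length ?cJ = m - length I"
    using dI I J len by (simp_all add: length_compl_cols)
  have lI: "length I \<le> m" by (rule length_strict_le[OF I])
  have Z: "minor ?Z ?cols ?full = minor Y I J \<or> minor ?Z ?cols ?full = - minor Y I J"
    using minor_single_split[OF I len, of Y 1] by simp
  \<comment> \<open>Cauchy--Binet for square matrices: only the full set of rows occurs\<close>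
  have "minor (\<lambda>i c. \<Sum>l\<in>{1..m}. X l i * ?Z c l) ?full ?cols =
    (\<Sum>S | S \<subseteq> {1..m} \<and> card S = length ?full.
       minor X (sorted_list_of_set S) ?full * minor (\<lambda>l c. ?Z c l) (sorted_list_of_set S) ?cols)"
    by (rule cauchy_binet) simp
  also have "{S. S \<subseteq> {1..m} \<and> card S = length ?full} = {{1..m}}"
    using card_subset_eq[of "{1..m}"] by (auto simp del: upt_Suc)
  also have "(\<Sum>S\<in>{{1..m}}. minor X (sorted_list_of_set S) ?full * minor (\<lambda>l c. ?Z c l) (sorted_list_of_set S) ?cols) =
      D * minor ?Z ?cols ?full"
  proof -
    have "sorted_list_of_set {1..m} = ?full"
      by (metis atLeastLessThanSuc_atLeastAtMost sorted_list_of_set_range)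
    moreover have "minor (\<lambda>l c. ?Z c l) ?full ?cols = minor ?Z ?cols ?full"
      by (rule minor_transpose[symmetric])
    ultimately show ?thesis unfolding D_def by (simp del: upt_Suc)
  qed
  finally have left: "minor (\<lambda>i c. \<Sum>l\<in>{1..m}. X l i * ?Z c l) ?full ?cols = D * minor ?Z ?cols ?full" .
  \<comment> \<open>The product matrix is \<open>d\<close> times a partial permutation matrix next to columns taken from the rows of \<open>X\<close>.\<close>
  let ?W = "case_sum (\<lambda>k i. X k i) (\<lambda>j i. if i = j then d else 0) :: nat + nat \<Rightarrow> nat \<Rightarrow> 'a"
  have "minor (\<lambda>i c. \<Sum>l\<in>{1..m}. X l i * ?Z c l) ?full ?cols =
      minor (\<lambda>i c. ?W (case_sum Inr Inl c) i) ?full ?cols"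
  proof (rule minor_cong)
    fix i c assume i: "i \<in> set ?full" and c: "c \<in> set ?cols"
    then have i': "i \<in> {1..m}" by auto
    show "(\<Sum>l\<in>{1..m}. X l i * ?Z c l) = ?W (case_sum Inr Inl c) i"
    proof (cases c)
      case (Inl j)
      then have "j \<in> {1..m}" using c J by auto
      then show ?thesis using XY[OF i'] Inl by simp
    next
      case (Inr k)
      then have "k \<in> {1..m}" using c by (auto simp: set_compl_cols)
      then show ?thesis using Inr by (simp add: if_distrib cong: if_cong)
    qed
  qed
  also have "\<dots> = minor (\<lambda>c i. ?W (case_sum Inr Inl c) i) ?cols ?full"
    by (rule minor_transpose)
  also have "\<dots> = minor ?W (map (case_sum Inr Inl) ?cols) ?full"
    using minor_map[of ?W "case_sum Inr Inl" ?cols "\<lambda>x. x" ?full] by (simp del: upt_Suc)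
  finally have right: "minor (\<lambda>i c. \<Sum>l\<in>{1..m}. X l i * ?Z c l) ?full ?cols =
      minor ?W (map Inr J @ map Inl ?cI) ?full" by (simp add: comp_def del: upt_Suc)
  \<comment> \<open>reordering brings the rows of \<open>X\<close> to the front, as \<open>minor_single_split\<close> requires\<close>
  have perm: "mset (map Inr J @ map Inl ?cI :: (nat + nat) list) = mset (map Inl ?cI @ map Inr J)"
    by simp
  have "minor ?W (map Inl ?cI @ map Inr J) ?full = d ^ length I * c \<or>
      minor ?W (map Inl ?cI @ map Inr J) ?full = - (d ^ length I * c)"
    using minor_single_split[of ?cJ m ?cI "\<lambda>i k. X k i" d] sorted_compl_cols[of m J]
      set_compl_cols[of m J] lc lI compl_compl_cols[OF J]
    by (simp add: c_def minor_transpose[of X ?cI ?cJ] del: upt_Suc)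
  moreover have "D * y = e \<or> D * y = - e" if "D * z = w'" "z = y \<or> z = - y" "w' = w \<or> w' = - w"
    "w = e \<or> w = - e" for z w' w y e :: 'a
    using that by (elim disjE; metis minus_minus mult_minus_right)
  ultimately show ?thesis
    using trans[OF left[symmetric] right] Z minor_permute_rows[OF perm, of ?W ?full] by blast
qed

section \<open>Degrees and leading monomials\<close>

definition additive :: "(('v \<Rightarrow>\<^sub>0 nat) \<Rightarrow> nat) \<Rightarrow> bool"
  where "additive \<theta> \<longleftrightarrow> (\<forall>u w. \<theta> (u + w) = \<theta> u + \<theta> w)"

definition hom_deg :: "(('v \<Rightarrow>\<^sub>0 nat) \<Rightarrow> nat) \<Rightarrow> nat \<Rightarrow> (('v \<Rightarrow>\<^sub>0 nat) \<Rightarrow>\<^sub>0 int) set"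
  where "hom_deg \<theta> n = {f. \<forall>u\<in>Poly_Mapping.keys f. \<theta> u = n}"

definition deg_le :: "(('v \<Rightarrow>\<^sub>0 nat) \<Rightarrow> nat) \<Rightarrow> nat \<Rightarrow> (('v \<Rightarrow>\<^sub>0 nat) \<Rightarrow>\<^sub>0 int) set"
  where "deg_le \<theta> n = {f. \<forall>u\<in>Poly_Mapping.keys f. \<theta> u \<le> n}"

lemma hom_deg_subgroup: "add_subgroup (hom_deg \<theta> n)"
  unfolding add_subgroup_def
proof (intro conjI ballI)
  fix a b assume "a \<in> hom_deg \<theta> n" "b \<in> hom_deg \<theta> n"
  then show "a - b \<in> hom_deg \<theta> n" using keys_diff[of a b] by (auto simp: hom_deg_def)
qed (simp add: hom_deg_def)

lemma deg_le_subgroup: "add_subgroup (deg_le \<theta> n)"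
  unfolding add_subgroup_def
proof (intro conjI ballI)
  fix a b assume "a \<in> deg_le \<theta> n" "b \<in> deg_le \<theta> n"
  then show "a - b \<in> deg_le \<theta> n" using keys_diff[of a b] by (auto simp: deg_le_def)
qed (simp add: deg_le_def)

lemma hom_deg_mult:
  assumes "additive \<theta>" "a \<in> hom_deg \<theta> k" "b \<in> hom_deg \<theta> n"
  shows "a * b \<in> hom_deg \<theta> (k + n)"
  unfolding hom_deg_def
proof (intro CollectI ballI)
  fix u assume "u \<in> Poly_Mapping.keys (a * b)"
  then obtain x y where "u = x + y" "x \<in> Poly_Mapping.keys a" "y \<in> Poly_Mapping.keys b"
    using keys_mult[of a b] by blast
  then show "\<theta> u = k + n" using assms by (simp add: hom_deg_def additive_def)
qed

lemma deg_le_mult: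
  assumes "additive \<theta>" "a \<in> deg_le \<theta> k" "b \<in> deg_le \<theta> n"
  shows "a * b \<in> deg_le \<theta> (k + n)"
  unfolding deg_le_def
proof (intro CollectI ballI)
  fix u assume "u \<in> Poly_Mapping.keys (a * b)"
  then obtain x y where "u = x + y" "x \<in> Poly_Mapping.keys a" "y \<in> Poly_Mapping.keys b"
    using keys_mult[of a b] by blast
  then show "\<theta> u \<le> k + n" using assms by (auto simp: deg_le_def additive_def intro: add_mono)
qed

lemma additive_zero: "additive \<theta> \<Longrightarrow> \<theta> 0 = 0"
  unfolding additive_def by (metis add_cancel_right_right)

lemma hom_deg_one: "additive \<theta> \<Longrightarrow> 1 \<in> hom_deg \<theta> 0"
  by (simp add: hom_deg_def additive_zero)

lemma hom_deg_power:
  assumes "additive \<theta>" "a \<in> hom_deg \<theta> k"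
  shows "a ^ n \<in> hom_deg \<theta> (n * k)"
proof (induction n)
  case (Suc n)
  then show ?case using hom_deg_mult[OF assms Suc] by simp
qed (simp add: hom_deg_one[OF assms(1)])

lemma hom_deg_le: "f \<in> hom_deg \<theta> n \<Longrightarrow> n \<le> k \<Longrightarrow> f \<in> deg_le \<theta> k"
  by (simp add: hom_deg_def deg_le_def)

lemma sum_list_del:
  fixes f :: "'a \<Rightarrow> nat"
  assumes "b < length J"
  shows "(\<Sum>j\<leftarrow>J. f j) = f (J ! b) + (\<Sum>j\<leftarrow>del b J. f j)"
proof -
  have "J = take b J @ J ! b # drop (Suc b) J" using assms by (rule id_take_nth_drop)
  then have "(\<Sum>j\<leftarrow>J. f j) = (\<Sum>j\<leftarrow>take b J @ J ! b # drop (Suc b) J. f j)" by simp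
  then show ?thesis by (simp add: del_def)
qed

lemma set_del: "set (del b J) \<subseteq> set J"
  by (auto simp: del_def dest: in_set_takeD in_set_dropD)

text \<open>Every term of a determinant uses each row and each column once.\<close>

lemma minor_hom_deg:
  assumes \<theta>: "additive \<theta>"
    and X: "\<And>i j. i \<in> set I \<Longrightarrow> j \<in> set J \<Longrightarrow> X i j \<in> hom_deg \<theta> (\<alpha> i + \<beta> j)"
  shows "minor X I J \<in> hom_deg \<theta> ((\<Sum>i\<leftarrow>I. \<alpha> i) + (\<Sum>j\<leftarrow>J. \<beta> j))"
  using X
proof (induction I arbitrary: J)
  case Nil
  then show ?case
    using add_subgroup_0[OF hom_deg_subgroup] hom_deg_one[OF \<theta>] by (cases J) (auto simp: minor_Nil)
next
  case (Cons i I)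
  have sgn: "(- 1) ^ b \<in> hom_deg \<theta> 0" for b
    using add_subgroup_sign[OF hom_deg_subgroup hom_deg_one[OF \<theta>], of "(- 1) ^ b"]
    by (auto simp: minus_one_power_iff)
  show ?case
    unfolding minor_Cons
  proof (rule add_subgroup_sum[OF hom_deg_subgroup])
    fix b assume "b \<in> {..<length J}"
    then have b: "b < length J" by simp
    have "minor X I (del b J) \<in> hom_deg \<theta> ((\<Sum>i\<leftarrow>I. \<alpha> i) + (\<Sum>j\<leftarrow>del b J. \<beta> j))"
      using set_del[of b J] by (intro Cons.IH Cons.prems) auto
    moreover have "X i (J ! b) \<in> hom_deg \<theta> (\<alpha> i + \<beta> (J ! b))" using b by (intro Cons.prems) auto
    ultimately have "(-1) ^ b * X i (J ! b) * minor X I (del b J) \<in>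
        hom_deg \<theta> (0 + (\<alpha> i + \<beta> (J ! b)) + ((\<Sum>i\<leftarrow>I. \<alpha> i) + (\<Sum>j\<leftarrow>del b J. \<beta> j)))"
      using hom_deg_mult[OF \<theta>] sgn by blast
    then show "(-1) ^ b * X i (J ! b) * minor X I (del b J) \<in>
        hom_deg \<theta> ((\<Sum>i\<leftarrow>i # I. \<alpha> i) + (\<Sum>j\<leftarrow>J. \<beta> j))"
      using sum_list_del[OF b, of \<beta>] by (simp add: ac_simps)
  qed
qed

subsection \<open>Leading monomials\<close>

definition lead :: "(('v::linorder \<Rightarrow>\<^sub>0 nat) \<Rightarrow>\<^sub>0 int) \<Rightarrow> ('v \<Rightarrow>\<^sub>0 nat) \<Rightarrow> bool"
  where "lead f u \<longleftrightarrow> u \<in> Poly_Mapping.keys f \<and> (\<forall>w\<in>Poly_Mapping.keys f. w \<le> u)"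

text \<open>The order of exponent vectors is lexicographic, with the smallest variable most significant.\<close>

lemma less_monomial:
  fixes f g :: "'v::linorder \<Rightarrow>\<^sub>0 nat"
  assumes "Poly_Mapping.lookup f p < Poly_Mapping.lookup g p"
    "\<And>q. q < p \<Longrightarrow> Poly_Mapping.lookup f q = Poly_Mapping.lookup g q"
  shows "f < g"
  using assms by transfer (auto simp: less_fun_def)

lemma lead_mult:
  assumes f: "lead f u" and g: "lead g w"
  shows "lead (f * g) (u + w)"
proof -
  let ?F = "Poly_Mapping.keys f" and ?G = "Poly_Mapping.keys g"
  have "f * g = (\<Sum>a\<in>?F. Poly_Mapping.single a (Poly_Mapping.lookup f a)) *
      (\<Sum>b\<in>?G. Poly_Mapping.single b (Poly_Mapping.lookup g b))"
    by (simp only: poly_mapping_sum_singles)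
  also have "\<dots> = (\<Sum>a\<in>?F. \<Sum>b\<in>?G.
      Poly_Mapping.single (a + b) (Poly_Mapping.lookup f a * Poly_Mapping.lookup g b))"
    by (simp add: sum_product mult_single)
  finally have "Poly_Mapping.lookup (f * g) (u + w) = (\<Sum>a\<in>?F. \<Sum>b\<in>?G.
      (Poly_Mapping.lookup f a * Poly_Mapping.lookup g b when a + b = u + w))"
    by (simp add: lookup_sum lookup_single)
  also have "\<dots> = (\<Sum>a\<in>?F. \<Sum>b\<in>?G.
      (if a = u \<and> b = w then Poly_Mapping.lookup f a * Poly_Mapping.lookup g b else 0))"
  proof (intro sum.cong refl)
    fix a b assume ab: "a \<in> ?F" "b \<in> ?G"
    have "a \<le> u" "b \<le> w" using ab f g by (auto simp: lead_def)
    then have "a + b = u + w \<longleftrightarrow> a = u \<and> b = w"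
      by (metis add_less_le_mono add_le_less_mono order_le_less order_less_irrefl)
    then show "(Poly_Mapping.lookup f a * Poly_Mapping.lookup g b when a + b = u + w) =
      (if a = u \<and> b = w then Poly_Mapping.lookup f a * Poly_Mapping.lookup g b else 0)"
      by (simp add: when_def)
  qed
  also have "\<dots> = (\<Sum>a\<in>?F. if a = u then Poly_Mapping.lookup f u * Poly_Mapping.lookup g w else 0)"
  proof (rule sum.cong[OF refl])
    fix a
    show "(\<Sum>b\<in>?G. if a = u \<and> b = w then Poly_Mapping.lookup f a * Poly_Mapping.lookup g b else 0) =
      (if a = u then Poly_Mapping.lookup f u * Poly_Mapping.lookup g w else 0)"
      using g by (cases "a = u") (simp_all add: lead_def)
  qed
  also have "\<dots> = Poly_Mapping.lookup f u * Poly_Mapping.lookup g w"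
    using f by (simp add: lead_def)
  finally have "u + w \<in> Poly_Mapping.keys (f * g)"
    using f g by (simp add: lead_def in_keys_iff)
  moreover have "v \<le> u + w" if v: "v \<in> Poly_Mapping.keys (f * g)" for v
  proof -
    obtain a b where "v = a + b" "a \<in> ?F" "b \<in> ?G" using v keys_mult[of f g] by blast
    then show ?thesis using f g by (auto simp: lead_def intro: add_mono)
  qed
  ultimately show ?thesis by (simp add: lead_def)
qed

lemma lead_uminus: "lead (- f) u \<longleftrightarrow> lead f u"
  by (simp add: lead_def)

lemma lead_one: "lead 1 0"
  by (simp add: lead_def)

lemma lead_mvar_power: "lead (Poly_Mapping.single u 1) u"
  by (simp add: lead_def)

lemma lead_power:
  assumes "lead f u"
  shows "lead (f ^ n) (\<Sum>_\<in>{..<n}. u)"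
proof (induction n)
  case (Suc n)
  then show ?case using lead_mult[OF Suc assms] by (simp add: mult.commute)
qed (simp add: lead_one)

lemma lead_add:
  assumes "lead f u" "\<And>w. w \<in> Poly_Mapping.keys g \<Longrightarrow> w < u"
  shows "lead (f + g) u"
proof -
  have "Poly_Mapping.lookup g u = 0" using assms(2)[of u] by (auto simp: in_keys_iff)
  then have "u \<in> Poly_Mapping.keys (f + g)"
    using assms(1) by (simp add: lead_def in_keys_iff lookup_add)
  moreover have "w \<le> u" if "w \<in> Poly_Mapping.keys (f + g)" for w
    using that Poly_Mapping.keys_add[of f g] assms by (auto simp: lead_def intro: less_imp_le)
  ultimately show ?thesis by (simp add: lead_def)
qed

section \<open>The generic point\<close>

type_synonym gpoly = "((nat \<times> nat \<times> nat) \<Rightarrow>\<^sub>0 nat) \<Rightarrow>\<^sub>0 int"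

text \<open>The variables are triples: \<open>(0, k, 0)\<close> is the diagonal entry \<open>k\<close> of \<open>D\<close>, \<open>(1, k, i)\<close> the entry of
  \<open>P\<close> in row \<open>i\<close> and column \<open>k\<close>, \<open>(2, k, j)\<close> the entry of \<open>Q\<close> in row \<open>k\<close> and column \<open>j\<close>, and \<open>(3, 0, 0)\<close>
  is \<open>d'\<close>. Triples are ordered lexicographically; this fixes the order of monomials.\<close>

definition ev :: "nat \<Rightarrow> nat \<Rightarrow> nat \<Rightarrow> ((nat \<times> nat \<times> nat) \<Rightarrow>\<^sub>0 nat)"
  where "ev c i j = Poly_Mapping.single (c, i, j) 1"

definition gvar :: "nat \<Rightarrow> nat \<Rightarrow> nat \<Rightarrow> gpoly"
  where "gvar c i j = Poly_Mapping.single (ev c i j) 1"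

lemma lookup_ev: "Poly_Mapping.lookup (ev c i j) q = (if q = (c, i, j) then 1 else 0)"
  by (simp add: ev_def lookup_single when_def)

lemma gvar_hom_deg: "gvar c i j \<in> hom_deg \<theta> (\<theta> (ev c i j))"
  by (simp add: gvar_def hom_deg_def)

lemma additive_lookup: "additive (\<lambda>u. Poly_Mapping.lookup u q)"
  by (simp add: additive_def lookup_add)

lemma lookup_sum_list: "Poly_Mapping.lookup (\<Sum>x\<leftarrow>xs. f x) q = (\<Sum>x\<leftarrow>xs. Poly_Mapping.lookup (f x) q)"
  by (induction xs) (simp_all add: lookup_add)

definition diag :: "nat \<Rightarrow> nat list \<Rightarrow> nat list \<Rightarrow> ((nat \<times> nat \<times> nat) \<Rightarrow>\<^sub>0 nat)"
  where "diag c K J = (\<Sum>(k, j)\<leftarrow>zip K J. ev c k j)"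

lemma diag_simps: "diag c [] J = 0" "diag c (k # K) (j # J) = ev c k j + diag c K J"
  by (simp_all add: diag_def)

lemma lookup_diag_zero:
  "c' \<noteq> c \<or> k \<notin> set K \<Longrightarrow> Poly_Mapping.lookup (diag c K J) (c', k, j) = 0"
  unfolding diag_def
  by (induction K arbitrary: J) (auto simp: lookup_sum_list lookup_ev dest: set_zip_leftD intro!: sum_list_0)

lemma generic_minor_hom_deg:
  assumes "\<And>k j. k \<in> set K \<Longrightarrow> j \<in> set J \<Longrightarrow> \<theta> (ev c k j) = \<alpha> k + \<beta> j" "additive \<theta>"
  shows "minor (gvar c) K J \<in> hom_deg \<theta> ((\<Sum>k\<leftarrow>K. \<alpha> k) + (\<Sum>j\<leftarrow>J. \<beta> j))"
proof (rule minor_hom_deg[OF assms(2)])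
  fix k j assume "k \<in> set K" "j \<in> set J"
  then show "gvar c k j \<in> hom_deg \<theta> (\<alpha> k + \<beta> j)"
    using gvar_hom_deg[of c k j \<theta>] assms(1) by simp
qed

lemma generic_minor_hom_deg_zero:
  assumes "\<And>k j. k \<in> set K \<Longrightarrow> j \<in> set J \<Longrightarrow> \<theta> (ev c k j) = 0" "additive \<theta>"
  shows "minor (gvar c) K J \<in> hom_deg \<theta> 0"
  using generic_minor_hom_deg[of K J \<theta> c "\<lambda>_. 0" "\<lambda>_. 0"] assms by simp

lemma sign_mult_hom_deg: "f \<in> hom_deg \<theta> n \<Longrightarrow> (- 1) ^ b * f \<in> hom_deg \<theta> n"
  using add_subgroup_uminus[OF hom_deg_subgroup] by (auto simp: minus_one_power_iff)

text \<open>Among the variables of the first row the one in the first column is most significant, and no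
  other row contains variables that are as significant. So the diagonal term wins.\<close>

lemma lead_generic_minor:
  assumes "sorted_wrt (<) K" "sorted_wrt (<) J" "length K = length J"
  shows "lead (minor (gvar c) K J) (diag c K J)"
  using assms
proof (induction K arbitrary: J)
  case Nil
  then show ?case by (simp add: minor_Nil diag_simps lead_one)
next
  case (Cons k K)
  then obtain j J' where J: "J = j # J'" by (cases J) auto
  let ?X = "gvar c"
  let ?g = "\<Sum>b<length J'. (-1) ^ Suc b * ?X k (J' ! b) * minor ?X K (j # del b J')"
  have del: "del (Suc b) (j # J') = j # del b J'" "del 0 (j # J') = J'" for b
    by (simp_all add: del_def)
  have eq: "minor ?X (k # K) J = ?X k j * minor ?X K J' + ?g"
    unfolding minor_Cons J by (simp only: list.size add_Suc_right add_0_right sum.lessThan_Suc_shift del) simp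
  have IH: "lead (minor ?X K J') (diag c K J')" using Cons J by simp
  have "lead (?X k j) (ev c k j)" unfolding gvar_def by (rule lead_mvar_power)
  then have first: "lead (?X k j * minor ?X K J') (ev c k j + diag c K J')"
    using IH by (rule lead_mult)
  have kK: "k < k'" if "k' \<in> set K" for k' using Cons.prems that by simp
  have jJ: "j < j'" if "j' \<in> set J'" for j' using Cons.prems J that by simp
  have zero: "?g \<in> hom_deg (\<lambda>u. Poly_Mapping.lookup u q) 0" if q: "q \<le> (c, k, j)" for q
  proof (rule add_subgroup_sum[OF hom_deg_subgroup])
    fix b assume "b \<in> {..<length J'}"
    then have "(c, k, j) < (c, k, J' ! b)" by (simp add: jJ)
    then have "q \<noteq> (c, k, J' ! b)" using q by auto
    then have 1: "?X k (J' ! b) \<in> hom_deg (\<lambda>u. Poly_Mapping.lookup u q) 0"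
      using gvar_hom_deg[of c k "J' ! b" "\<lambda>u. Poly_Mapping.lookup u q"] by (simp add: lookup_ev)
    have qK: "q \<noteq> (c, k', j')" if "k' \<in> set K" for k' j'
    proof -
      have "(c, k, j) < (c, k', j')" using kK[OF that] by simp
      then show ?thesis using q by auto
    qed
    have 2: "minor ?X K (j # del b J') \<in> hom_deg (\<lambda>u. Poly_Mapping.lookup u q) 0"
      by (rule generic_minor_hom_deg_zero[OF _ additive_lookup]) (simp add: lookup_ev qK)
    have "?X k (J' ! b) * minor ?X K (j # del b J') \<in> hom_deg (\<lambda>u. Poly_Mapping.lookup u q) (0 + 0)"
      by (rule hom_deg_mult[OF additive_lookup 1 2])
    from sign_mult_hom_deg[OF this, of "Suc b"]
    show "(-1) ^ Suc b * ?X k (J' ! b) * minor ?X K (j # del b J') \<in> hom_deg (\<lambda>u. Poly_Mapping.lookup u q) 0"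
      by (simp only: mult.assoc add_0_right)
  qed
  have "w < ev c k j + diag c K J'" if w: "w \<in> Poly_Mapping.keys ?g" for w
  proof (rule less_monomial[of _ "(c, k, j)"])
    have wz: "Poly_Mapping.lookup w q = 0" if "q \<le> (c, k, j)" for q
      using zero[OF that] w by (simp add: hom_deg_def)
    then show "Poly_Mapping.lookup w (c, k, j) < Poly_Mapping.lookup (ev c k j + diag c K J') (c, k, j)"
      by (simp add: lookup_add lookup_ev)
    fix q assume q: "q < (c, k, j)"
    obtain c' k' j' where qe: "q = (c', k', j')" by (cases q)
    have "c' \<noteq> c \<or> k' \<notin> set K" using q qe kK by force
    then have "Poly_Mapping.lookup (diag c K J') q = 0" unfolding qe by (rule lookup_diag_zero)
    then show "Poly_Mapping.lookup w q = Poly_Mapping.lookup (ev c k j + diag c K J') q"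
      using wz[of q] q by (auto simp: lookup_add lookup_ev)
  qed
  then have "lead (?X k j * minor ?X K J' + ?g) (ev c k j + diag c K J')"
    by (rule lead_add[OF first])
  then show ?case by (simp only: eq) (simp add: J diag_simps)
qed

text \<open>The entries of \<open>P D Q\<close>.\<close>

definition gx :: "nat \<Rightarrow> nat \<Rightarrow> nat \<Rightarrow> gpoly"
  where "gx m i j = (\<Sum>k\<in>{1..m}. (gvar 0 k 0 * gvar 1 k i) * gvar 2 k j)"

definition tmon :: "nat list \<Rightarrow> ((nat \<times> nat \<times> nat) \<Rightarrow>\<^sub>0 nat)"
  where "tmon K = (\<Sum>k\<leftarrow>K. ev 0 k 0)"

lemma lookup_tmon:
  assumes "distinct K"
  shows "Poly_Mapping.lookup (tmon K) (c, a, b) = (if c = 0 \<and> b = 0 \<and> a \<in> set K then 1 else 0)"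
  using assms unfolding tmon_def by (induction K) (auto simp: lookup_add lookup_ev)

lemma minor_gx:
  "minor (gx m) I J = (\<Sum>S | S \<subseteq> {1..m} \<and> card S = length I.
     Poly_Mapping.single (tmon (sorted_list_of_set S)) 1 *
     (minor (gvar 1) (sorted_list_of_set S) I * minor (gvar 2) (sorted_list_of_set S) J))"
proof -
  have prod: "(\<Prod>k\<leftarrow>K. gvar 0 k 0) = Poly_Mapping.single (tmon K) 1" for K
    by (induction K) (simp_all add: tmon_def gvar_def mult_single)
  have "minor (gx m) I J = minor (\<lambda>i j. \<Sum>k\<in>{1..m}. (gvar 0 k 0 * gvar 1 k i) * gvar 2 k j) I J"
    by (simp add: gx_def[abs_def])
  also have "\<dots> = (\<Sum>S | S \<subseteq> {1..m} \<and> card S = length I.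
     minor (\<lambda>k i. gvar 0 k 0 * gvar 1 k i) (sorted_list_of_set S) I * minor (gvar 2) (sorted_list_of_set S) J)"
    by (rule cauchy_binet) simp
  also have "\<dots> = (\<Sum>S | S \<subseteq> {1..m} \<and> card S = length I.
     Poly_Mapping.single (tmon (sorted_list_of_set S)) 1 *
     (minor (gvar 1) (sorted_list_of_set S) I * minor (gvar 2) (sorted_list_of_set S) J))"
    by (simp only: minor_scale_rows prod mult.assoc)
  finally show ?thesis .
qed

definition gmon :: "nat list \<Rightarrow> nat list \<Rightarrow> ((nat \<times> nat \<times> nat) \<Rightarrow>\<^sub>0 nat)"
  where "gmon I J = tmon [1..<Suc (length I)] +
    (diag 1 [1..<Suc (length I)] I + diag 2 [1..<Suc (length I)] J)"

lemma gx_term_hom_deg: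
  assumes S: "finite S" and \<theta>: "additive \<theta>" "\<And>k j. \<theta> (ev 1 k j) = 0" "\<And>k j. \<theta> (ev 2 k j) = 0"
  shows "Poly_Mapping.single (tmon (sorted_list_of_set S)) 1 *
     (minor (gvar 1) (sorted_list_of_set S) I * minor (gvar 2) (sorted_list_of_set S) J)
     \<in> hom_deg \<theta> (\<theta> (tmon (sorted_list_of_set S)))"
proof -
  have "Poly_Mapping.single (tmon (sorted_list_of_set S)) (1::int) \<in> hom_deg \<theta> (\<theta> (tmon (sorted_list_of_set S)))"
    by (simp add: hom_deg_def)
  moreover have "minor (gvar 1) (sorted_list_of_set S) I \<in> hom_deg \<theta> 0"
    "minor (gvar 2) (sorted_list_of_set S) J \<in> hom_deg \<theta> 0"
    by (rule generic_minor_hom_deg_zero; use \<theta> in simp)+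
  ultimately have "Poly_Mapping.single (tmon (sorted_list_of_set S)) 1 *
     (minor (gvar 1) (sorted_list_of_set S) I * minor (gvar 2) (sorted_list_of_set S) J)
     \<in> hom_deg \<theta> (\<theta> (tmon (sorted_list_of_set S)) + (0 + 0))"
    by (intro hom_deg_mult[OF \<theta>(1)])
  then show ?thesis by simp
qed

lemma sorted_list_of_set_upt: "sorted_list_of_set {1..n} = [1..<Suc n]"
  by (metis atLeastLessThanSuc_atLeastAtMost sorted_list_of_set_range)

text \<open>In the Cauchy--Binet expansion, the summand of a set \<open>S\<close> carries the entries of \<open>D\<close> with index in
  \<open>S\<close>. As these are the most significant variables, \<open>S = {1..n}\<close> wins.\<close>

lemma lead_minor_gx:
  assumes I: "sorted_wrt (<) I" "set I \<subseteq> {1..m}" and J: "sorted_wrt (<) J" and len: "length J = length I"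
  shows "lead (minor (gx m) I J) (gmon I J)"
proof -
  let ?n = "length I"
  let ?Ss = "{S. S \<subseteq> {1..m} \<and> card S = ?n}"
  let ?sl = sorted_list_of_set
  let ?T = "\<lambda>S. Poly_Mapping.single (tmon (?sl S)) 1 * (minor (gvar 1) (?sl S) I * minor (gvar 2) (?sl S) J)"
  have nm: "?n \<le> m" by (rule length_strict_le[OF I])
  have S0: "{1..?n} \<in> ?Ss" using nm by auto
  have split: "minor (gx m) I J = ?T {1..?n} + (\<Sum>S\<in>?Ss - {{1..?n}}. ?T S)"
    unfolding minor_gx by (rule sum.remove[OF _ S0]) simp
  have srt: "sorted_wrt (<) [1..<Suc ?n]" by (rule sorted_wrt_upt)
  have first: "lead (?T {1..?n}) (gmon I J)"
    unfolding sorted_list_of_set_upt gmon_def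
    by (intro lead_mult lead_mvar_power lead_generic_minor srt I J) (simp_all add: len del: upt_Suc)
  have "w < gmon I J" if w: "w \<in> Poly_Mapping.keys (\<Sum>S\<in>?Ss - {{1..?n}}. ?T S)" for w
  proof -
    obtain S where S: "S \<subseteq> {1..m}" "card S = ?n" "S \<noteq> {1..?n}" "w \<in> Poly_Mapping.keys (?T S)"
      using w keys_sum[of ?T "?Ss - {{1..?n}}"] by blast
    have fS: "finite S" using S(1) finite_subset by auto
    have lw: "Poly_Mapping.lookup w (0, a, b) = (if b = 0 \<and> a \<in> S then 1 else 0)" for a b
    proof -
      have "?T S \<in> hom_deg (\<lambda>u. Poly_Mapping.lookup u (0, a, b)) (Poly_Mapping.lookup (tmon (?sl S)) (0, a, b))"
        by (rule gx_term_hom_deg[OF fS additive_lookup]) (simp_all add: lookup_ev)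
      then show ?thesis using S(4) fS by (simp add: hom_deg_def lookup_tmon)
    qed
    have lg: "Poly_Mapping.lookup (gmon I J) (0, a, b) = (if b = 0 \<and> a \<in> {1..?n} then 1 else 0)" for a b
      unfolding gmon_def by (simp add: lookup_add lookup_diag_zero lookup_tmon del: upt_Suc)
    have ne: "{1..?n} - S \<noteq> {}"
    proof
      assume "{1..?n} - S = {}"
      then have "{1..?n} = S" using S(2) fS by (intro card_subset_eq) auto
      then show False using S(3) by simp
    qed
    \<comment> \<open>the first entry of \<open>D\<close> that is missing in the summand of \<open>S\<close>\<close>
    define a where "a = Min ({1..?n} - S)"
    have a: "a \<in> {1..?n} - S" unfolding a_def using ne by (intro Min_in) auto
    have least: "a \<le> x" if "x \<in> {1..?n} - S" for x unfolding a_def using that by (intro Min_le) auto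
    show ?thesis
    proof (rule less_monomial[of _ "(0, a, 0)"])
      show "Poly_Mapping.lookup w (0, a, 0) < Poly_Mapping.lookup (gmon I J) (0, a, 0)"
        using a by (simp add: lw lg)
      fix q :: "nat \<times> nat \<times> nat" assume q: "q < (0, a, 0)"
      then obtain a' b where qe: "q = (0, a', b)" "a' < a" by (cases q) auto
      have "a' \<in> S \<longleftrightarrow> a' \<in> {1..?n}"
        using least[of a'] qe(2) a S(1) by auto
      then show "Poly_Mapping.lookup w q = Poly_Mapping.lookup (gmon I J) q"
        unfolding qe(1) lw lg by simp
    qed
  qed
  then show ?thesis unfolding split by (rule lead_add[OF first])
qed

text \<open>The degree in the first \<open>j\<close> entries of \<open>D\<close>.\<close>

definition wt :: "nat \<Rightarrow> ((nat \<times> nat \<times> nat) \<Rightarrow>\<^sub>0 nat) \<Rightarrow> nat"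
  where "wt j u = (\<Sum>a=1..j. Poly_Mapping.lookup u (0, a, 0))"

text \<open>For \<open>c = 1\<close> the degree in row \<open>i\<close> of \<open>P\<close>, for \<open>c = 2\<close> that in column \<open>i\<close> of \<open>Q\<close>.\<close>

definition entry_deg :: "nat \<Rightarrow> nat \<Rightarrow> nat \<Rightarrow> ((nat \<times> nat \<times> nat) \<Rightarrow>\<^sub>0 nat) \<Rightarrow> nat"
  where "entry_deg m c i u = (\<Sum>k=1..m. Poly_Mapping.lookup u (c, k, i))"

definition ddeg :: "((nat \<times> nat \<times> nat) \<Rightarrow>\<^sub>0 nat) \<Rightarrow> nat"
  where "ddeg u = Poly_Mapping.lookup u (3, 0, 0)"

lemma additive_degrees: "additive (wt j)" "additive (entry_deg m c i)" "additive ddeg"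
  by (simp_all add: additive_def wt_def entry_deg_def ddeg_def lookup_add sum.distrib)

lemma degrees_ev:
  "wt j (ev c k i) = (if c = 0 \<and> k \<in> {1..j} \<and> i = 0 then 1 else 0)"
  "entry_deg m c' i' (ev c k i) = (if c = c' \<and> k \<in> {1..m} \<and> i = i' then 1 else 0)"
  "ddeg (ev c k i) = (if c = 3 \<and> k = 0 \<and> i = 0 then 1 else 0)"
proof -
  have s: "(\<Sum>a=1..j. if a = k \<and> P then 1 else 0) = (if k \<in> {1..j} \<and> P then 1 else 0)" for j P
    by (cases P) simp_all
  have "wt j (ev c k i) = (\<Sum>a=1..j. if a = k \<and> c = 0 \<and> i = 0 then 1 else 0)"
    unfolding wt_def by (intro sum.cong) (auto simp: lookup_ev)
  then show "wt j (ev c k i) = (if c = 0 \<and> k \<in> {1..j} \<and> i = 0 then 1 else 0)"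
    unfolding s by auto
  have "entry_deg m c' i' (ev c k i) = (\<Sum>a=1..m. if a = k \<and> c = c' \<and> i = i' then 1 else 0)"
    unfolding entry_deg_def by (intro sum.cong) (auto simp: lookup_ev)
  then show "entry_deg m c' i' (ev c k i) = (if c = c' \<and> k \<in> {1..m} \<and> i = i' then 1 else 0)"
    unfolding s by auto
  show "ddeg (ev c k i) = (if c = 3 \<and> k = 0 \<and> i = 0 then 1 else 0)"
    by (simp add: ddeg_def lookup_ev)
qed

lemma wt_tmon: "distinct K \<Longrightarrow> wt j (tmon K) = card (set K \<inter> {1..j})"
  by (simp add: wt_def lookup_tmon sum.If_cases Int_commute)

lemma minor_gx_wt:
  assumes "j \<le> m"
  shows "minor (gx m) I J \<in> deg_le (wt j) (min j (length I))"
  unfolding minor_gx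
proof (rule add_subgroup_sum[OF deg_le_subgroup])
  fix S assume "S \<in> {S. S \<subseteq> {1..m} \<and> card S = length I}"
  then have S: "finite S" "card S = length I" using finite_subset by auto
  have "card (S \<inter> {1..j}) \<le> card S" using S by (intro card_mono) auto
  moreover have "card (S \<inter> {1..j}) \<le> card {1..j}" by (intro card_mono) auto
  ultimately have "wt j (tmon (sorted_list_of_set S)) \<le> min j (length I)"
    using S by (simp add: wt_tmon)
  then show "Poly_Mapping.single (tmon (sorted_list_of_set S)) 1 *
     (minor (gvar 1) (sorted_list_of_set S) I * minor (gvar 2) (sorted_list_of_set S) J)
     \<in> deg_le (wt j) (min j (length I))"
    by (rule hom_deg_le[OF gx_term_hom_deg[OF S(1)], rotated -1])
       (simp_all add: additive_degrees degrees_ev)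
qed

lemma gx_hom_deg:
  assumes \<theta>: "additive \<theta>" "\<And>k. k \<in> {1..m} \<Longrightarrow> \<theta> (ev 0 k 0) + \<theta> (ev 1 k i) + \<theta> (ev 2 k j) = n"
  shows "gx m i j \<in> hom_deg \<theta> n"
  unfolding gx_def
proof (rule add_subgroup_sum[OF hom_deg_subgroup])
  fix k assume k: "k \<in> {1..m}"
  have "gvar 0 k 0 * gvar 1 k i * gvar 2 k j \<in> hom_deg \<theta> (\<theta> (ev 0 k 0) + \<theta> (ev 1 k i) + \<theta> (ev 2 k j))"
    by (intro hom_deg_mult[OF \<theta>(1)] gvar_hom_deg)
  then show "gvar 0 k 0 * gvar 1 k i * gvar 2 k j \<in> hom_deg \<theta> n" using \<theta>(2)[OF k] by simp
qed

lemma gx_degrees: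
  "gx m i j \<in> hom_deg (entry_deg m 1 i') (if i = i' then 1 else 0)"
  "gx m i j \<in> hom_deg (entry_deg m 2 j') (if j = j' then 1 else 0)"
  "gx m i j \<in> hom_deg ddeg 0"
  by (rule gx_hom_deg; simp add: additive_degrees degrees_ev)+

subsection \<open>Cofactors\<close>

definition gdet :: "nat \<Rightarrow> gpoly"
  where "gdet m = minor (gx m) [1..<Suc m] [1..<Suc m]"

text \<open>The cofactor matrix, that is, the transpose of the adjugate.\<close>

definition cof :: "nat \<Rightarrow> (nat \<Rightarrow> nat \<Rightarrow> 'a::comm_ring_1) \<Rightarrow> nat \<Rightarrow> nat \<Rightarrow> 'a"
  where "cof m X i j = (-1) ^ (i + j) * minor X (del (i - 1) [1..<Suc m]) (del (j - 1) [1..<Suc m])"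

lemma cofactor_relations:
  fixes X :: "nat \<Rightarrow> nat \<Rightarrow> 'a::comm_ring_1"
  assumes "i \<in> {1..m}" "j \<in> {1..m}"
  defines "D \<equiv> minor X [1..<Suc m] [1..<Suc m]"
  shows "(\<Sum>l=1..m. X l i * cof m X l j) = (if i = j then D else 0)"
    "(\<Sum>l=1..m. X i l * cof m X j l) = (if i = j then D else 0)"
proof -
  define A where "A = mat m m (\<lambda>(a, b). X (Suc a) (Suc b))"
  have A: "A \<in> carrier_mat m m" by (simp add: A_def)
  have D: "D = det A" unfolding D_def A_def minor_def
    by (simp del: upt_Suc) (intro arg_cong[where f = det] eq_matI; simp del: upt_Suc)
  have cofA: "cofactor A a b = cof m X (Suc a) (Suc b)" if "a < m" "b < m" for a b
  proof -
    have "mat_delete A a b = mat (m - 1) (m - 1) (\<lambda>(i, j). X (del a [1..<Suc m] ! i) (del b [1..<Suc m] ! j))"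
      unfolding mat_delete_def A_def using that
      by (intro eq_matI) (auto simp: nth_del simp del: upt_Suc)
    then show ?thesis using that
      by (simp add: cofactor_def cof_def minor_def length_del del: upt_Suc)
  qed
  obtain i' j' where ij: "i = Suc i'" "j = Suc j'" "i' < m" "j' < m"
    using assms(1,2) by (metis atLeastAtMost_iff Suc_le_eq not0_implies_Suc not_less_eq_eq Suc_le_lessD le_zero_eq One_nat_def)
  have sum: "(\<Sum>l=1..m. f l) = (\<Sum>l<m. f (Suc l))" for f :: "nat \<Rightarrow> 'a"
    by (rule sum.reindex_bij_witness[of _ Suc "\<lambda>l. l - 1"]) auto
  have "(adj_mat A * A) $$ (j', i') = (\<Sum>l<m. cofactor A l j' * A $$ (l, i'))"
    using ij A by (simp add: adj_mat_def scalar_prod_def atLeast0LessThan A_def)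
  moreover have "(adj_mat A * A) $$ (j', i') = (if i = j then D else 0)"
    using ij adj_mat(3)[OF A] by (simp add: D)
  moreover have "(\<Sum>l=1..m. X l i * cof m X l j) = (\<Sum>l<m. cofactor A l j' * A $$ (l, i'))"
    unfolding sum using ij by (intro sum.cong) (simp_all add: cofA, simp add: A_def)
  ultimately show "(\<Sum>l=1..m. X l i * cof m X l j) = (if i = j then D else 0)" by simp
  have "(A * adj_mat A) $$ (i', j') = (\<Sum>l<m. A $$ (i', l) * cofactor A j' l)"
    using ij A by (simp add: adj_mat_def scalar_prod_def atLeast0LessThan A_def)
  moreover have "(A * adj_mat A) $$ (i', j') = (if i = j then D else 0)"
    using ij adj_mat(2)[OF A] by (simp add: D)
  moreover have "(\<Sum>l=1..m. X i l * cof m X j l) = (\<Sum>l<m. A $$ (i', l) * cofactor A j' l)"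
    unfolding sum using ij by (intro sum.cong) (simp_all add: cofA, simp add: A_def)
  ultimately show "(\<Sum>l=1..m. X i l * cof m X j l) = (if i = j then D else 0)" by simp
qed

definition gy :: "nat \<Rightarrow> nat \<Rightarrow> nat \<Rightarrow> gpoly"
  where "gy m i j = gvar 3 0 0 * cof m (gx m) i j"

definition gd :: "nat \<Rightarrow> gpoly"
  where "gd m = gvar 3 0 0 * gdet m"

lemma gx_gy:
  assumes "i \<in> {1..m}" "j \<in> {1..m}"
  shows "(\<Sum>l=1..m. gx m l i * gy m l j) = (if i = j then gd m else 0)"
    "(\<Sum>l=1..m. gx m i l * gy m j l) = (if i = j then gd m else 0)"
proof -
  have "(\<Sum>l=1..m. gx m l i * gy m l j) = gvar 3 0 0 * (\<Sum>l=1..m. gx m l i * cof m (gx m) l j)"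
    "(\<Sum>l=1..m. gx m i l * gy m j l) = gvar 3 0 0 * (\<Sum>l=1..m. gx m i l * cof m (gx m) j l)"
    by (simp_all add: gy_def sum_distrib_left mult_ac)
  then show "(\<Sum>l=1..m. gx m l i * gy m l j) = (if i = j then gd m else 0)"
    "(\<Sum>l=1..m. gx m i l * gy m j l) = (if i = j then gd m else 0)"
    using cofactor_relations[OF assms, of "gx m"] by (simp_all add: gd_def gdet_def del: upt_Suc)
qed

lemma sum_list_upt_indicator:
  assumes "k \<in> {1..m}"
  shows "(\<Sum>x\<leftarrow>[1..<Suc m]. if x = k then 1 else 0) = (1::nat)"
proof -
  have "(\<Sum>x\<leftarrow>[1..<Suc m]. if x = k then 1 else 0) = (\<Sum>x\<in>set [1..<Suc m]. if x = k then 1 else 0 :: nat)"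
    by (rule sum_list_distinct_conv_sum_set) simp
  then show ?thesis using assms by (auto simp del: upt_Suc)
qed

lemma gy_degrees:
  assumes "i \<in> {1..m}" "j \<in> {1..m}" "k \<in> {1..m}"
  shows "gy m i j \<in> hom_deg (entry_deg m 1 k) (if i = k then 0 else 1)"
    "gy m i j \<in> hom_deg (entry_deg m 2 k) (if j = k then 0 else 1)"
    "gy m i j \<in> hom_deg ddeg 1"
proof -
  let ?f = "[1..<Suc m]"
  have one: "(\<Sum>x\<leftarrow>del (i - 1) ?f. if x = k then 1 else 0) = (if i = k then 0 else 1 :: nat)"
    if "i \<in> {1..m}" for i
  proof -
    note sum_list_upt_indicator[OF assms(3)]
    moreover have "?f ! (i - 1) = i" using that by (simp del: upt_Suc)
    moreover have "i - 1 < length ?f" using that by auto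
    ultimately have "(\<Sum>x\<leftarrow>del (i - 1) ?f. if x = k then 1 else 0) = (1::nat) - (if i = k then 1 else 0)"
      using sum_list_del[of "i - 1" ?f "\<lambda>x. if x = k then 1 else (0::nat)"]
      by (simp only: diff_add_inverse)
    then show ?thesis by simp
  qed
  have g3: "gvar 3 0 0 \<in> hom_deg (entry_deg m 1 k) 0" "gvar 3 0 0 \<in> hom_deg (entry_deg m 2 k) 0"
    "gvar 3 0 0 \<in> hom_deg ddeg 1"
    using gvar_hom_deg[of 3 0 0 "entry_deg m 1 k"] gvar_hom_deg[of 3 0 0 "entry_deg m 2 k"]
      gvar_hom_deg[of 3 0 0 ddeg] by (simp_all add: degrees_ev)
  have "minor (gx m) (del (i - 1) ?f) (del (j - 1) ?f) \<in> hom_deg (entry_deg m 1 k)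
      ((\<Sum>x\<leftarrow>del (i - 1) ?f. if x = k then 1 else 0) + (\<Sum>x\<leftarrow>del (j - 1) ?f. 0))"
    by (rule minor_hom_deg[OF additive_degrees(2)]) (use gx_degrees(1) in simp)
  then have c1: "cof m (gx m) i j \<in> hom_deg (entry_deg m 1 k) (if i = k then 0 else 1)"
    unfolding cof_def one[OF assms(1)] by (intro sign_mult_hom_deg) simp
  have "minor (gx m) (del (i - 1) ?f) (del (j - 1) ?f) \<in> hom_deg (entry_deg m 2 k)
      ((\<Sum>x\<leftarrow>del (i - 1) ?f. 0) + (\<Sum>x\<leftarrow>del (j - 1) ?f. if x = k then 1 else 0))"
    by (rule minor_hom_deg[OF additive_degrees(2)]) (use gx_degrees(2) in simp)
  then have c2: "cof m (gx m) i j \<in> hom_deg (entry_deg m 2 k) (if j = k then 0 else 1)"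
    unfolding cof_def one[OF assms(2)] by (intro sign_mult_hom_deg) simp
  have "minor (gx m) (del (i - 1) ?f) (del (j - 1) ?f) \<in> hom_deg ddeg
      ((\<Sum>x\<leftarrow>del (i - 1) ?f. 0) + (\<Sum>x\<leftarrow>del (j - 1) ?f. 0))"
    by (rule minor_hom_deg[OF additive_degrees(3)]) (use gx_degrees(3) in simp)
  then have c3: "cof m (gx m) i j \<in> hom_deg ddeg 0"
    unfolding cof_def by (intro sign_mult_hom_deg) simp
  show "gy m i j \<in> hom_deg (entry_deg m 1 k) (if i = k then 0 else 1)"
    "gy m i j \<in> hom_deg (entry_deg m 2 k) (if j = k then 0 else 1)" "gy m i j \<in> hom_deg ddeg 1"
    using hom_deg_mult[OF additive_degrees(2) g3(1) c1] hom_deg_mult[OF additive_degrees(2) g3(2) c2]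
      hom_deg_mult[OF additive_degrees(3) g3(3) c3] by (simp_all add: gy_def)
qed

lemma lead_gdet: "lead (gdet m) (gmon [1..<Suc m] [1..<Suc m])"
  unfolding gdet_def by (rule lead_minor_gx) (auto simp del: upt_Suc)

text \<open>In \<open>complementary_minor\<close> one factor \<open>det X\<close> can be cancelled.\<close>

lemma minor_gy:
  assumes I: "sorted_wrt (<) I" "set I \<subseteq> {1..m}" and J: "sorted_wrt (<) J" "set J \<subseteq> {1..m}"
    and len: "length J = length I" and ne: "I \<noteq> []"
  defines "R \<equiv> gvar 3 0 0 ^ length I * (gdet m ^ (length I - 1) *
    minor (gx m) (compl_cols m I) (compl_cols m J))"
  shows "minor (gy m) I J = R \<or> minor (gy m) I J = - R"
proof -
  have nz: "gdet m \<noteq> 0" using lead_gdet[of m] by (auto simp: lead_def)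
  obtain k where k: "length I = Suc k" using ne by (cases I) auto
  let ?c = "minor (gx m) (compl_cols m I) (compl_cols m J)"
  have "gdet m * minor (gy m) I J = gd m ^ length I * ?c \<or>
      gdet m * minor (gy m) I J = - (gd m ^ length I * ?c)"
    unfolding gdet_def
    by (rule complementary_minor[OF _ I J len]) (use gx_gy in auto)
  moreover have "gd m ^ length I * ?c = gdet m * R"
    unfolding R_def gd_def k by (simp add: power_mult_distrib mult_ac)
  ultimately have "gdet m * minor (gy m) I J = gdet m * R \<or> gdet m * minor (gy m) I J = gdet m * (- R)"
    by simp
  then show ?thesis using nz mult_left_cancel by blast
qed

definition nmul :: "nat \<Rightarrow> ('v \<Rightarrow>\<^sub>0 nat) \<Rightarrow> ('v \<Rightarrow>\<^sub>0 nat)"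
  where "nmul n u = (\<Sum>_\<in>{..<n}. u)"

lemma lookup_nmul: "Poly_Mapping.lookup (nmul n u) q = n * Poly_Mapping.lookup u q"
  by (simp add: nmul_def lookup_sum)

definition hmon :: "nat \<Rightarrow> nat list \<Rightarrow> nat list \<Rightarrow> ((nat \<times> nat \<times> nat) \<Rightarrow>\<^sub>0 nat)"
  where "hmon m I J = nmul (length I) (ev 3 0 0) +
    (nmul (length I - 1) (gmon [1..<Suc m] [1..<Suc m]) + gmon (compl_cols m I) (compl_cols m J))"

lemma lead_minor_gy:
  assumes I: "sorted_wrt (<) I" "set I \<subseteq> {1..m}" and J: "sorted_wrt (<) J" "set J \<subseteq> {1..m}"
    and len: "length J = length I" and ne: "I \<noteq> []"
  shows "lead (minor (gy m) I J) (hmon m I J)"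
proof -
  have d: "distinct I" "distinct J" using I J by (auto simp: strict_sorted_iff)
  have "lead (gvar 3 0 0 ^ length I * (gdet m ^ (length I - 1) *
    minor (gx m) (compl_cols m I) (compl_cols m J))) (hmon m I J)"
    unfolding hmon_def nmul_def
    by (intro lead_mult lead_power lead_gdet lead_minor_gx sorted_compl_cols)
       (use d I J len in \<open>auto simp: gvar_def lead_mvar_power set_compl_cols length_compl_cols\<close>)
  then show ?thesis using minor_gy[OF assms] lead_uminus by metis
qed

lemma deg_le_power:
  assumes "additive \<theta>" "a \<in> deg_le \<theta> k"
  shows "a ^ n \<in> deg_le \<theta> (n * k)"
proof (induction n)
  case (Suc n)
  then show ?case using deg_le_mult[OF assms Suc] by simp
qed (simp add: hom_deg_le[OF hom_deg_one[OF assms(1)]])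

lemma minor_gy_wt:
  assumes j: "j \<le> m" and I: "set I \<subseteq> {1..m}" and J: "set J \<subseteq> {1..m}"
    and len: "length J = length I" and ne: "I \<noteq> []"
  shows "minor (gy m) I J \<in> deg_le (wt j) ((length I - 1) * j + min j (m - length I))"
proof (cases "distinct I \<and> distinct J")
  case True
  have "minor (gy m) (sort I) (sort J) \<in> deg_le (wt j) ((length I - 1) * j + min j (m - length I))"
  proof -
    let ?R = "gvar 3 0 0 ^ length (sort I) * (gdet m ^ (length (sort I) - 1) *
      minor (gx m) (compl_cols m (sort I)) (compl_cols m (sort J)))"
    have "gvar 3 0 0 \<in> hom_deg (wt j) 0"
      using gvar_hom_deg[of 3 0 0 "wt j"] by (simp add: degrees_ev)
    then have "gvar 3 0 0 ^ length (sort I) \<in> deg_le (wt j) 0"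
      using hom_deg_le[OF hom_deg_power[OF additive_degrees(1)]] by fastforce
    moreover have "gdet m ^ (length (sort I) - 1) \<in> deg_le (wt j) ((length (sort I) - 1) * j)"
      using minor_gx_wt[OF j, of "[1..<Suc m]" "[1..<Suc m]"] j
      by (intro deg_le_power additive_degrees) (simp add: gdet_def min_absorb1 del: upt_Suc)
    moreover have "minor (gx m) (compl_cols m (sort I)) (compl_cols m (sort J)) \<in> deg_le (wt j) (min j (m - length I))"
      using minor_gx_wt[OF j, of "compl_cols m (sort I)"] True I by (simp add: length_compl_cols)
    ultimately have "?R \<in> deg_le (wt j) (0 + ((length (sort I) - 1) * j + min j (m - length I)))"
      by (intro deg_le_mult additive_degrees)
    then have R: "?R \<in> deg_le (wt j) ((length I - 1) * j + min j (m - length I))" by simp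
    have ne': "sort I \<noteq> []" using ne by (metis length_0_conv length_sort)
    have "minor (gy m) (sort I) (sort J) = ?R \<or> minor (gy m) (sort I) (sort J) = - ?R"
      by (rule minor_gy[OF _ _ _ _ _ ne']) (use True I J len in \<open>simp_all add: strict_sorted_iff\<close>)
    then show ?thesis using add_subgroup_sign[OF deg_le_subgroup R] by blast
  qed
  moreover have "minor (gy m) I J = minor (gy m) (sort I) J \<or> minor (gy m) I J = - minor (gy m) (sort I) J"
    by (rule minor_permute_rows) simp
  moreover have "minor (gy m) (sort I) J = minor (gy m) (sort I) (sort J) \<or>
      minor (gy m) (sort I) J = - minor (gy m) (sort I) (sort J)"
    unfolding minor_transpose[of "gy m" "sort I"] by (rule minor_permute_rows) simp
  ultimately show ?thesis
    using add_subgroup_sign[OF deg_le_subgroup] by metis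
next
  case False
  then have "minor (gy m) I J = 0"
    using minor_not_distinct_rows minor_not_distinct_cols by blast
  then show ?thesis by (simp add: add_subgroup_0[OF deg_le_subgroup])
qed

section \<open>Leading monomials of standard bideterminants\<close>

text \<open>The image of \<open>d\<^sup>t (S | T)\<close> at the generic point, and its leading monomial in the standard case.\<close>

definition gprod :: "nat \<Rightarrow> nat \<Rightarrow> bicolumns \<Rightarrow> bicolumns \<Rightarrow> gpoly"
  where "gprod m t L1 L2 = gd m ^ t * (minor_prod (gx m) L1 * minor_prod (gy m) L2)"

definition gmono :: "nat \<Rightarrow> nat \<Rightarrow> bicolumns \<Rightarrow> bicolumns \<Rightarrow> ((nat \<times> nat \<times> nat) \<Rightarrow>\<^sub>0 nat)"
  where "gmono m t L1 L2 = nmul t (ev 3 0 0 + gmon [1..<Suc m] [1..<Suc m]) +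
    ((\<Sum>(I, J)\<leftarrow>L1. gmon I J) + (\<Sum>(I, J)\<leftarrow>L2. hmon m I J))"

lemma lead_minor_prod:
  assumes "\<And>I J. (I, J) \<in> set L \<Longrightarrow> lead (minor X I J) (f I J)"
  shows "lead (minor_prod X L) (\<Sum>(I, J)\<leftarrow>L. f I J)"
  using assms
proof (induction L)
  case (Cons c L)
  obtain I J where c: "c = (I, J)" by (cases c)
  show ?case using lead_mult[of "minor X I J" "f I J" "minor_prod X L"] Cons by (simp add: c minor_prod_Cons)
qed (simp add: minor_prod_Nil lead_one)

lemma lead_gprod:
  assumes L: "bicols m L1" "bicols m L2" "strict_cols L1" "strict_cols L2"
    and ne: "\<And>I J. (I, J) \<in> set L2 \<Longrightarrow> I \<noteq> []"
  shows "lead (gprod m t L1 L2) (gmono m t L1 L2)"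
  unfolding gprod_def gmono_def
proof (intro lead_mult)
  show "lead (gd m ^ t) (nmul t (ev 3 0 0 + gmon [1..<Suc m] [1..<Suc m]))"
    unfolding nmul_def gd_def
    by (intro lead_power lead_mult lead_gdet) (simp add: gvar_def lead_mvar_power)
  show "lead (minor_prod (gx m) L1) (\<Sum>(I, J)\<leftarrow>L1. gmon I J)"
  proof (rule lead_minor_prod)
    fix I J assume IJ: "(I, J) \<in> set L1"
    show "lead (minor (gx m) I J) (gmon I J)"
      using bicolsD[OF L(1) IJ] L(3) IJ by (intro lead_minor_gx) (auto simp: strict_cols_def)
  qed
  show "lead (minor_prod (gy m) L2) (\<Sum>(I, J)\<leftarrow>L2. hmon m I J)"
  proof (rule lead_minor_prod)
    fix I J assume IJ: "(I, J) \<in> set L2"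
    show "lead (minor (gy m) I J) (hmon m I J)"
      using bicolsD[OF L(2) IJ] L(4) IJ ne[OF IJ] by (intro lead_minor_gy) (auto simp: strict_cols_def)
  qed
qed

lemma minor_prod_hom_deg:
  assumes \<theta>: "additive \<theta>" and "\<And>I J. (I, J) \<in> set L \<Longrightarrow> minor X I J \<in> hom_deg \<theta> (f I J)"
  shows "minor_prod X L \<in> hom_deg \<theta> (\<Sum>(I, J)\<leftarrow>L. f I J)"
  using assms(2)
proof (induction L)
  case (Cons c L)
  obtain I J where c: "c = (I, J)" by (cases c)
  show ?case using hom_deg_mult[OF \<theta>, of "minor X I J" "f I J" "minor_prod X L"] Cons by (simp add: c minor_prod_Cons)
qed (simp add: minor_prod_Nil hom_deg_one[OF \<theta>])

lemma minor_prod_deg_le: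
  assumes \<theta>: "additive \<theta>" and "\<And>I J. (I, J) \<in> set L \<Longrightarrow> minor X I J \<in> deg_le \<theta> (f I J)"
  shows "minor_prod X L \<in> deg_le \<theta> (\<Sum>(I, J)\<leftarrow>L. f I J)"
  using assms(2)
proof (induction L)
  case (Cons c L)
  obtain I J where c: "c = (I, J)" by (cases c)
  show ?case using deg_le_mult[OF \<theta>, of "minor X I J" "f I J" "minor_prod X L"] Cons by (simp add: c minor_prod_Cons)
qed (simp add: minor_prod_Nil hom_deg_le[OF hom_deg_one[OF \<theta>]])

lemma sum_list_indicator: "(\<Sum>i\<leftarrow>I. if i = k then 1 else 0) = count_list I k"
  "(\<Sum>i\<leftarrow>I. if i = k then 0 else 1) = length I - count_list I k"
proof -
  show "(\<Sum>i\<leftarrow>I. if i = k then 1 else 0) = count_list I k" by (induction I) auto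
  have "(\<Sum>i\<leftarrow>I. if i = k then 0 else 1) + count_list I k = length I" by (induction I) auto
  then show "(\<Sum>i\<leftarrow>I. if i = k then 0 else 1) = length I - count_list I k" by simp
qed

lemma gd_degrees:
  assumes "k \<in> {1..m}"
  shows "gd m \<in> hom_deg (entry_deg m 1 k) 1" "gd m \<in> hom_deg (entry_deg m 2 k) 1"
    "gd m \<in> hom_deg ddeg 1"
proof -
  let ?f = "[1..<Suc m]"
  note one = sum_list_upt_indicator[OF assms]
  have zero: "(\<Sum>x\<leftarrow>?f. 0) = (0::nat)" by (simp del: upt_Suc)
  have g3: "gvar 3 0 0 \<in> hom_deg (entry_deg m 1 k) 0" "gvar 3 0 0 \<in> hom_deg (entry_deg m 2 k) 0"
    "gvar 3 0 0 \<in> hom_deg ddeg 1"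
    using gvar_hom_deg[of 3 0 0 "entry_deg m 1 k"] gvar_hom_deg[of 3 0 0 "entry_deg m 2 k"]
      gvar_hom_deg[of 3 0 0 ddeg] by (simp_all add: degrees_ev)
  have "gdet m \<in> hom_deg (entry_deg m 1 k) ((\<Sum>x\<leftarrow>?f. if x = k then 1 else 0) + (\<Sum>x\<leftarrow>?f. 0))"
    unfolding gdet_def by (rule minor_hom_deg[OF additive_degrees(2)]) (use gx_degrees(1) in simp)
  from hom_deg_mult[OF additive_degrees(2) g3(1) this]
  show "gd m \<in> hom_deg (entry_deg m 1 k) 1" by (simp only: gd_def one zero add_0_left add_0_right)
  have "gdet m \<in> hom_deg (entry_deg m 2 k) ((\<Sum>x\<leftarrow>?f. 0) + (\<Sum>x\<leftarrow>?f. if x = k then 1 else 0))"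
    unfolding gdet_def by (rule minor_hom_deg[OF additive_degrees(2)]) (use gx_degrees(2) in simp)
  from hom_deg_mult[OF additive_degrees(2) g3(2) this]
  show "gd m \<in> hom_deg (entry_deg m 2 k) 1" by (simp only: gd_def one zero add_0_left add_0_right)
  have "gdet m \<in> hom_deg ddeg ((\<Sum>x\<leftarrow>?f. 0) + (\<Sum>x\<leftarrow>?f. 0))"
    unfolding gdet_def by (rule minor_hom_deg[OF additive_degrees(3)]) (use gx_degrees(3) in simp)
  from hom_deg_mult[OF additive_degrees(3) g3(3) this]
  show "gd m \<in> hom_deg ddeg 1" by (simp add: gd_def del: upt_Suc)
qed

lemma gprod_degrees:
  assumes L: "bicols m L1" "bicols m L2" and k: "k \<in> {1..m}"
  shows "gprod m t L1 L2 \<in> hom_deg (entry_deg m 1 k)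
      (t + ((\<Sum>(I, J)\<leftarrow>L1. count_list I k) + (\<Sum>(I, J)\<leftarrow>L2. length I - count_list I k)))"
    "gprod m t L1 L2 \<in> hom_deg (entry_deg m 2 k)
      (t + ((\<Sum>(I, J)\<leftarrow>L1. count_list J k) + (\<Sum>(I, J)\<leftarrow>L2. length J - count_list J k)))"
    "gprod m t L1 L2 \<in> hom_deg ddeg (t + bideg L2)"
proof -
  have gd: "gd m ^ t \<in> hom_deg (entry_deg m 1 k) t" "gd m ^ t \<in> hom_deg (entry_deg m 2 k) t"
    "gd m ^ t \<in> hom_deg ddeg t"
    using hom_deg_power[OF additive_degrees(2) gd_degrees(1)[OF k], of t]
      hom_deg_power[OF additive_degrees(2) gd_degrees(2)[OF k], of t]
      hom_deg_power[OF additive_degrees(3) gd_degrees(3)[OF k], of t] by simp_all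
  have x1: "minor (gx m) I J \<in> hom_deg (entry_deg m 1 k) (count_list I k)" for I J
    using minor_hom_deg[OF additive_degrees(2)[of m 1 k], of I J "gx m" "\<lambda>i. if i = k then 1 else 0" "\<lambda>_. 0"]
      gx_degrees(1)[of m] by (simp add: sum_list_indicator)
  have x2: "minor (gx m) I J \<in> hom_deg (entry_deg m 2 k) (count_list J k)" for I J
    using minor_hom_deg[OF additive_degrees(2)[of m 2 k], of I J "gx m" "\<lambda>_. 0" "\<lambda>i. if i = k then 1 else 0"]
      gx_degrees(2)[of m] by (simp add: sum_list_indicator)
  have x3: "minor (gx m) I J \<in> hom_deg ddeg 0" for I J
    using minor_hom_deg[OF additive_degrees(3), of I J "gx m" "\<lambda>_. 0" "\<lambda>_. 0"]
      gx_degrees(3)[of m] by simp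
  have y1: "minor (gy m) I J \<in> hom_deg (entry_deg m 1 k) (length I - count_list I k)"
    if IJ: "(I, J) \<in> set L2" for I J
  proof -
    have "minor (gy m) I J \<in> hom_deg (entry_deg m 1 k) ((\<Sum>i\<leftarrow>I. if i = k then 0 else 1) + (\<Sum>j\<leftarrow>J. 0))"
    proof (rule minor_hom_deg[OF additive_degrees(2)])
      fix i j assume "i \<in> set I" "j \<in> set J"
      then have "i \<in> {1..m}" "j \<in> {1..m}" using bicolsD[OF L(2) IJ] by blast+
      then show "gy m i j \<in> hom_deg (entry_deg m 1 k) ((if i = k then 0 else 1) + 0)"
        using gy_degrees(1)[OF _ _ k] by simp
    qed
    then show ?thesis by (simp add: sum_list_indicator)
  qed
  have y2: "minor (gy m) I J \<in> hom_deg (entry_deg m 2 k) (length J - count_list J k)"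
    if IJ: "(I, J) \<in> set L2" for I J
  proof -
    have "minor (gy m) I J \<in> hom_deg (entry_deg m 2 k) ((\<Sum>i\<leftarrow>I. 0) + (\<Sum>j\<leftarrow>J. if j = k then 0 else 1))"
    proof (rule minor_hom_deg[OF additive_degrees(2)])
      fix i j assume "i \<in> set I" "j \<in> set J"
      then have "i \<in> {1..m}" "j \<in> {1..m}" using bicolsD[OF L(2) IJ] by blast+
      then show "gy m i j \<in> hom_deg (entry_deg m 2 k) (0 + (if j = k then 0 else 1))"
        using gy_degrees(2)[OF _ _ k] by simp
    qed
    then show ?thesis by (simp add: sum_list_indicator)
  qed
  have y3: "minor (gy m) I J \<in> hom_deg ddeg (length I)"
    if IJ: "(I, J) \<in> set L2" for I J
  proof -
    have "minor (gy m) I J \<in> hom_deg ddeg ((\<Sum>i\<leftarrow>I. 1) + (\<Sum>j\<leftarrow>J. 0))"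
    proof (rule minor_hom_deg[OF additive_degrees(3)])
      fix i j assume "i \<in> set I" "j \<in> set J"
      then have "i \<in> {1..m}" "j \<in> {1..m}" using bicolsD[OF L(2) IJ] by blast+
      then show "gy m i j \<in> hom_deg ddeg (1 + 0)"
        using gy_degrees(3)[OF _ _ k] by simp
    qed
    then show ?thesis by (simp add: sum_list_triv)
  qed
  show "gprod m t L1 L2 \<in> hom_deg (entry_deg m 1 k)
      (t + ((\<Sum>(I, J)\<leftarrow>L1. count_list I k) + (\<Sum>(I, J)\<leftarrow>L2. length I - count_list I k)))"
    unfolding gprod_def
    by (intro hom_deg_mult[OF additive_degrees(2)] gd minor_prod_hom_deg[OF additive_degrees(2)] x1 y1)
  show "gprod m t L1 L2 \<in> hom_deg (entry_deg m 2 k)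
      (t + ((\<Sum>(I, J)\<leftarrow>L1. count_list J k) + (\<Sum>(I, J)\<leftarrow>L2. length J - count_list J k)))"
    unfolding gprod_def
    by (intro hom_deg_mult[OF additive_degrees(2)] gd minor_prod_hom_deg[OF additive_degrees(2)] x2 y2)
  have "gprod m t L1 L2 \<in> hom_deg ddeg (t + ((\<Sum>(I, J)\<leftarrow>L1. 0) + (\<Sum>(I, J)\<leftarrow>L2. length I)))"
    unfolding gprod_def
    by (intro hom_deg_mult[OF additive_degrees(3)] gd minor_prod_hom_deg[OF additive_degrees(3)] x3 y3)
  moreover have "(\<Sum>(I, J)\<leftarrow>L1. 0) = (0::nat)" by (induction L1) auto
  ultimately show "gprod m t L1 L2 \<in> hom_deg ddeg (t + bideg L2)" by (simp add: bideg_def)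
qed

text \<open>The degree in the first \<open>j\<close> entries of \<open>D\<close> that the shape allows at most.\<close>

definition wt_total :: "nat \<Rightarrow> nat \<Rightarrow> nat \<Rightarrow> bicolumns \<Rightarrow> bicolumns \<Rightarrow> nat"
  where "wt_total m j t L1 L2 = t * j + ((\<Sum>(I, J)\<leftarrow>L1. min j (length I)) +
    (\<Sum>(I, J)\<leftarrow>L2. (length I - 1) * j + min j (m - length I)))"

lemma gprod_wt:
  assumes L: "bicols m L1" "bicols m L2" and ne: "\<And>I J. (I, J) \<in> set L2 \<Longrightarrow> I \<noteq> []" and j: "j \<le> m"
  shows "gprod m t L1 L2 \<in> deg_le (wt j) (wt_total m j t L1 L2)"
proof -
  have "gvar 3 0 0 \<in> deg_le (wt j) 0"
    using hom_deg_le[OF gvar_hom_deg[of 3 0 0 "wt j"], of 0] by (simp add: degrees_ev)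
  moreover have "gdet m \<in> deg_le (wt j) j"
    using minor_gx_wt[OF j, of "[1..<Suc m]" "[1..<Suc m]"] j by (simp add: gdet_def min_absorb1 del: upt_Suc)
  ultimately have "gd m \<in> deg_le (wt j) (0 + j)"
    unfolding gd_def by (intro deg_le_mult additive_degrees)
  then have gd: "gd m ^ t \<in> deg_le (wt j) (t * j)"
    using deg_le_power[OF additive_degrees(1)] by simp
  have y: "minor (gy m) I J \<in> deg_le (wt j) ((length I - 1) * j + min j (m - length I))"
    if IJ: "(I, J) \<in> set L2" for I J
    using minor_gy_wt[OF j _ _ _ ne[OF IJ]] bicolsD[OF L(2) IJ] by simp
  show ?thesis
    unfolding gprod_def wt_total_def
    by (intro deg_le_mult[OF additive_degrees(1)] gd minor_prod_deg_le[OF additive_degrees(1)] y minor_gx_wt[OF j])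
qed

lemma additive_nmul: "additive \<theta> \<Longrightarrow> \<theta> (nmul n u) = n * \<theta> u"
proof (induction n)
  case (Suc n)
  have "nmul (Suc n) u = nmul n u + u" by (simp add: nmul_def)
  then show ?case using Suc by (simp add: additive_def)
qed (simp add: nmul_def additive_zero)

lemma additive_sum_list: "additive \<theta> \<Longrightarrow> \<theta> (\<Sum>x\<leftarrow>xs. f x) = (\<Sum>x\<leftarrow>xs. \<theta> (f x))"
  by (induction xs) (simp_all add: additive_zero, simp add: additive_def)

lemma wt_gmon:
  assumes "j \<le> m"
  shows "wt j (gmon I J) = min j (length I)"
proof -
  have d: "wt j (diag c K J) = 0" if "c \<noteq> 0" for c K J
    unfolding wt_def using that by (intro sum.neutral) (auto simp: lookup_diag_zero)
  have "card ({1..length I} \<inter> {1..j}) = min j (length I)"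
    by (simp add: Int_atLeastAtMost min.commute)
  moreover have "set [1..<Suc (length I)] = {1..length I}" by auto
  ultimately have "wt j (tmon [1..<Suc (length I)]) = min j (length I)"
    by (simp only: wt_tmon distinct_upt)
  then show ?thesis
    using additive_degrees(1)[of j] unfolding gmon_def additive_def by (simp add: d del: upt_Suc)
qed

lemma wt_gmono:
  assumes L: "bicols m L1" "bicols m L2" "strict_cols L2" and j: "j \<le> m"
  shows "wt j (gmono m t L1 L2) = wt_total m j t L1 L2"
proof -
  note add = additive_degrees(1)[of j]
  have e: "wt j (ev 3 0 0) = 0" by (simp add: degrees_ev)
  have full: "wt j (gmon [1..<Suc m] [1..<Suc m]) = j"
    using wt_gmon[OF j, of "[1..<Suc m]"] j by (simp del: upt_Suc)
  have h: "wt j (hmon m I J) = (length I - 1) * j + min j (m - length I)" if IJ: "(I, J) \<in> set L2" for I J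
  proof -
    have "length (compl_cols m I) = m - length I"
      using bicolsD[OF L(2) IJ] L(3) IJ by (intro length_compl_cols) (auto simp: strict_cols_def strict_sorted_iff)
    then show ?thesis
      using add e full wt_gmon[OF j, of "compl_cols m I"]
      unfolding hmon_def additive_def by (simp add: additive_nmul[OF add] del: upt_Suc)
  qed
  have "wt j (\<Sum>(I, J)\<leftarrow>L1. gmon I J) = (\<Sum>(I, J)\<leftarrow>L1. min j (length I))"
    by (simp add: additive_sum_list[OF add] case_prod_unfold wt_gmon[OF j])
  moreover have "wt j (\<Sum>(I, J)\<leftarrow>L2. hmon m I J) = (\<Sum>(I, J)\<leftarrow>L2. (length I - 1) * j + min j (m - length I))"
    unfolding additive_sum_list[OF add]
    by (rule arg_cong[where f = sum_list], rule map_cong) (auto simp: h)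
  moreover have "wt j (nmul t (ev 3 0 0 + gmon [1..<Suc m] [1..<Suc m])) = t * j"
    using add e full unfolding additive_nmul[OF add] additive_def by (simp del: upt_Suc)
  ultimately show ?thesis
    using add unfolding gmono_def wt_total_def additive_def by (simp del: upt_Suc)
qed

subsection \<open>A standard bitableau is determined by its leading monomial\<close>

definition cell :: "nat list \<Rightarrow> nat \<Rightarrow> nat \<Rightarrow> nat"
  where "cell x a j = (if a < length x \<and> x ! a = j then 1 else 0)"

lemma lookup_diag_cell:
  assumes "length I = n"
  shows "Poly_Mapping.lookup (diag c [1..<Suc n] I) (c, Suc a, j) = cell I a j"
proof -
  have "Poly_Mapping.lookup (diag c [b..<b + length I] I) (c, b + a, j) = cell I a j" for b
  proof (induction I arbitrary: a b)
    case Nil then show ?case by (simp add: diag_def cell_def)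
  next
    case (Cons i I)
    have upt: "[b..<b + length (i # I)] = b # [Suc b..<Suc b + length I]"
      using upt_conv_Cons[of b "b + length (i # I)"] by (simp del: upt_Suc)
    show ?case
    proof (cases a)
      case 0
      then show ?thesis
        by (simp only: upt diag_simps lookup_add lookup_ev) (simp add: lookup_diag_zero cell_def del: upt_Suc)
    next
      case (Suc a')
      then show ?thesis using Cons.IH[of "Suc b" a']
        by (simp only: upt diag_simps lookup_add lookup_ev) (simp add: cell_def)
    qed
  qed
  from this[of 1] show ?thesis using assms by (simp del: upt_Suc)
qed

lemma lookup_gmon:
  assumes "length J = length I"
  shows "Poly_Mapping.lookup (gmon I J) (1, Suc a, j) = cell I a j"
    "Poly_Mapping.lookup (gmon I J) (2, Suc a, j) = cell J a j"
    "Poly_Mapping.lookup (gmon I J) (3, b, j) = 0"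
  unfolding gmon_def
  by (simp_all add: lookup_add lookup_tmon lookup_diag_zero lookup_diag_cell[unfolded One_nat_def] assms
      del: upt_Suc)

text \<open>The columns of the padded tableau: full columns, the complements of the columns in \<open>B\<close> in reverse
  order, and the columns in \<open>A\<close>.\<close>

definition hat_cols :: "nat \<Rightarrow> nat \<Rightarrow> nat list list \<Rightarrow> nat list list \<Rightarrow> nat list list"
  where "hat_cols m e A B = replicate (e - length B) [1..<Suc m] @ rev (map (compl_cols m) B) @ A"

lemma hat_cols_count:
  assumes "\<And>x. x \<in> set B \<Longrightarrow> x \<noteq> []"
  shows "(\<Sum>x\<leftarrow>hat_cols m (t + (\<Sum>x\<leftarrow>B. length x)) A B. cell x a j) =
    t * cell [1..<Suc m] a j + ((\<Sum>x\<leftarrow>A. cell x a j) +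
    (\<Sum>x\<leftarrow>B. (length x - 1) * cell [1..<Suc m] a j + cell (compl_cols m x) a j))"
proof -
  have len: "(\<Sum>x\<leftarrow>B. length x) = length B + (\<Sum>x\<leftarrow>B. length x - 1)"
    using assms
  proof (induction B)
    case (Cons x B)
    then have "0 < length x" by simp
    then show ?case using Cons by simp
  qed simp
  have s: "(\<Sum>x\<leftarrow>B. (length x - 1) * c + f x) = (\<Sum>x\<leftarrow>B. length x - 1) * c + (\<Sum>x\<leftarrow>B. f x)" for c and f :: "nat list \<Rightarrow> nat"
    by (induction B) (simp_all add: algebra_simps)
  show ?thesis
    unfolding hat_cols_def s
    by (simp add: len sum_list_replicate rev_map comp_def algebra_simps sum_list_rev
        flip: rev_map del: upt_Suc)
qed

lemma lookup_gmono:
  assumes L: "bicols m L1" "bicols m L2" "strict_cols L2" and ne: "\<And>I J. (I, J) \<in> set L2 \<Longrightarrow> I \<noteq> []"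
  shows "Poly_Mapping.lookup (gmono m t L1 L2) (1, Suc a, j) =
      (\<Sum>x\<leftarrow>hat_cols m (t + bideg L2) (map fst L1) (map fst L2). cell x a j)"
    "Poly_Mapping.lookup (gmono m t L1 L2) (2, Suc a, j) =
      (\<Sum>x\<leftarrow>hat_cols m (t + bideg L2) (map snd L1) (map snd L2). cell x a j)"
    "Poly_Mapping.lookup (gmono m t L1 L2) (3, 0, 0) = t + bideg L2"
proof -
  have l1: "length J = length I" if "(I, J) \<in> set L1" for I J using bicolsD[OF L(1) that] by simp
  have l2: "length J = length I" if "(I, J) \<in> set L2" for I J using bicolsD[OF L(2) that] by simp
  have lc: "length (compl_cols m J) = length (compl_cols m I)" if IJ: "(I, J) \<in> set L2" for I J
    using bicolsD[OF L(2) IJ] L(3) IJ by (simp add: length_compl_cols strict_cols_def strict_sorted_iff)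
  have h: "Poly_Mapping.lookup (hmon m I J) (1, Suc a, j) = (length I - 1) * cell [1..<Suc m] a j + cell (compl_cols m I) a j"
    "Poly_Mapping.lookup (hmon m I J) (2, Suc a, j) = (length J - 1) * cell [1..<Suc m] a j + cell (compl_cols m J) a j"
    "Poly_Mapping.lookup (hmon m I J) (3, 0, 0) = length I"
    if "(I, J) \<in> set L2" for I J
    unfolding hmon_def
    by (simp_all add: lookup_add lookup_nmul lookup_gmon[unfolded One_nat_def] lc[OF that] l2[OF that] lookup_ev del: upt_Suc)
  have deg: "bideg L2 = (\<Sum>x\<leftarrow>map fst L2. length x)" "bideg L2 = (\<Sum>x\<leftarrow>map snd L2. length x)"
  proof -
    show "bideg L2 = (\<Sum>x\<leftarrow>map fst L2. length x)" by (simp add: bideg_def comp_def case_prod_unfold)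
    show "bideg L2 = (\<Sum>x\<leftarrow>map snd L2. length x)"
      unfolding bideg_def map_map by (rule arg_cong[where f = sum_list], rule map_cong) (auto simp: l2)
  qed
  have ne1: "x \<noteq> []" if "x \<in> set (map fst L2)" for x using that ne by auto
  have ne2: "x \<noteq> []" if "x \<in> set (map snd L2)" for x using that ne l2 by fastforce
  have s1: "(\<Sum>(I, J)\<leftarrow>L1. Poly_Mapping.lookup (gmon I J) (1, Suc a, j)) = (\<Sum>x\<leftarrow>map fst L1. cell x a j)"
    "(\<Sum>(I, J)\<leftarrow>L1. Poly_Mapping.lookup (gmon I J) (2, Suc a, j)) = (\<Sum>x\<leftarrow>map snd L1. cell x a j)"
    "(\<Sum>(I, J)\<leftarrow>L1. Poly_Mapping.lookup (gmon I J) (3, 0, 0)) = (\<Sum>c\<leftarrow>L1. 0)"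
    unfolding map_map
    by (rule arg_cong[where f = sum_list], rule map_cong,
        (auto simp: lookup_gmon[unfolded One_nat_def] l1)[2])+
  have s2: "(\<Sum>(I, J)\<leftarrow>L2. Poly_Mapping.lookup (hmon m I J) (1, Suc a, j)) =
      (\<Sum>x\<leftarrow>map fst L2. (length x - 1) * cell [1..<Suc m] a j + cell (compl_cols m x) a j)"
    "(\<Sum>(I, J)\<leftarrow>L2. Poly_Mapping.lookup (hmon m I J) (2, Suc a, j)) =
      (\<Sum>x\<leftarrow>map snd L2. (length x - 1) * cell [1..<Suc m] a j + cell (compl_cols m x) a j)"
    "(\<Sum>(I, J)\<leftarrow>L2. Poly_Mapping.lookup (hmon m I J) (3, 0, 0)) = bideg L2"
    unfolding map_map bideg_def
    by (rule arg_cong[where f = sum_list], rule map_cong, (auto simp: h[unfolded One_nat_def] simp del: upt_Suc)[2])+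
  have g: "Poly_Mapping.lookup (gmono m t L1 L2) q =
    t * (Poly_Mapping.lookup (ev 3 0 0) q + Poly_Mapping.lookup (gmon [1..<Suc m] [1..<Suc m]) q) +
    ((\<Sum>(I, J)\<leftarrow>L1. Poly_Mapping.lookup (gmon I J) q) + (\<Sum>(I, J)\<leftarrow>L2. Poly_Mapping.lookup (hmon m I J) q))" for q
    unfolding gmono_def
    by (simp add: lookup_add lookup_nmul lookup_sum_list case_prod_unfold del: upt_Suc)
  show "Poly_Mapping.lookup (gmono m t L1 L2) (1, Suc a, j) =
      (\<Sum>x\<leftarrow>hat_cols m (t + bideg L2) (map fst L1) (map fst L2). cell x a j)"
  proof -
    have "Poly_Mapping.lookup (gmono m t L1 L2) (1, Suc a, j) = t * cell [1..<Suc m] a j +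
      ((\<Sum>x\<leftarrow>map fst L1. cell x a j) +
      (\<Sum>x\<leftarrow>map fst L2. (length x - 1) * cell [1..<Suc m] a j + cell (compl_cols m x) a j))"
      unfolding g s1 s2 lookup_gmon[OF refl] by (simp add: lookup_ev del: upt_Suc)
    also have "\<dots> = (\<Sum>x\<leftarrow>hat_cols m (t + bideg L2) (map fst L1) (map fst L2). cell x a j)"
      unfolding deg(1) by (rule hat_cols_count[symmetric]) (rule ne1)
    finally show ?thesis .
  qed
  show "Poly_Mapping.lookup (gmono m t L1 L2) (2, Suc a, j) =
      (\<Sum>x\<leftarrow>hat_cols m (t + bideg L2) (map snd L1) (map snd L2). cell x a j)"
  proof -
    have "Poly_Mapping.lookup (gmono m t L1 L2) (2, Suc a, j) = t * cell [1..<Suc m] a j +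
      ((\<Sum>x\<leftarrow>map snd L1. cell x a j) +
      (\<Sum>x\<leftarrow>map snd L2. (length x - 1) * cell [1..<Suc m] a j + cell (compl_cols m x) a j))"
      unfolding g s1 s2 lookup_gmon[OF refl] by (simp add: lookup_ev del: upt_Suc)
    also have "\<dots> = (\<Sum>x\<leftarrow>hat_cols m (t + bideg L2) (map snd L1) (map snd L2). cell x a j)"
      unfolding deg(2) by (rule hat_cols_count[symmetric]) (rule ne2)
    finally show ?thesis .
  qed
  show "Poly_Mapping.lookup (gmono m t L1 L2) (3, 0, 0) = t + bideg L2"
    unfolding g s1 s2 lookup_gmon[OF refl] by (simp add: lookup_ev sum_list_triv del: upt_Suc)
qed

definition col_count :: "nat list \<Rightarrow> nat \<Rightarrow> nat"
  where "col_count x j = card {i \<in> set x. i \<le> j}"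

lemma less_col_count:
  assumes "sorted_wrt (<) x"
  shows "a < col_count x j \<longleftrightarrow> a < length x \<and> x ! a \<le> j"
proof -
  have "distinct x" using assms by (simp add: strict_sorted_iff)
  then have "col_count x j = length (filter (\<lambda>i. i \<le> j) x)"
    by (simp add: col_count_def distinct_length_filter Int_def conj_commute)
  moreover have "sorted_wrt (\<lambda>a b. b \<le> j \<longrightarrow> a \<le> j) x"
    by (rule sorted_wrt_mono_rel[OF _ assms]) auto
  ultimately show ?thesis by (simp add: length_filter_prefix)
qed

text \<open>Both sides say that \<open>x\<close> has at least as many entries up to \<open>j\<close> as \<open>y\<close>, for every \<open>j\<close>. In this form the
  relation is easily compared with complements and with the pair condition.\<close>

lemma col_le_iff:
  assumes "sorted_wrt (<) x" "sorted_wrt (<) y" "set y \<subseteq> {1..m}"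
  shows "col_le x y \<longleftrightarrow> (\<forall>j\<in>{1..m}. col_count y j \<le> col_count x j)"
proof
  assume le: "col_le x y"
  show "\<forall>j\<in>{1..m}. col_count y j \<le> col_count x j"
  proof (intro ballI leI notI)
    fix j assume "col_count x j < col_count y j"
    then have "col_count x j < length y" "y ! col_count x j \<le> j"
      using less_col_count[OF assms(2)] by auto
    then have "col_count x j < length x \<and> x ! col_count x j \<le> j"
      using le unfolding col_le_def by force
    then show False using less_col_count[OF assms(1), of "col_count x j" j] by simp
  qed
next
  assume le: "\<forall>j\<in>{1..m}. col_count y j \<le> col_count x j"
  have *: "a < length x \<and> x ! a \<le> y ! a" if a: "a < length y" for a
  proof -
    have "y ! a \<in> {1..m}" using a assms(3) nth_mem by blast
    moreover have "a < col_count y (y ! a)" using a less_col_count[OF assms(2)] by simp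
    ultimately have "a < col_count x (y ! a)" using le by fastforce
    then show ?thesis using less_col_count[OF assms(1)] by simp
  qed
  then have "length y \<le> length x" by (meson leI less_irrefl)
  then show "col_le x y" using * by (simp add: col_le_def)
qed

lemma col_count_compl:
  assumes "set x \<subseteq> {1..m}" "j \<le> m"
  shows "col_count (compl_cols m x) j = j - col_count x j" "col_count x j \<le> j"
proof -
  have s: "{i \<in> set x. i \<le> j} \<subseteq> {1..j}" using assms by auto
  show "col_count x j \<le> j" unfolding col_count_def using card_mono[OF _ s] by simp
  have "{i \<in> set (compl_cols m x). i \<le> j} = {1..j} - {i \<in> set x. i \<le> j}"
    using assms by (auto simp: set_compl_cols)
  then show "col_count (compl_cols m x) j = j - col_count x j"
    unfolding col_count_def using s by (simp add: card_Diff_subset)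
qed

text \<open>Complementation reverses the relation between columns, and the pair condition says that the
  complement of the first column in \<open>B\<close> may precede the first column in \<open>A\<close>.\<close>

lemma hat_cols_sorted:
  assumes std: "rat_std m A B"
  shows "sorted_wrt col_le (hat_cols m e A B)" "\<And>x. x \<in> set (hat_cols m e A B) \<Longrightarrow> set x \<subseteq> {1..m}"
proof -
  have A: "sorted_wrt col_le A" "\<And>c. c \<in> set A \<Longrightarrow> c \<noteq> [] \<and> sorted_wrt (<) c \<and> set c \<subseteq> {1..m}"
    and B: "sorted_wrt col_le B" "\<And>c. c \<in> set B \<Longrightarrow> c \<noteq> [] \<and> sorted_wrt (<) c \<and> set c \<subseteq> {1..m}"
    using std by (auto simp: rat_std_def std_cols_def)
  let ?f = "[1..<Suc m]"
  have f: "sorted_wrt (<) ?f" "set ?f = {1..m}" by (simp_all add: sorted_wrt_upt del: upt_Suc) auto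
  have refl: "col_le x x" for x by (simp add: col_le_def)
  have full: "col_le ?f x" if "sorted_wrt (<) x" "set x \<subseteq> {1..m}" for x
  proof -
    have "col_count x j \<le> col_count ?f j" for j
      unfolding col_count_def using that(2) f(2) by (intro card_mono) auto
    then show ?thesis using col_le_iff[OF f(1) that] by blast
  qed
  note sc = sorted_compl_cols[of m]
  have sub: "set (compl_cols m x) \<subseteq> {1..m}" for x by (auto simp: set_compl_cols)
  have comp: "col_le (compl_cols m y) (compl_cols m x)" if "col_le x y" "x \<in> set B" "y \<in> set B" for x y
  proof -
    have "col_count y j \<le> col_count x j" if "j \<in> {1..m}" for j
      using col_le_iff[of x y m] \<open>col_le x y\<close> B(2)[OF \<open>x \<in> set B\<close>] B(2)[OF \<open>y \<in> set B\<close>] that by blast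
    then have "col_count (compl_cols m x) j \<le> col_count (compl_cols m y) j" if "j \<in> {1..m}" for j
      using that col_count_compl[of x m j] col_count_compl[of y m j]
        B(2)[OF \<open>x \<in> set B\<close>] B(2)[OF \<open>y \<in> set B\<close>] by (simp add: diff_le_mono2)
    then show ?thesis using col_le_iff[OF sc sc sub] by blast
  qed
  have head: "col_le (head_col C) c \<and> head_col C \<in> set C" if "sorted_wrt col_le C" "c \<in> set C" for C c
    using that by (cases C) (auto simp: head_col_def refl)
  have cross: "col_le (compl_cols m b) a" if a: "a \<in> set A" and b: "b \<in> set B" for a b
  proof -
    have "col_count a j \<le> col_count (compl_cols m b) j" if j: "j \<in> {1..m}" for j
    proof -
      have "col_count a j \<le> col_count (head_col A) j"
        using head[OF A(1) a] col_le_iff[of "head_col A" a m] A(2) a j by blast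
      moreover have "col_count b j \<le> col_count (head_col B) j"
        using head[OF B(1) b] col_le_iff[of "head_col B" b m] B(2) b j by blast
      moreover have "col_count (head_col A) j + col_count (head_col B) j \<le> j"
        using std j by (simp add: rat_std_def pair_std_def col_count_def)
      ultimately show ?thesis using col_count_compl[of b m j] B(2)[OF b] j by simp
    qed
    then show ?thesis using col_le_iff[OF sc] A(2)[OF a] by blast
  qed
  have "sorted_wrt col_le (rev (map (compl_cols m) B))"
    unfolding sorted_wrt_rev sorted_wrt_map
    by (rule sorted_wrt_mono_rel[OF _ B(1)]) (rule comp)
  moreover have "sorted_wrt col_le (replicate n ?f)" for n
    by (induction n) (auto simp: refl simp del: upt_Suc)
  ultimately show "sorted_wrt col_le (hat_cols m e A B)"
    unfolding hat_cols_def sorted_wrt_append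
    using A cross full[OF sc sub] full by (auto simp del: upt_Suc)
  show "set x \<subseteq> {1..m}" if x: "x \<in> set (hat_cols m e A B)" for x
  proof -
    have "x = ?f \<or> x \<in> compl_cols m ` set B \<or> x \<in> set A"
      using x by (auto simp: hat_cols_def simp del: upt_Suc split: if_splits)
    then show ?thesis using f(2) sub A(2) by blast
  qed
qed

text \<open>In a standard tableau the entries up to \<open>j\<close> in row \<open>a\<close> lie in an initial segment of the columns. So
  the contents of the rows determine all columns, except that empty columns leave no trace.\<close>

lemma chain_determined:
  assumes C: "sorted_wrt col_le C" "\<And>x. x \<in> set C \<Longrightarrow> set x \<subseteq> {1..m}"
    and D: "sorted_wrt col_le D" "\<And>x. x \<in> set D \<Longrightarrow> set x \<subseteq> {1..m}"
    and eq: "\<And>a j. (\<Sum>x\<leftarrow>C. cell x a j) = (\<Sum>x\<leftarrow>D. cell x a j)"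
    and i: "i < length C" "C ! i \<noteq> []"
  shows "i < length D \<and> D ! i = C ! i"
proof -
  let ?P = "\<lambda>a j x. a < length x \<and> x ! a \<le> (j::nat)"
  have pos: "i < length (filter (?P a j) E) \<longleftrightarrow> i < length E \<and> ?P a j (E ! i)"
    if "sorted_wrt col_le E" for E a j
  proof (rule length_filter_prefix)
    show "sorted_wrt (\<lambda>x y. ?P a j y \<longrightarrow> ?P a j x) E"
      by (rule sorted_wrt_mono_rel[OF _ that]) (force simp: col_le_def)
  qed
  have count: "length (filter (?P a j) E) = (\<Sum>j'\<in>{1..j}. \<Sum>x\<leftarrow>E. cell x a j')"
    if "\<And>x. x \<in> set E \<Longrightarrow> set x \<subseteq> {1..m}" for E a j
    using that
  proof (induction E)
    case (Cons x E)
    have "(\<Sum>j'\<in>{1..j}. cell x a j') = (if ?P a j x then 1 else 0)"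
    proof (cases "a < length x")
      case True
      have "set x \<subseteq> {1..m}" using Cons.prems[of x] by simp
      then have "x ! a \<in> {1..m}" using True nth_mem by blast
      then show ?thesis using True by (simp add: cell_def)
    qed (simp add: cell_def)
    then show ?case using Cons by (simp add: sum.distrib)
  qed simp
  \<comment> \<open>position \<open>i\<close> lies in the initial segment for \<open>(a, j)\<close> in both chains or in neither\<close>
  have key: "i < length C \<and> ?P a j (C ! i) \<longleftrightarrow> i < length D \<and> ?P a j (D ! i)" for a j
  proof -
    have "length (filter (?P a j) C) = length (filter (?P a j) D)"
      using count[OF C(2)] count[OF D(2)] eq by simp
    then show ?thesis using pos[OF C(1), of a j] pos[OF D(1), of a j] by simp
  qed
  have iD: "i < length D" using key[of 0 "C ! i ! 0"] i by simp
  have P: "?P a j (C ! i) \<longleftrightarrow> ?P a j (D ! i)" for a j using key[of a j] i iD by simp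
  have len: "a < length (C ! i) \<longleftrightarrow> a < length (D ! i)" for a
    using P[of a "C ! i ! a"] P[of a "D ! i ! a"] by auto
  then have "length (D ! i) = length (C ! i)" by (metis linorder_neqE_nat less_irrefl)
  moreover have "D ! i ! a = C ! i ! a" if "a < length (D ! i)" for a
    using that len[of a] P[of a "C ! i ! a"] P[of a "D ! i ! a"] by auto
  ultimately show ?thesis using iD by (auto intro: nth_equalityI)
qed

text \<open>The padded tableau has \<open>e\<close> columns in front of those of \<open>A\<close>. After reversal these are the
  complements of the columns in \<open>B\<close>, none of which is full, followed by full columns.\<close>

lemma hat_cols_determined:
  assumes std: "rat_std m A B" "rat_std m A' B'"
    and e: "e = t + (\<Sum>x\<leftarrow>B. length x)" "e = t' + (\<Sum>x\<leftarrow>B'. length x)"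
    and eq: "\<And>a j. (\<Sum>x\<leftarrow>hat_cols m e A B. cell x a j) = (\<Sum>x\<leftarrow>hat_cols m e A' B'. cell x a j)"
  shows "A = A' \<and> B = B'"
proof -
  let ?f = "[1..<Suc m]"
  define H where "H A B = hat_cols m e A B" for A B
  define P where "P B = replicate (e - length B) ?f @ rev (map (compl_cols m) B)" for B
  have H: "H A B = P B @ A" for A B by (simp add: H_def P_def hat_cols_def)
  have ne: "c \<noteq> []" if "rat_std m A B" "c \<in> set A \<or> c \<in> set B" for A B c
    using that by (auto simp: rat_std_def std_cols_def)
  have lB: "length B \<le> (\<Sum>x\<leftarrow>B. length x)" if "rat_std m A B" for A B
  proof -
    have "(\<Sum>x\<leftarrow>B. 1) \<le> (\<Sum>x\<leftarrow>B. length x)"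
    proof (rule sum_list_mono)
      fix x assume "x \<in> set B"
      then show "1 \<le> length x" using ne[OF that, of x] by (auto simp: Suc_le_eq)
    qed
    then show ?thesis by (simp add: sum_list_triv)
  qed
  have lP: "length (P B) = e" "length (P B') = e"
    using lB[OF std(1)] lB[OF std(2)] e unfolding P_def by simp_all
  have det: "i < length (H A B) \<Longrightarrow> H A B ! i \<noteq> [] \<Longrightarrow> i < length (H A' B') \<and> H A' B' ! i = H A B ! i"
    and det': "i < length (H A' B') \<Longrightarrow> H A' B' ! i \<noteq> [] \<Longrightarrow> i < length (H A B) \<and> H A B ! i = H A' B' ! i" for i
    unfolding H_def
    by (rule chain_determined[OF hat_cols_sorted[OF std(1)] hat_cols_sorted[OF std(2)] eq], assumption+)
       (rule chain_determined[OF hat_cols_sorted[OF std(2)] hat_cols_sorted[OF std(1)] eq[symmetric]], assumption+)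
  have A1: "i < length A' \<and> A' ! i = A ! i" if i: "i < length A" for i
    using det[of "e + i"] i lP ne[OF std(1), of "A ! i"] by (simp add: H nth_append)
  have A2: "i < length A \<and> A ! i = A' ! i" if i: "i < length A'" for i
    using det'[of "e + i"] i lP ne[OF std(2), of "A' ! i"] by (simp add: H nth_append)
  have "A = A'"
    using A1 A2 by (metis linorder_neqE_nat less_irrefl nth_equalityI)
  moreover have "P B = P B'"
  proof (rule nth_equalityI)
    fix i assume "i < length (P B)"
    then have i: "i < e" using lP by simp
    show "P B ! i = P B' ! i"
      using det[of i] det'[of i] i lP by (cases "P B ! i = []"; cases "P B' ! i = []") (simp_all add: H nth_append)
  qed (simp add: lP)
  then have "rev (P B) = rev (P B')" by simp
  then have r: "map (compl_cols m) B @ replicate (e - length B) ?f = map (compl_cols m) B' @ replicate (e - length B') ?f"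
    by (simp add: P_def del: upt_Suc)
  \<comment> \<open>the complement of a nonempty column is not full, so the full columns can be cut off\<close>
  have tw: "takeWhile (\<lambda>x. x \<noteq> ?f) (map (compl_cols m) B @ replicate n ?f) = map (compl_cols m) B"
    if "rat_std m A B" for A B n
  proof -
    have "x \<noteq> ?f" if x: "x \<in> set (map (compl_cols m) B)" for x
    proof
      assume xf: "x = ?f"
      obtain b where b: "b \<in> set B" "x = compl_cols m b" using x by auto
      have "set b \<subseteq> {1..m}" "b \<noteq> []" using \<open>rat_std m A B\<close> b(1) by (auto simp: rat_std_def std_cols_def)
      moreover have "{1..m} - set b = {1..m}"
        using arg_cong[OF xf, of set] b(2) by (simp add: set_compl_cols atLeastLessThanSuc_atLeastAtMost del: upt_Suc)
      ultimately show False by (cases b) auto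
    qed
    then show ?thesis by (subst takeWhile_append2) (simp_all del: upt_Suc)
  qed
  have mm: "map (compl_cols m) B = map (compl_cols m) B'"
    using arg_cong[OF r, of "takeWhile (\<lambda>x. x \<noteq> ?f)"] tw[OF std(1)] tw[OF std(2)] by simp
  have cc: "map (compl_cols m) (map (compl_cols m) B) = B" if "rat_std m A B" for A B
    unfolding map_map
    by (rule map_idI) (use that in \<open>auto simp: rat_std_def std_cols_def compl_compl_cols\<close>)
  have "B = B'" using arg_cong[OF mm, of "map (compl_cols m)"] cc[OF std(1)] cc[OF std(2)] by simp
  ultimately show ?thesis by simp
qed

lemma gmono_inj:
  assumes L: "bicols m L1" "bicols m L2" "rat_std m (map fst L1) (map fst L2)" "rat_std m (map snd L1) (map snd L2)"
    and L': "bicols m L1'" "bicols m L2'" "rat_std m (map fst L1') (map fst L2')" "rat_std m (map snd L1') (map snd L2')"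
    and eq: "gmono m t L1 L2 = gmono m t' L1' L2'"
  shows "t = t' \<and> L1 = L1' \<and> L2 = L2'"
proof -
  have strict: "strict_cols M2" and ne: "(I, J) \<in> set M2 \<Longrightarrow> I \<noteq> []"
    and deg: "bideg M2 = (\<Sum>x\<leftarrow>map fst M2. length x)" "bideg M2 = (\<Sum>x\<leftarrow>map snd M2. length x)"
    if M: "bicols m M2" "rat_std m (map fst M1) (map fst M2)" "rat_std m (map snd M1) (map snd M2)" for M1 M2 I J
  proof -
    show "strict_cols M2" using M(2,3) by (force simp: strict_cols_def rat_std_def std_cols_def)
    show "(I, J) \<in> set M2 \<Longrightarrow> I \<noteq> []" using M(2) by (force simp: rat_std_def std_cols_def)
    show "bideg M2 = (\<Sum>x\<leftarrow>map fst M2. length x)" by (simp add: bideg_def comp_def case_prod_unfold)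
    show "bideg M2 = (\<Sum>x\<leftarrow>map snd M2. length x)"
      unfolding bideg_def map_map by (rule arg_cong[where f = sum_list], rule map_cong) (use bicolsD(1)[OF M(1)] in auto)
  qed
  note lk = lookup_gmono[OF L(1,2) strict[OF L(2-4)] ne[OF L(2-4)]]
  note lk' = lookup_gmono[OF L'(1,2) strict[OF L'(2-4)] ne[OF L'(2-4)]]
  have e: "t + bideg L2 = t' + bideg L2'" using lk(3)[where t = t] lk'(3)[where t = t'] eq by simp
  have "map fst L1 = map fst L1' \<and> map fst L2 = map fst L2'"
  proof (rule hat_cols_determined[OF L(3) L'(3)])
    show "t + bideg L2 = t + (\<Sum>x\<leftarrow>map fst L2. length x)" by (simp only: deg(1)[OF L(2-4)])
    show "t + bideg L2 = t' + (\<Sum>x\<leftarrow>map fst L2'. length x)" using e by (simp only: deg(1)[OF L'(2-4)])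
    show "(\<Sum>x\<leftarrow>hat_cols m (t + bideg L2) (map fst L1) (map fst L2). cell x a j) =
        (\<Sum>x\<leftarrow>hat_cols m (t + bideg L2) (map fst L1') (map fst L2'). cell x a j)" for a j
      using lk(1)[where t = t and a = a and j = j] lk'(1)[where t = t' and a = a and j = j] eq e by simp
  qed
  moreover have "map snd L1 = map snd L1' \<and> map snd L2 = map snd L2'"
  proof (rule hat_cols_determined[OF L(4) L'(4)])
    show "t + bideg L2 = t + (\<Sum>x\<leftarrow>map snd L2. length x)" by (simp only: deg(2)[OF L(2-4)])
    show "t + bideg L2 = t' + (\<Sum>x\<leftarrow>map snd L2'. length x)" using e by (simp only: deg(2)[OF L'(2-4)])
    show "(\<Sum>x\<leftarrow>hat_cols m (t + bideg L2) (map snd L1) (map snd L2). cell x a j) =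
        (\<Sum>x\<leftarrow>hat_cols m (t + bideg L2) (map snd L1') (map snd L2'). cell x a j)" for a j
      using lk(2)[where t = t and a = a and j = j] lk'(2)[where t = t' and a = a and j = j] eq e by simp
  qed
  ultimately have "L1 = L1'" "L2 = L2'" by (metis zip_map_fst_snd)+
  then show ?thesis using e by simp
qed

section \<open>Leading monomials in linear combinations\<close>

lemma lookup_of_int_mult:
  "Poly_Mapping.lookup (of_int a * f) u = a * Poly_Mapping.lookup f u" for f :: "('a::comm_monoid_add) \<Rightarrow>\<^sub>0 int"
proof (induction a rule: int_induct[where k = 0])
  case base then show ?case by simp
next
  case (step1 i) then show ?case by (simp add: algebra_simps lookup_add)
next
  case (step2 i) then show ?case by (simp add: algebra_simps lookup_minus)
qed

text \<open>Among the indices with the label \<open>g\<close> of \<open>i0\<close> take one whose leading monomial is maximal for \<open>w\<close>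
  first and for the order of monomials second. It occurs in no other summand.\<close>

lemma surviving_lead:
  fixes f :: "'i \<Rightarrow> (('v::linorder \<Rightarrow>\<^sub>0 nat) \<Rightarrow>\<^sub>0 int)" and w :: "('v \<Rightarrow>\<^sub>0 nat) \<Rightarrow> nat"
  assumes F: "finite F" "i0 \<in> F" and a: "\<And>i. i \<in> F \<Longrightarrow> a i \<noteq> 0"
    and lead: "\<And>i. i \<in> F \<Longrightarrow> lead (f i) (u i)" and inj: "inj_on u F"
    and g: "\<And>i v. i \<in> F \<Longrightarrow> v \<in> Poly_Mapping.keys (f i) \<Longrightarrow> g v = g (u i)"
    and w: "\<And>i v. i \<in> F \<Longrightarrow> v \<in> Poly_Mapping.keys (f i) \<Longrightarrow> w v \<le> w (u i)"
  obtains i where "i \<in> F" "g (u i) = g (u i0)" "w (u i0) \<le> w (u i)"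
    "u i \<in> Poly_Mapping.keys (\<Sum>i\<in>F. of_int (a i) * f i)"
proof -
  let ?G = "{i \<in> F. g (u i) = g (u i0)}"
  let ?k = "\<lambda>i. (w (u i), u i)"
  have fin: "finite (?k ` ?G)" "?k ` ?G \<noteq> {}" using F by auto
  obtain i where i: "i \<in> ?G" "?k i = Max (?k ` ?G)" using Max_in[OF fin] by auto
  have max: "?k i' \<le> ?k i" if "i' \<in> ?G" for i'
    unfolding i(2) using that fin by (intro Max_ge) auto
  have other: "Poly_Mapping.lookup (f i') (u i) = 0" if i': "i' \<in> F" "i' \<noteq> i" for i'
  proof (rule ccontr)
    assume "Poly_Mapping.lookup (f i') (u i) \<noteq> 0"
    then have k: "u i \<in> Poly_Mapping.keys (f i')" by (simp add: in_keys_iff)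
    have "i' \<in> ?G" using g[OF i'(1) k] i(1) i'(1) by simp
    then have "?k i' \<le> ?k i" by (rule max)
    moreover have "w (u i) \<le> w (u i')" by (rule w[OF i'(1) k])
    moreover have "u i \<le> u i'" using lead[OF i'(1)] k by (simp add: lead_def)
    ultimately have "u i' = u i" by auto
    then show False using inj i' i(1) by (auto dest: inj_onD)
  qed
  have "Poly_Mapping.lookup (\<Sum>i\<in>F. of_int (a i) * f i) (u i) =
      (\<Sum>i'\<in>F. if i' = i then a i * Poly_Mapping.lookup (f i) (u i) else 0)"
    unfolding lookup_sum lookup_of_int_mult by (rule sum.cong) (auto simp: other)
  also have "\<dots> = a i * Poly_Mapping.lookup (f i) (u i)" using F(1) i(1) by simp
  also have "\<dots> \<noteq> 0" using a lead i(1) by (auto simp: lead_def in_keys_iff)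
  finally have "u i \<in> Poly_Mapping.keys (\<Sum>i\<in>F. of_int (a i) * f i)" by (simp add: in_keys_iff)
  moreover have "w (u i0) \<le> w (u i)" using max[of i0] F(2) by (auto simp: less_eq_prod_def)
  ultimately show thesis using that i(1) by blast
qed

section \<open>Dominance and partial sums\<close>

lemma sum_list_map2_diff:
  "length xs = length ys \<Longrightarrow> sum_list (map2 (-) xs ys) = sum_list xs - sum_list (ys :: int list)"
  by (induction xs ys rule: list_induct2) auto

lemma sum_list_map_int: "sum_list (map int xs) = int (sum_list xs)"
  by (induction xs) auto

text \<open>This compares a partial sum of the weight of a shape with the degree of the leading monomial in
  the first \<open>j\<close> entries of \<open>D\<close>. A column of length \<open>k\<close> of the second tableau contributes
  \<open>j\<close> to the degree for each of the \<open>k - 1\<close> factors \<open>det X\<close> and \<open>min j (m - k)\<close> for the complementary minor.\<close>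

lemma sum_take_bracket:
  assumes A: "tabcols m A" and B: "tabcols m B" and j: "j \<le> m"
  shows "sum_list (take j (bracket (shape_of m A) (shape_of m B))) + int (\<Sum>x\<leftarrow>B. length x) * int j =
    int ((\<Sum>x\<leftarrow>A. min j (length x)) + (\<Sum>x\<leftarrow>B. (length x - 1) * j + min j (m - length x)))"
proof -
  let ?p = "shape_of m A" and ?q = "shape_of m B"
  have "sum_list (take j (bracket ?p ?q)) = sum_list (take j (map int ?p)) - sum_list (take j (rev (map int ?q)))"
    unfolding bracket_def take_map take_zip by (rule sum_list_map2_diff) simp
  also have "sum_list (take j (map int ?p)) = int (\<Sum>x\<leftarrow>A. min j (length x))"
    by (simp only: take_map sum_list_map_int sum_shape_of[OF j])
  also have "sum_list (take j (rev (map int ?q))) = int (sum_list ?q) - int (\<Sum>x\<leftarrow>B. min (m - j) (length x))"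
  proof -
    have "take j (rev (map int ?q)) = rev (map int (drop (m - j) ?q))"
      by (simp add: take_rev drop_map)
    then have "sum_list (take j (rev (map int ?q))) = int (sum_list (drop (m - j) ?q))"
      by (simp add: sum_list_rev sum_list_map_int)
    moreover have "sum_list ?q = sum_list (take (m - j) ?q) + sum_list (drop (m - j) ?q)"
      by (metis append_take_drop_id sum_list_append)
    ultimately show ?thesis by (simp add: sum_shape_of)
  qed
  also have "int (sum_list ?q) = int (\<Sum>x\<leftarrow>B. length x)" by (simp add: sum_list_shape_of[OF B])
  finally have eq: "sum_list (take j (bracket ?p ?q)) = int (\<Sum>x\<leftarrow>A. min j (length x)) -
    (int (\<Sum>x\<leftarrow>B. length x) - int (\<Sum>x\<leftarrow>B. min (m - j) (length x)))" .
  have "\<forall>x\<in>set B. x \<noteq> [] \<and> length x \<le> m" using B by (simp add: tabcols_def)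
  then have "int (\<Sum>x\<leftarrow>B. length x) * int j + int (\<Sum>x\<leftarrow>B. min (m - j) (length x)) =
      int (\<Sum>x\<leftarrow>B. (length x - 1) * j + min j (m - length x)) + int (\<Sum>x\<leftarrow>B. length x)"
  proof (induction B)
    case (Cons x B)
    obtain l where l: "length x = Suc l" using Cons.prems by (cases x) auto
    have "Suc l \<le> m" using Cons.prems l by simp
    then have "min (m - j) (Suc l) + j = min j (m - Suc l) + Suc l" using j by (auto simp: min_def)
    then have "int (min (m - j) (Suc l)) + int j = int (min j (m - Suc l)) + int (Suc l)"
      by (simp only: of_nat_add[symmetric])
    then have "int (length x) * int j + int (min (m - j) (length x)) =
        int ((length x - 1) * j + min j (m - length x)) + int (length x)"
      unfolding l by (simp add: algebra_simps)
    then show ?case using Cons by (simp add: distrib_right)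
  qed simp
  then show ?thesis unfolding eq by simp
qed

lemma sum_list_bracket:
  assumes "tabcols m A" "tabcols m B"
  shows "sum_list (bracket (shape_of m A) (shape_of m B)) =
    int (sum_list (shape_of m A)) - int (sum_list (shape_of m B))"
  unfolding bracket_def by (subst sum_list_map2_diff) (simp_all add: sum_list_rev sum_list_map_int)

lemma length_bracket: "length p = m \<Longrightarrow> length q = m \<Longrightarrow> length (bracket p q) = m"
  by (simp add: bracket_def)

lemma bracket_dominant:
  assumes p: "p \<in> partitions m" and q: "q \<in> partitions m"
  shows "bracket p q \<in> dominant_weights m"
proof -
  have l: "length p = m" "length q = m" using p q by (auto simp: partitions_def)
  have "bracket p q ! j \<le> bracket p q ! i" if "i < j" "j < m" for i j
  proof -
    have "p ! j \<le> p ! i" using p that l by (auto simp: partitions_def sorted_wrt_iff_nth_less)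
    moreover have "q ! (m - 1 - i) \<le> q ! (m - 1 - j)"
      using q that l by (auto simp: partitions_def sorted_wrt_iff_nth_less)
    moreover have "bracket p q ! k = int (p ! k) - int (q ! (m - 1 - k))" if "k < m" for k
      using that l by (simp add: bracket_def rev_nth)
    ultimately show ?thesis using that by simp
  qed
  then show ?thesis
    using l by (auto simp: dominant_weights_def length_bracket sorted_wrt_iff_nth_less)
qed

section \<open>Evaluation at the generic point\<close>

context ranking
begin

definition phi :: "var \<Rightarrow> gpoly"
  where "phi v = (case v of VX i j \<Rightarrow> gx m (r i) (r j) | VY i j \<Rightarrow> gy m (r i) (r j))"

lemma phi_hom: "comm_ring_hom (peval phi)"
  by (rule peval_hom)

lemma peval_phi_var: "peval phi (x_var i j) = gx m (r i) (r j)" "peval phi (y_var i j) = gy m (r i) (r j)"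
  by (simp_all add: peval_mvar phi_def)

lemma r_bij: "bij_betw r {1..m} {1..m}"
  by (rule bij_betwI[of _ _ _ s]) (use r_range s_range r_s s_r in auto)

lemma r_inj: "i \<in> {1..m} \<Longrightarrow> j \<in> {1..m} \<Longrightarrow> r i = r j \<longleftrightarrow> i = j"
  using s_r by metis

lemma peval_phi_h:
  assumes ij: "i \<in> {1..m}" "j \<in> {1..m}"
  shows "peval phi (h m i j) = (if i = j then gd m else 0)"
    "peval phi (h_bar m i j) = (if i = j then gd m else 0)"
proof -
  have sum_r: "(\<Sum>l=1..m. f (r l)) = (\<Sum>l=1..m. f l)" for f :: "nat \<Rightarrow> gpoly"
    by (rule sum.reindex_bij_betw[OF r_bij])
  have "peval phi (h m i j) = (\<Sum>l=1..m. gx m (r l) (r i) * gy m (r l) (r j))"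
    by (simp add: h_def peval_sum peval_mult peval_phi_var)
  also have "\<dots> = (\<Sum>l=1..m. gx m l (r i) * gy m l (r j))" by (rule sum_r)
  also have "\<dots> = (if i = j then gd m else 0)"
    by (subst gx_gy(1)) (use ij r_range r_inj in auto)
  finally show "peval phi (h m i j) = (if i = j then gd m else 0)" .
  have "peval phi (h_bar m i j) = (\<Sum>l=1..m. gx m (r i) (r l) * gy m (r j) (r l))"
    by (simp add: h_bar_def peval_sum peval_mult peval_phi_var)
  also have "\<dots> = (\<Sum>l=1..m. gx m (r i) l * gy m (r j) l)" by (rule sum_r)
  also have "\<dots> = (if i = j then gd m else 0)"
    by (subst gx_gy(2)) (use ij r_range r_inj in auto)
  finally show "peval phi (h_bar m i j) = (if i = j then gd m else 0)" .
qed

text \<open>The generic point satisfies the defining relations.\<close>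

lemma peval_phi_ideal: "p \<in> monoid_ideal m \<Longrightarrow> peval phi p = 0"
proof -
  interpret hom: comm_ring_hom "peval phi" by (rule phi_hom)
  let ?K = "{p \<in> carrier (poly_ring m). peval phi p = 0}"
  have ring: "ring (poly_ring m)" by (rule cring.axioms(1)[OF poly_ring_cring])
  have "ideal ?K (poly_ring m)"
  proof (rule idealI[OF ring])
    show "subgroup ?K (add_monoid (poly_ring m))"
    proof (rule group.subgroupI[OF abelian_group.a_group[OF ring.is_abelian_group[OF ring]]])
      show "?K \<noteq> {}" using poly_carrier_ring(1) hom.hom_zero by blast
      fix a assume a: "a \<in> ?K"
      have "inv\<^bsub>add_monoid (poly_ring m)\<^esub> a = - a"
        by (rule group.inv_equality[OF abelian_group.a_group[OF ring.is_abelian_group[OF ring]]])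
          (use a poly_carrier_ring in auto)
      then show "inv\<^bsub>add_monoid (poly_ring m)\<^esub> a \<in> ?K"
        using a by (simp add: poly_carrier_ring hom.hom_uminus)
    qed (auto simp: poly_carrier_ring hom.hom_add)
  qed (auto simp: poly_carrier_ring hom.hom_mult)
  moreover have "monoid_relations m \<subseteq> ?K"
  proof
    fix p assume p: "p \<in> monoid_relations m"
    then have "p \<in> carrier (poly_ring m)" using monoid_relations_carrier by blast
    moreover have "peval phi p = 0"
      using p unfolding monoid_relations_def by (auto simp: peval_phi_h hom.hom_minus)
    ultimately show "p \<in> ?K" by simp
  qed
  ultimately have "monoid_ideal m \<subseteq> ?K"
    unfolding monoid_ideal_def by (rule ring.genideal_minimal[OF ring])
  then show "p \<in> monoid_ideal m \<Longrightarrow> peval phi p = 0" by blast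
qed

lemma peval_phi_minor_prod:
  assumes "bicols m L"
  shows "peval phi (minor_prod xs L) = minor_prod (gx m) L" "peval phi (minor_prod ys L) = minor_prod (gy m) L"
proof -
  have "minor_prod (\<lambda>i j. peval phi (A i j)) L = minor_prod B L"
    if "\<And>i j. i \<in> {1..m} \<Longrightarrow> j \<in> {1..m} \<Longrightarrow> peval phi (A i j) = B i j" for A B
    using assms
  proof (induction L)
    case (Cons c L)
    obtain I J where c: "c = (I, J)" by (cases c)
    have "minor (\<lambda>i j. peval phi (A i j)) I J = minor B I J"
      by (rule minor_cong, rule that) (use Cons.prems in \<open>unfold c bicols_simps, blast+\<close>)
    then show ?case using Cons by (simp add: c minor_prod_Cons bicols_simps)
  qed (simp add: minor_prod_Nil)
  from this[of xs "gx m"] this[of ys "gy m"]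
  show "peval phi (minor_prod xs L) = minor_prod (gx m) L" "peval phi (minor_prod ys L) = minor_prod (gy m) L"
    by (simp_all add: hom_minor_prod[OF phi_hom] xs_def ys_def peval_phi_var r_s)
qed

text \<open>A bitableau as two lists of pairs of columns, one list for each component of the shape.\<close>

definition bitab_cols :: "nat list \<Rightarrow> nat list \<Rightarrow> rat_tableau \<times> rat_tableau \<Rightarrow> bicolumns \<Rightarrow> bicolumns \<Rightarrow> bool"
  where "bitab_cols lam1 lam2 ST L1 L2 \<longleftrightarrow> bicols m L1 \<and> bicols m L2 \<and>
    tabcols m (map fst L1) \<and> tabcols m (map fst L2) \<and> tabcols m (map snd L1) \<and> tabcols m (map snd L2) \<and>
    lam1 = shape_of m (map fst L1) \<and> lam2 = shape_of m (map fst L2) \<and>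
    fst ST = (tab_of s (map fst L1), tab_of s (map fst L2)) \<and>
    snd ST = (tab_of s (map snd L1), tab_of s (map snd L2))"

lemma bitab_cols_exist:
  assumes lam: "lam1 \<in> partitions m" "lam2 \<in> partitions m" and ST: "is_rat_bitableau m lam1 lam2 ST"
  obtains L1 L2 where "bitab_cols lam1 lam2 ST L1 L2"
proof -
  obtain S1 S2 T1 T2 where STe: "ST = ((S1, S2), (T1, T2))" by (metis surj_pair)
  have tab: "is_tableau m lam1 S1" "is_tableau m lam2 S2" "is_tableau m lam1 T1" "is_tableau m lam2 T2"
    using ST by (auto simp: STe is_rat_bitableau_def is_rat_tableau_def)
  have one: "\<exists>L. bicols m L \<and> tabcols m (map fst L) \<and> tabcols m (map snd L) \<and> lam = shape_of m (map fst L) \<and>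
      S = tab_of s (map fst L) \<and> T = tab_of s (map snd L)"
    if lam: "lam \<in> partitions m" and S: "is_tableau m lam S" and T: "is_tableau m lam T" for lam S T
  proof -
    obtain A where A: "tabcols m A" "S = tab_of s A" "lam = shape_of m A"
      by (rule tableau_columns_exist[OF lam S])
    obtain B where B: "tabcols m B" "T = tab_of s B" "lam = shape_of m B"
      by (rule tableau_columns_exist[OF lam T])
    have "dom (tab_of s A) = dom (tab_of s B)"
      using S T A(2) B(2) by (simp add: is_tableau_def)
    then have ml: "map length A = map length B" using A(1) B(1) by (rule map_length_eq)
    then have len: "length A = length B" by (metis length_map)
    then have fs: "map fst (zip A B) = A" "map snd (zip A B) = B" by simp_all
    have "bicols m (zip A B)"
      unfolding bicols_def
    proof (intro allI impI)
      fix I J assume "(I, J) \<in> set (zip A B)"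
      then obtain k where k: "k < length A" "k < length B" "I = A ! k" "J = B ! k"
        by (auto simp: in_set_zip)
      have "length I = length J" using arg_cong[OF ml, of "\<lambda>l. l ! k"] k by simp
      moreover have "set I \<subseteq> {1..m}" "set J \<subseteq> {1..m}" using A(1) B(1) k by (simp_all add: tabcols_def)
      ultimately show "length I = length J \<and> set I \<subseteq> {1..m} \<and> set J \<subseteq> {1..m}" by blast
    qed
    then show ?thesis using A B fs by (intro exI[of _ "zip A B"]) simp
  qed
  obtain L1 where "bicols m L1 \<and> tabcols m (map fst L1) \<and> tabcols m (map snd L1) \<and> lam1 = shape_of m (map fst L1) \<and>
      S1 = tab_of s (map fst L1) \<and> T1 = tab_of s (map snd L1)"
    using one[OF lam(1) tab(1,3)] by blast
  moreover obtain L2 where "bicols m L2 \<and> tabcols m (map fst L2) \<and> tabcols m (map snd L2) \<and> lam2 = shape_of m (map fst L2) \<and>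
      S2 = tab_of s (map fst L2) \<and> T2 = tab_of s (map snd L2)"
    using one[OF lam(2) tab(2,4)] by blast
  ultimately show thesis using that[of L1 L2] by (simp add: bitab_cols_def STe)
qed

lemma bitab_cols_poly:
  assumes "bitab_cols lam1 lam2 ST L1 L2"
  shows "bidet_poly m (t, ST) = h m 1 1 ^ t * (minor_prod xs L1 * minor_prod ys L2)"
    "bidet_poly m (t, ST) \<in> carrier (poly_ring m)"
    "peval phi (bidet_poly m (t, ST)) = gprod m t L1 L2"
    "d_bidet m t ST = coord_class m (bidet_poly m (t, ST))"
    "bideterminant m ST = coord_class m (bidet_poly m (0, ST))"
proof -
  interpret M: matrix_pair m xs ys "homogeneous m" "relations_mod_d m" by (rule matrix_pair)
  interpret hom: comm_ring_hom "peval phi" by (rule phi_hom)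
  note b = assms[unfolded bitab_cols_def]
  have len: "map length (map fst L1) = map length (map snd L1)" "map length (map fst L2) = map length (map snd L2)"
    using b by (auto simp: bicols_def)
  have parts: "bidet_part x_var (fst (fst ST)) (fst (snd ST)) = minor_prod xs L1"
    "bidet_part y_var (snd (fst ST)) (snd (snd ST)) = minor_prod ys L2"
    using b bidet_part_tab_of[OF _ _ len(1), of x_var] bidet_part_tab_of[OF _ _ len(2), of y_var]
    by (simp_all add: zip_map_fst_snd xs_def[abs_def] ys_def[abs_def])
  show eq: "bidet_poly m (t, ST) = h m 1 1 ^ t * (minor_prod xs L1 * minor_prod ys L2)" for t
    by (simp add: bidet_poly_def parts)
  have c: "minor_prod xs L1 \<in> carrier (poly_ring m)" "minor_prod ys L2 \<in> carrier (poly_ring m)"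
    using M.minor_prod_F[of L1 xs] M.minor_prod_F[of L2 ys] M.X_F M.Y_F b homogeneous_carrier by blast+
  have one: "1 \<in> {1..m}" using m by simp
  have hc: "h m 1 1 \<in> carrier (poly_ring m)" by (rule h_carrier[OF one one])
  show "bidet_poly m (t, ST) \<in> carrier (poly_ring m)"
    unfolding eq by (intro poly_carrier_ring poly_carrier_power hc c)
  show "peval phi (bidet_poly m (t, ST)) = gprod m t L1 L2"
    unfolding eq gprod_def using b one
    by (simp add: hom.hom_mult hom.hom_power peval_phi_minor_prod peval_phi_h)
  have bd: "bideterminant m ST = coord_class m (minor_prod xs L1 * minor_prod ys L2)"
    unfolding bideterminant_def parts by (rule coord_class_mult[OF c])
  show "d_bidet m t ST = coord_class m (bidet_poly m (t, ST))"
    unfolding d_bidet_def bd eq d_elem_def coord_class_power[OF hc]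
    by (intro coord_class_mult poly_carrier_power hc poly_carrier_ring c)
  show "bideterminant m ST = coord_class m (bidet_poly m (0, ST))"
    unfolding bd eq by simp
qed

lemma bitab_cols_std:
  assumes "bitab_cols lam1 lam2 ST L1 L2" "standard_rat_bitableau m ord ST"
  shows "rat_std m (map fst L1) (map fst L2)" "rat_std m (map snd L1) (map snd L2)"
  using assms standard_rat_tableau_tab_of
  by (auto simp: bitab_cols_def standard_rat_bitableau_def)

definition index_cols :: "bitableau_index \<Rightarrow> bicolumns \<times> bicolumns"
  where "index_cols i = (SOME L. \<exists>lam1\<in>partitions m. \<exists>lam2\<in>partitions m.
    is_rat_bitableau m lam1 lam2 (snd i) \<and> bitab_cols lam1 lam2 (snd i) (fst L) (snd L))"

lemma index_cols:
  assumes "(t, ST) \<in> std_index m ord"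
  obtains lam1 lam2 L1 L2 where "index_cols (t, ST) = (L1, L2)" "lam1 \<in> partitions m" "lam2 \<in> partitions m"
    "is_rat_bitableau m lam1 lam2 ST" "bitab_cols lam1 lam2 ST L1 L2"
    "standard_rat_bitableau m ord ST"
    "rat_std m (map fst L1) (map fst L2)" "rat_std m (map snd L1) (map snd L2)"
proof -
  obtain lam1 lam2 where lam: "lam1 \<in> partitions m" "lam2 \<in> partitions m" "is_rat_bitableau m lam1 lam2 ST"
    and std: "standard_rat_bitableau m ord ST"
    using assms by (auto simp: std_index_def)
  obtain L1 L2 where L: "bitab_cols lam1 lam2 ST L1 L2" by (rule bitab_cols_exist[OF lam])
  have "\<exists>L. \<exists>lam1\<in>partitions m. \<exists>lam2\<in>partitions m.
      is_rat_bitableau m lam1 lam2 (snd (t, ST)) \<and> bitab_cols lam1 lam2 (snd (t, ST)) (fst L) (snd L)"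
    using lam L by (intro exI[of _ "(L1, L2)"]) auto
  from someI_ex[OF this, folded index_cols_def]
  obtain lam1 lam2 where "lam1 \<in> partitions m" "lam2 \<in> partitions m" "is_rat_bitableau m lam1 lam2 ST"
    "bitab_cols lam1 lam2 ST (fst (index_cols (t, ST))) (snd (index_cols (t, ST)))" by auto
  then show thesis using that[of "fst (index_cols (t, ST))" "snd (index_cols (t, ST))"] std bitab_cols_std
    by auto
qed

definition index_mon :: "bitableau_index \<Rightarrow> ((nat \<times> nat \<times> nat) \<Rightarrow>\<^sub>0 nat)"
  where "index_mon i = gmono m (fst i) (fst (index_cols i)) (snd (index_cols i))"

lemma rat_std_strict:
  assumes "bicols m L1" "bicols m L2" "rat_std m (map fst L1) (map fst L2)" "rat_std m (map snd L1) (map snd L2)"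
  shows "strict_cols L1" "strict_cols L2" "\<And>I J. (I, J) \<in> set L2 \<Longrightarrow> I \<noteq> []"
  using assms by (force simp: strict_cols_def rat_std_def std_cols_def)+

lemma lead_index_mon:
  assumes i: "i \<in> std_index m ord"
  shows "lead (peval phi (bidet_poly m i)) (index_mon i)"
proof -
  obtain t ST where ie: "i = (t, ST)" by (cases i)
  obtain lam1 lam2 L1 L2 where L: "index_cols (t, ST) = (L1, L2)" "bitab_cols lam1 lam2 ST L1 L2"
    "rat_std m (map fst L1) (map fst L2)" "rat_std m (map snd L1) (map snd L2)"
    by (rule index_cols[OF i[unfolded ie]])
  have b: "bicols m L1" "bicols m L2" using L(2) by (simp_all add: bitab_cols_def)
  show ?thesis
    unfolding ie index_mon_def bitab_cols_poly(3)[OF L(2)] L(1) fst_conv snd_conv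
    by (rule lead_gprod[OF b rat_std_strict[OF b L(3,4)]])
qed

lemma index_mon_inj: "inj_on index_mon (std_index m ord)"
proof (rule inj_onI)
  fix i i' assume i: "i \<in> std_index m ord" "i' \<in> std_index m ord" and eq: "index_mon i = index_mon i'"
  obtain t ST where ie: "i = (t, ST)" by (cases i)
  obtain t' ST' where ie': "i' = (t', ST')" by (cases i')
  obtain lam1 lam2 L1 L2 where L: "index_cols (t, ST) = (L1, L2)" "bitab_cols lam1 lam2 ST L1 L2"
    "rat_std m (map fst L1) (map fst L2)" "rat_std m (map snd L1) (map snd L2)"
    by (rule index_cols[OF i(1)[unfolded ie]])
  obtain lam1' lam2' L1' L2' where L': "index_cols (t', ST') = (L1', L2')" "bitab_cols lam1' lam2' ST' L1' L2'"
    "rat_std m (map fst L1') (map fst L2')" "rat_std m (map snd L1') (map snd L2')"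
    by (rule index_cols[OF i(2)[unfolded ie']])
  have "t = t' \<and> L1 = L1' \<and> L2 = L2'"
  proof (rule gmono_inj)
    show "gmono m t L1 L2 = gmono m t' L1' L2'"
      using eq L(1) L'(1) by (simp add: index_mon_def ie ie')
  qed (use L L' in \<open>simp_all add: bitab_cols_def\<close>)
  then show "i = i'" using L(2) L'(2) by (simp add: bitab_cols_def ie ie' prod_eq_iff)
qed

text \<open>The degrees for which images of bideterminants are homogeneous: in \<open>d'\<close>, in the rows of \<open>P\<close> and in
  the columns of \<open>Q\<close>.\<close>

definition multidegree :: "((nat \<times> nat \<times> nat) \<Rightarrow>\<^sub>0 nat) \<Rightarrow> nat \<times> nat list \<times> nat list"
  where "multidegree u = (ddeg u, map (\<lambda>k. entry_deg m 1 k u) [1..<Suc m], map (\<lambda>k. entry_deg m 2 k u) [1..<Suc m])"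

definition gprod_multidegree :: "nat \<Rightarrow> bicolumns \<Rightarrow> bicolumns \<Rightarrow> nat \<times> nat list \<times> nat list"
  where "gprod_multidegree t L1 L2 = (t + bideg L2,
    map (\<lambda>k. t + ((\<Sum>(I, J)\<leftarrow>L1. count_list I k) + (\<Sum>(I, J)\<leftarrow>L2. length I - count_list I k))) [1..<Suc m],
    map (\<lambda>k. t + ((\<Sum>(I, J)\<leftarrow>L1. count_list J k) + (\<Sum>(I, J)\<leftarrow>L2. length J - count_list J k))) [1..<Suc m])"

lemma gprod_multidegree:
  assumes "bicols m L1" "bicols m L2" "u \<in> Poly_Mapping.keys (gprod m t L1 L2)"
  shows "multidegree u = gprod_multidegree t L1 L2"
proof -
  note deg = gprod_degrees[OF assms(1,2), of _ t]
  have one: "1 \<in> {1..m}" using m by simp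
  have "ddeg u = t + bideg L2" using deg(3)[OF one] assms(3) by (simp add: hom_deg_def)
  moreover have "entry_deg m 1 k u = t + ((\<Sum>(I, J)\<leftarrow>L1. count_list I k) + (\<Sum>(I, J)\<leftarrow>L2. length I - count_list I k))"
    "entry_deg m 2 k u = t + ((\<Sum>(I, J)\<leftarrow>L1. count_list J k) + (\<Sum>(I, J)\<leftarrow>L2. length J - count_list J k))"
    if "k \<in> {1..m}" for k
    using deg(1,2)[OF that] assms(3) by (simp_all add: hom_deg_def)
  ultimately show ?thesis
    unfolding multidegree_def gprod_multidegree_def by (auto simp del: upt_Suc)
qed

lemma lead_survives:
  assumes F: "finite F" "F \<subseteq> std_index m ord" "\<And>i. i \<in> F \<Longrightarrow> a i \<noteq> 0" and i0: "i0 \<in> F" and j: "j \<le> m"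
  obtains i where "i \<in> F" "multidegree (index_mon i) = multidegree (index_mon i0)"
    "wt j (index_mon i0) \<le> wt j (index_mon i)"
    "index_mon i \<in> Poly_Mapping.keys (\<Sum>i\<in>F. of_int (a i) * peval phi (bidet_poly m i))"
proof (rule surviving_lead[OF F(1) i0 F(3), where f = "\<lambda>i. peval phi (bidet_poly m i)" and u = index_mon
      and g = multidegree and w = "wt j"])
  show lead: "lead (peval phi (bidet_poly m i)) (index_mon i)" if "i \<in> F" for i
    using lead_index_mon F(2) that by blast
  show "inj_on index_mon F" by (rule inj_on_subset[OF index_mon_inj F(2)])
  have cols: "\<exists>t L1 L2. peval phi (bidet_poly m i) = gprod m t L1 L2 \<and> index_mon i = gmono m t L1 L2 \<and>
      bicols m L1 \<and> bicols m L2 \<and> strict_cols L2 \<and> (\<forall>I J. (I, J) \<in> set L2 \<longrightarrow> I \<noteq> [])" if "i \<in> F" for i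
  proof -
    have i: "i \<in> std_index m ord" using F(2) that by blast
    obtain t ST where ie: "i = (t, ST)" by (cases i)
    obtain lam1 lam2 L1 L2 where L: "index_cols (t, ST) = (L1, L2)" "bitab_cols lam1 lam2 ST L1 L2"
      "rat_std m (map fst L1) (map fst L2)" "rat_std m (map snd L1) (map snd L2)"
      by (rule index_cols[OF i[unfolded ie]])
    have b: "bicols m L1" "bicols m L2" using L(2) by (simp_all add: bitab_cols_def)
    show ?thesis
      using bitab_cols_poly(3)[OF L(2)] L(1) b rat_std_strict[OF b L(3,4)]
      by (intro exI[of _ t] exI[of _ L1] exI[of _ L2]) (simp add: ie index_mon_def)
  qed
  fix i v assume i: "i \<in> F" and v: "v \<in> Poly_Mapping.keys (peval phi (bidet_poly m i))"
  obtain t L1 L2 where L: "peval phi (bidet_poly m i) = gprod m t L1 L2" "index_mon i = gmono m t L1 L2"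
    "bicols m L1" "bicols m L2" "strict_cols L2" "\<forall>I J. (I, J) \<in> set L2 \<longrightarrow> I \<noteq> []"
    using cols[OF i] by blast
  have "index_mon i \<in> Poly_Mapping.keys (gprod m t L1 L2)" using lead[OF i] L(1) by (simp add: lead_def)
  then show "multidegree v = multidegree (index_mon i)"
    using gprod_multidegree[OF L(3,4)] v L(1) by simp
  have "gprod m t L1 L2 \<in> deg_le (wt j) (wt_total m j t L1 L2)"
    by (rule gprod_wt[OF L(3,4) _ j]) (use L(6) in blast)
  then show "wt j v \<le> wt j (index_mon i)"
    using v L(1) unfolding L(2) wt_gmono[OF L(3-5) j] by (simp add: deg_le_def)
qed

text \<open>A nontrivial relation would have a surviving leading monomial at the generic point.\<close>

theorem standard_bideterminants_independent:
  assumes F: "finite F" "F \<subseteq> std_index m ord"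
    and zero: "(\<Sum>i\<in>F. of_int (a i) * bidet_poly m i) \<in> monoid_ideal m"
  shows "\<forall>i\<in>F. a i = 0"
proof (rule ccontr)
  interpret hom: comm_ring_hom "peval phi" by (rule phi_hom)
  assume "\<not> (\<forall>i\<in>F. a i = 0)"
  then obtain i0 where i0: "i0 \<in> {i \<in> F. a i \<noteq> 0}" by blast
  have int: "peval phi (of_int k) = of_int k" for k by (induction k rule: int_induct[where k = 0]) (simp_all add: peval_add peval_one peval_zero hom.hom_minus)
  have "(\<Sum>i\<in>F. of_int (a i) * peval phi (bidet_poly m i)) = 0"
    using peval_phi_ideal[OF zero] by (simp add: peval_sum peval_mult int)
  moreover have "(\<Sum>i\<in>F. of_int (a i) * peval phi (bidet_poly m i)) =
      (\<Sum>i\<in>{i \<in> F. a i \<noteq> 0}. of_int (a i) * peval phi (bidet_poly m i))"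
    by (rule sum.mono_neutral_right) (use F in auto)
  ultimately have "(\<Sum>i\<in>{i \<in> F. a i \<noteq> 0}. of_int (a i) * peval phi (bidet_poly m i)) = 0" by simp
  moreover obtain i where "index_mon i \<in>
      Poly_Mapping.keys (\<Sum>i\<in>{i \<in> F. a i \<noteq> 0}. of_int (a i) * peval phi (bidet_poly m i))"
    by (rule lead_survives[of "{i \<in> F. a i \<noteq> 0}" a i0 0]) (use F i0 in auto)
  ultimately show False by simp
qed

subsection \<open>The basis\<close>

lemma index_coord_class:
  assumes "i \<in> std_index m ord"
  shows "(\<lambda>(t, ST). d_bidet m t ST) i = coord_class m (bidet_poly m i)"
    "bidet_poly m i \<in> carrier (poly_ring m)"
proof -
  obtain t ST where ie: "i = (t, ST)" by (cases i)
  obtain lam1 lam2 L1 L2 where L: "bitab_cols lam1 lam2 ST L1 L2"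
    by (rule index_cols[OF assms[unfolded ie]])
  show "(\<lambda>(t, ST). d_bidet m t ST) i = coord_class m (bidet_poly m i)"
    "bidet_poly m i \<in> carrier (poly_ring m)"
    unfolding ie using bitab_cols_poly(2,4)[OF L] by simp_all
qed

lemma int_lincomb_index:
  assumes F: "finite F" "F \<subseteq> std_index m ord"
  shows "int_lincomb (coord_ring m) F a (\<lambda>(t, ST). d_bidet m t ST) =
    coord_class m (\<Sum>i\<in>F. of_int (a i) * bidet_poly m i)"
    "(\<Sum>i\<in>F. of_int (a i) * bidet_poly m i) \<in> carrier (poly_ring m)"
proof -
  interpret R: cring "coord_ring m" by (rule coord_ring_cring)
  have c: "bidet_poly m i \<in> carrier (poly_ring m)" if "i \<in> F" for i
    using index_coord_class(2) F(2) that by blast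
  have "int_lincomb (coord_ring m) F a (\<lambda>(t, ST). d_bidet m t ST) =
      int_lincomb (coord_ring m) F a (\<lambda>i. coord_class m (bidet_poly m i))"
    unfolding int_lincomb_def
  proof (rule R.finsum_cong'[OF refl])
    show "(\<lambda>i. [a i] \<cdot>\<^bsub>coord_ring m\<^esub> coord_class m (bidet_poly m i)) \<in> F \<rightarrow> carrier (coord_ring m)"
      using c by (auto simp: coord_class_of_int intro!: coord_class_carrier poly_carrier_of_int_mult)
  qed (use index_coord_class(1) F(2) in auto)
  also have "\<dots> = coord_class m (\<Sum>i\<in>F. of_int (a i) * bidet_poly m i)"
    by (rule int_lincomb_coord_class[OF F(1) c])
  finally show "int_lincomb (coord_ring m) F a (\<lambda>(t, ST). d_bidet m t ST) =
    coord_class m (\<Sum>i\<in>F. of_int (a i) * bidet_poly m i)" .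
  show "(\<Sum>i\<in>F. of_int (a i) * bidet_poly m i) \<in> carrier (poly_ring m)"
    by (intro add_subgroup_sum[OF poly_carrier_subgroup] poly_carrier_of_int_mult c)
qed

theorem standard_bideterminants_basis:
  "is_int_basis (coord_ring m) (std_index m ord) (\<lambda>(t, ST). d_bidet m t ST)"
  unfolding is_int_basis_def
proof (intro conjI ballI allI impI)
  show "(\<lambda>(t, ST). d_bidet m t ST) ` std_index m ord \<subseteq> carrier (coord_ring m)"
  proof (rule image_subsetI)
    fix i assume "i \<in> std_index m ord"
    from index_coord_class[OF this] show "(\<lambda>(t, ST). d_bidet m t ST) i \<in> carrier (coord_ring m)"
      by (simp only: coord_class_carrier)
  qed
next
  fix v assume "v \<in> carrier (coord_ring m)"
  then obtain p where p: "p \<in> carrier (poly_ring m)" "v = coord_class m p" by (rule coord_ring_carrierE)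
  obtain F a where F: "finite F" "F \<subseteq> std_index m ord"
    "p - (\<Sum>i\<in>F. of_int (a i) * bidet_poly m i) \<in> monoid_ideal m"
    using standard_bideterminants_span[OF p(1)] unfolding lincombs_def by blast
  have "v = int_lincomb (coord_ring m) F a (\<lambda>(t, ST). d_bidet m t ST)"
    unfolding p(2) int_lincomb_index(1)[OF F(1,2)]
    using F(3) coord_class_eq[OF p(1) int_lincomb_index(2)[OF F(1,2)]] by blast
  then show "\<exists>F a. finite F \<and> F \<subseteq> std_index m ord \<and>
      v = int_lincomb (coord_ring m) F a (\<lambda>(t, ST). d_bidet m t ST)" using F by blast
next
  fix F a i
  assume F: "finite F \<and> F \<subseteq> std_index m ord \<and>
    int_lincomb (coord_ring m) F a (\<lambda>(t, ST). d_bidet m t ST) = \<zero>\<^bsub>coord_ring m\<^esub>" and i: "i \<in> F"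
  then have F': "finite F" "F \<subseteq> std_index m ord" by auto
  have "coord_class m (\<Sum>i\<in>F. of_int (a i) * bidet_poly m i) = coord_class m 0"
    using F int_lincomb_index(1)[OF F', of a] by (simp add: coord_class_zero)
  then have "(\<Sum>i\<in>F. of_int (a i) * bidet_poly m i) \<in> monoid_ideal m"
    using coord_class_eq[OF int_lincomb_index(2)[OF F'] poly_carrier_ring(1)] by simp
  then show "a i = 0" using standard_bideterminants_independent[OF F'] i by blast
qed

subsection \<open>Expansion of a bideterminant\<close>

lemma count_sums:
  assumes "bicols m L"
  shows "(\<Sum>(I, J)\<leftarrow>L. count_list I k) = count_list (concat (map fst L)) k"
    "(\<Sum>(I, J)\<leftarrow>L. count_list J k) = count_list (concat (map snd L)) k"
    "(\<Sum>(I, J)\<leftarrow>L. length I - count_list I k) + count_list (concat (map fst L)) k = bideg L"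
    "(\<Sum>(I, J)\<leftarrow>L. length J - count_list J k) + count_list (concat (map snd L)) k = bideg L"
  using assms
proof (induction L)
  case (Cons c L)
  obtain I J where c: "c = (I, J)" by (cases c)
  {
    case 1 then show ?case using Cons.IH(1) by (simp add: c bicols_simps)
  next
    case 2 then show ?case using Cons.IH(2) by (simp add: c bicols_simps)
  next
    case 3 then show ?case
      using Cons.IH(3) count_le_length[of I k] by (simp add: c bicols_simps bideg_def)
  next
    case 4 then show ?case
      using Cons.IH(4) count_le_length[of J k] by (simp add: c bicols_simps bideg_def)
  }
qed (simp_all add: bideg_def)

lemma sum_count_concat:
  assumes "bicols m L"
  shows "(\<Sum>k=1..m. count_list (concat (map fst L)) k) = bideg L"
proof -
  have "set (concat (map fst L)) \<subseteq> {1..m}"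
    using bicolsD(2)[OF assms] by fastforce
  then have "(\<Sum>k=1..m. count_list (concat (map fst L)) k) = length (concat (map fst L))"
    by (rule sum_count_set) simp
  then show ?thesis by (simp add: length_concat bideg_def comp_def case_prod_unfold)
qed

text \<open>Subtracting the degree in \<open>d'\<close> from the degree in a row of \<open>P\<close> leaves the component of the weight
  for that row; summed over all rows this gives the difference of the two sizes.\<close>

lemma multidegree_consequences:
  assumes M: "bicols m M1" "bicols m M2" and L: "bicols m L1" "bicols m L2"
    and eq: "gprod_multidegree t M1 M2 = gprod_multidegree 0 L1 L2"
  shows "t + bideg M2 = bideg L2" "t + bideg M1 = bideg L1"
    "k \<in> {1..m} \<Longrightarrow> int (count_list (concat (map fst M1)) k) - int (count_list (concat (map fst M2)) k) =
      int (count_list (concat (map fst L1)) k) - int (count_list (concat (map fst L2)) k)"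
    "k \<in> {1..m} \<Longrightarrow> int (count_list (concat (map snd M1)) k) - int (count_list (concat (map snd M2)) k) =
      int (count_list (concat (map snd L1)) k) - int (count_list (concat (map snd L2)) k)"
proof -
  show t: "t + bideg M2 = bideg L2" using eq by (simp add: gprod_multidegree_def)
  show f: "int (count_list (concat (map fst M1)) k) - int (count_list (concat (map fst M2)) k) =
      int (count_list (concat (map fst L1)) k) - int (count_list (concat (map fst L2)) k)" if "k \<in> {1..m}" for k
  proof -
    have "t + ((\<Sum>(I, J)\<leftarrow>M1. count_list I k) + (\<Sum>(I, J)\<leftarrow>M2. length I - count_list I k)) =
        (\<Sum>(I, J)\<leftarrow>L1. count_list I k) + (\<Sum>(I, J)\<leftarrow>L2. length I - count_list I k)"
      using eq that by (auto simp: gprod_multidegree_def simp del: upt_Suc)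
    then show ?thesis
      using count_sums(1)[OF M(1), of k] count_sums(1)[OF L(1), of k]
        count_sums(3)[OF M(2), of k] count_sums(3)[OF L(2), of k] t by linarith
  qed
  show "int (count_list (concat (map snd M1)) k) - int (count_list (concat (map snd M2)) k) =
      int (count_list (concat (map snd L1)) k) - int (count_list (concat (map snd L2)) k)" if "k \<in> {1..m}" for k
  proof -
    have "t + ((\<Sum>(I, J)\<leftarrow>M1. count_list J k) + (\<Sum>(I, J)\<leftarrow>M2. length J - count_list J k)) =
        (\<Sum>(I, J)\<leftarrow>L1. count_list J k) + (\<Sum>(I, J)\<leftarrow>L2. length J - count_list J k)"
      using eq that by (auto simp: gprod_multidegree_def simp del: upt_Suc)
    then show ?thesis
      using count_sums(2)[OF M(1), of k] count_sums(2)[OF L(1), of k]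
        count_sums(4)[OF M(2), of k] count_sums(4)[OF L(2), of k] t by linarith
  qed
  have "(\<Sum>k=1..m. int (count_list (concat (map fst M1)) k) - int (count_list (concat (map fst M2)) k)) =
      (\<Sum>k=1..m. int (count_list (concat (map fst L1)) k) - int (count_list (concat (map fst L2)) k))"
    by (rule sum.cong[OF refl f])
  then have "int (bideg M1) - int (bideg M2) = int (bideg L1) - int (bideg L2)"
    using sum_count_concat[OF M(1)] sum_count_concat[OF M(2)] sum_count_concat[OF L(1)] sum_count_concat[OF L(2)]
    by (simp add: sum_subtractf flip: of_nat_sum)
  then show "t + bideg M1 = bideg L1" using t by linarith
qed

lemma rat_weight_tab_of:
  assumes "tabcols m A" "tabcols m B"
  shows "rat_weight m (tab_of s A, tab_of s B) =
    map (\<lambda>k. int (count_list (concat A) (r k)) - int (count_list (concat B) (r k))) [1..<Suc m]"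
  unfolding rat_weight_def fst_conv snd_conv tableau_weight_tab_of[OF assms(1)] tableau_weight_tab_of[OF assms(2)]
  by (simp add: zip_map_map zip_same_conv_map case_prod_unfold comp_def del: upt_Suc)

lemma part_length_bound:
  assumes "rat_std m A B"
  shows "part_length (shape_of m A) + part_length (shape_of m B) \<le> m"
proof -
  have t: "tabcols m A" "tabcols m B" using assms by (auto simp: rat_std_def std_cols_tabcols)
  have "card {i \<in> set (head_col C). i \<le> m} = length (head_col C)" if "std_cols m C" for C
  proof -
    have "sorted_wrt (<) (head_col C)" "set (head_col C) \<subseteq> {1..m}"
      using that by (cases C; simp add: head_col_def std_cols_def)+
    then have "{i \<in> set (head_col C). i \<le> m} = set (head_col C)" "distinct (head_col C)"
      by (auto simp: strict_sorted_iff)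
    then show ?thesis by (simp add: distinct_card)
  qed
  moreover have "m \<in> {1..m}" using m by simp
  ultimately show ?thesis
    using assms unfolding part_length_shape_of[OF t(1)] part_length_shape_of[OF t(2)] rat_std_def pair_std_def
    by metis
qed

definition index_shapes :: "bitableau_index \<Rightarrow> nat list \<times> nat list"
  where "index_shapes i =
    (shape_of m (map fst (fst (index_cols i))), shape_of m (map fst (snd (index_cols i))))"

text \<open>An element of the basis that occurs in the expansion has the multidegree of \<open>(S | T)\<close>, and the
  degree of its leading monomial in the first \<open>j\<close> entries of \<open>D\<close> does not exceed that of some leading
  monomial that survives, hence not the bound for \<open>(S | T)\<close>.\<close>

lemma index_in_expansion:
  assumes L: "bitab_cols lam1 lam2 ST0 L1 L2"
    and F: "finite F" "F \<subseteq> std_index m ord" "\<And>i. i \<in> F \<Longrightarrow> a i \<noteq> 0"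
    and sum: "(\<Sum>i\<in>F. of_int (a i) * peval phi (bidet_poly m i)) = gprod m 0 L1 L2"
    and i: "(t, ST) \<in> F"
  defines "mu1 \<equiv> fst (index_shapes (t, ST))" and "mu2 \<equiv> snd (index_shapes (t, ST))"
  shows "is_decomposition m (bracket mu1 mu2) mu1 mu2" "is_rat_bitableau m mu1 mu2 ST"
    "standard_rat_bitableau m ord ST" "dominance_le (bracket mu1 mu2) (bracket lam1 lam2)"
    "int (sum_list mu1) = int (sum_list lam1) - int t" "int (sum_list mu2) = int (sum_list lam2) - int t"
    "bitableau_weight m ST = bitableau_weight m ST0"
proof -
  have idx: "(t, ST) \<in> std_index m ord" using i F(2) by blast
  obtain nu1 nu2 M1 M2 where M: "index_cols (t, ST) = (M1, M2)" "nu1 \<in> partitions m" "nu2 \<in> partitions m"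
    "is_rat_bitableau m nu1 nu2 ST" "bitab_cols nu1 nu2 ST M1 M2" "standard_rat_bitableau m ord ST"
    "rat_std m (map fst M1) (map fst M2)" "rat_std m (map snd M1) (map snd M2)"
    by (rule index_cols[OF idx])
  note l = L[unfolded bitab_cols_def] and n = M(5)[unfolded bitab_cols_def]
  have bL: "bicols m L1" "bicols m L2" and bM: "bicols m M1" "bicols m M2" using l n by simp_all
  have mu: "mu1 = shape_of m (map fst M1)" "mu2 = shape_of m (map fst M2)"
    by (simp_all add: mu1_def mu2_def index_shapes_def M(1))
  have nu: "nu1 = mu1" "nu2 = mu2" using n mu by simp_all
  have lam: "lam1 = shape_of m (map fst L1)" "lam2 = shape_of m (map fst L2)" using l by simp_all
  have tM: "tabcols m (map fst M1)" "tabcols m (map fst M2)" "tabcols m (map snd M1)" "tabcols m (map snd M2)"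
    and tL: "tabcols m (map fst L1)" "tabcols m (map fst L2)" "tabcols m (map snd L1)" "tabcols m (map snd L2)"
    using l n by simp_all
  show "is_decomposition m (bracket mu1 mu2) mu1 mu2"
    using M(2,3) nu part_length_bound[OF M(7)] by (simp add: is_decomposition_def mu)
  show "is_rat_bitableau m mu1 mu2 ST" using M(4) nu by simp
  show "standard_rat_bitableau m ord ST" by (rule M(6))
  note st = rat_std_strict[OF bM M(7,8)]
  have mon: "index_mon (t, ST) = gmono m t M1 M2" by (simp add: index_mon_def M(1))
  have neL: "I \<noteq> []" if "(I, J) \<in> set L2" for I J using tL(2) that by (force simp: tabcols_def)
  have survive: "gprod_multidegree t M1 M2 = gprod_multidegree 0 L1 L2 \<and>
      wt_total m j t M1 M2 \<le> wt_total m j 0 L1 L2" if j: "j \<le> m" for j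
  proof -
    obtain i where i': "i \<in> F" "multidegree (index_mon i) = multidegree (index_mon (t, ST))"
      "wt j (index_mon (t, ST)) \<le> wt j (index_mon i)"
      "index_mon i \<in> Poly_Mapping.keys (\<Sum>i\<in>F. of_int (a i) * peval phi (bidet_poly m i))"
      by (rule lead_survives[OF F i j])
    have k: "index_mon i \<in> Poly_Mapping.keys (gprod m 0 L1 L2)" using i'(4) sum by simp
    have "gmono m t M1 M2 \<in> Poly_Mapping.keys (gprod m t M1 M2)"
      using lead_gprod[OF bM st] by (simp add: lead_def)
    then have "multidegree (index_mon (t, ST)) = gprod_multidegree t M1 M2"
      unfolding mon by (rule gprod_multidegree[OF bM])
    moreover have "multidegree (index_mon i) = gprod_multidegree 0 L1 L2"
      by (rule gprod_multidegree[OF bL k])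
    moreover have "wt j (index_mon i) \<le> wt_total m j 0 L1 L2"
      using gprod_wt[OF bL neL j, where t = 0] k by (auto simp: deg_le_def)
    moreover have "wt j (index_mon (t, ST)) = wt_total m j t M1 M2"
      unfolding mon by (rule wt_gmono[OF bM st(2) j])
    ultimately show ?thesis using i'(2,3) by simp
  qed
  note md = multidegree_consequences[OF bM bL conjunct1[OF survive[OF le0]]]
  have size: "sum_list (shape_of m (map fst K)) = bideg K" if "tabcols m (map fst K)" for K
    by (simp add: sum_list_shape_of[OF that] bideg_def comp_def case_prod_unfold)
  show s1: "int (sum_list mu1) = int (sum_list lam1) - int t"
    unfolding mu lam size[OF tM(1)] size[OF tL(1)] using md(2) by linarith
  show s2: "int (sum_list mu2) = int (sum_list lam2) - int t"
    unfolding mu lam size[OF tM(2)] size[OF tL(2)] using md(1) by linarith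
  have rk: "r k \<in> {1..m}" if "k \<in> set [1..<Suc m]" for k
    by (rule r_range) (use that in auto)
  have fs: "fst ST = (tab_of s (map fst M1), tab_of s (map fst M2))"
    "snd ST = (tab_of s (map snd M1), tab_of s (map snd M2))"
    "fst ST0 = (tab_of s (map fst L1), tab_of s (map fst L2))"
    "snd ST0 = (tab_of s (map snd L1), tab_of s (map snd L2))"
    using n l by blast+
  have "rat_weight m (fst ST) = rat_weight m (fst ST0)"
    unfolding fs rat_weight_tab_of[OF tM(1,2)] rat_weight_tab_of[OF tL(1,2)]
    by (rule map_cong[OF refl md(3)[OF rk]])
  moreover have "rat_weight m (snd ST) = rat_weight m (snd ST0)"
    unfolding fs rat_weight_tab_of[OF tM(3,4)] rat_weight_tab_of[OF tL(3,4)]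
    by (rule map_cong[OF refl md(4)[OF rk]])
  ultimately show "bitableau_weight m ST = bitableau_weight m ST0" by (simp add: bitableau_weight_def)
  show "dominance_le (bracket mu1 mu2) (bracket lam1 lam2)"
    unfolding dominance_le_def
  proof (intro conjI ballI)
    show "sum_list (bracket mu1 mu2) = sum_list (bracket lam1 lam2)"
      using s1 s2 unfolding mu lam sum_list_bracket[OF tM(1,2)] sum_list_bracket[OF tL(1,2)] by linarith
    fix j assume "j \<in> {1..length (bracket lam1 lam2)}"
    then have j: "j \<le> m" by (simp add: lam length_bracket)
    have w: "wt_total m j u K1 K2 = u * j + ((\<Sum>x\<leftarrow>map fst K1. min j (length x)) +
        (\<Sum>x\<leftarrow>map fst K2. (length x - 1) * j + min j (m - length x)))" for u K1 K2
      by (simp add: wt_total_def comp_def case_prod_unfold)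
    have d: "(\<Sum>x\<leftarrow>map fst K. length x) = bideg K" for K
      by (simp add: bideg_def comp_def case_prod_unfold)
    have "sum_list (take j (bracket mu1 mu2)) + int (bideg M2) * int j + int t * int j = int (wt_total m j t M1 M2)"
      unfolding mu using sum_take_bracket[OF tM(1,2) j] unfolding d w by simp
    moreover have "sum_list (take j (bracket lam1 lam2)) + int (bideg L2) * int j = int (wt_total m j 0 L1 L2)"
      unfolding lam using sum_take_bracket[OF tL(1,2) j] unfolding d w by simp
    moreover have "int (bideg L2) * int j = int (bideg M2) * int j + int t * int j"
      using md(1) by (simp add: algebra_simps flip: md(1))
    moreover have "wt_total m j t M1 M2 \<le> wt_total m j 0 L1 L2" using survive[OF j] by simp
    ultimately show "sum_list (take j (bracket mu1 mu2)) \<le> sum_list (take j (bracket lam1 lam2))"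
      by linarith
  qed
qed

theorem bideterminant_expansion:
  assumes dec: "is_decomposition m lam lam1 lam2"
    and S: "is_rat_tableau m lam1 lam2 S" and T: "is_rat_tableau m lam1 lam2 T"
  shows "\<exists>(n::nat) a t ST mu mu1 mu2.
           (\<forall>i<n.
              mu i \<in> dominant_weights m \<and> is_decomposition m (mu i) (mu1 i) (mu2 i) \<and>
              is_rat_bitableau m (mu1 i) (mu2 i) (ST i) \<and>
              standard_rat_bitableau m ord (ST i) \<and>
              dominance_le (mu i) lam \<and>
              int (sum_list (mu1 i)) = int (sum_list lam1) - int (t i) \<and>
              int (sum_list (mu2 i)) = int (sum_list lam2) - int (t i) \<and>
              bitableau_weight m (ST i) = bitableau_weight m (S, T)) \<and>
           bideterminant m (S, T) =
             int_lincomb (coord_ring m) {..<n} a (\<lambda>i. d_bidet m (t i) (ST i))"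
proof -
  interpret hom: comm_ring_hom "peval phi" by (rule phi_hom)
  have lam: "lam1 \<in> partitions m" "lam2 \<in> partitions m" "lam = bracket lam1 lam2"
    using dec by (auto simp: is_decomposition_def)
  have bt: "is_rat_bitableau m lam1 lam2 (S, T)" using S T by (simp add: is_rat_bitableau_def)
  obtain L1 L2 where L: "bitab_cols lam1 lam2 (S, T) L1 L2" by (rule bitab_cols_exist[OF lam(1,2) bt])
  let ?p = "bidet_poly m (0, (S, T))"
  obtain F0 a where F0: "finite F0" "F0 \<subseteq> std_index m ord"
    "?p - (\<Sum>i\<in>F0. of_int (a i) * bidet_poly m i) \<in> monoid_ideal m"
    using standard_bideterminants_span[OF bitab_cols_poly(2)[OF L]] unfolding lincombs_def by blast
  \<comment> \<open>only indices with nonzero coefficient satisfy the conditions\<close>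
  define F where "F = {i \<in> F0. a i \<noteq> 0}"
  have F: "finite F" "F \<subseteq> std_index m ord" "\<And>i. i \<in> F \<Longrightarrow> a i \<noteq> 0"
    using F0 by (auto simp: F_def)
  let ?sum = "\<Sum>i\<in>F. of_int (a i) * bidet_poly m i"
  have "(\<Sum>i\<in>F0. of_int (a i) * bidet_poly m i) = ?sum"
    unfolding F_def by (rule sum.mono_neutral_right) (use F0 in auto)
  then have J: "?p - ?sum \<in> monoid_ideal m" using F0(3) by simp
  have int: "peval phi (of_int k) = of_int k" for k
    by (induction k rule: int_induct[where k = 0])
      (simp_all add: peval_add peval_one peval_zero hom.hom_minus)
  have sum: "(\<Sum>i\<in>F. of_int (a i) * peval phi (bidet_poly m i)) = gprod m 0 L1 L2"
    using peval_phi_ideal[OF J] bitab_cols_poly(3)[OF L, of 0]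
    by (simp add: hom.hom_minus peval_sum peval_mult int)
  obtain h where h: "bij_betw h {..<card F} F"
    using ex_bij_betw_nat_finite[OF F(1)] by (auto simp: atLeast0LessThan)
  have hF: "h i \<in> F" if "i < card F" for i using h that by (auto simp: bij_betw_def)
  define mu1 where "mu1 = (\<lambda>i. fst (index_shapes (h i)))"
  define mu2 where "mu2 = (\<lambda>i. snd (index_shapes (h i)))"
  have props: "bracket (mu1 i) (mu2 i) \<in> dominant_weights m \<and>
      is_decomposition m (bracket (mu1 i) (mu2 i)) (mu1 i) (mu2 i) \<and>
      is_rat_bitableau m (mu1 i) (mu2 i) (snd (h i)) \<and> standard_rat_bitableau m ord (snd (h i)) \<and>
      dominance_le (bracket (mu1 i) (mu2 i)) lam \<and>
      int (sum_list (mu1 i)) = int (sum_list lam1) - int (fst (h i)) \<and>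
      int (sum_list (mu2 i)) = int (sum_list lam2) - int (fst (h i)) \<and>
      bitableau_weight m (snd (h i)) = bitableau_weight m (S, T)" if i: "i < card F" for i
  proof -
    have "(fst (h i), snd (h i)) \<in> F" using hF[OF i] by simp
    note e = index_in_expansion[OF L F sum this, unfolded prod.collapse]
    note e = e[folded fun_cong[OF mu1_def, of i, simplified] fun_cong[OF mu2_def, of i, simplified]]
    have "bracket (mu1 i) (mu2 i) \<in> dominant_weights m"
      using e(1) by (intro bracket_dominant) (auto simp: is_decomposition_def)
    then show ?thesis unfolding lam(3) using e by blast
  qed
  have c: "bidet_poly m (h i) \<in> carrier (poly_ring m)"
    and d: "d_bidet m (fst (h i)) (snd (h i)) = coord_class m (bidet_poly m (h i))" if "i < card F" for i
    using index_coord_class[of "h i"] hF[OF that] F(2) by (auto simp: case_prod_unfold)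
  interpret R: cring "coord_ring m" by (rule coord_ring_cring)
  have "int_lincomb (coord_ring m) {..<card F} (a \<circ> h) (\<lambda>i. d_bidet m (fst (h i)) (snd (h i))) =
      int_lincomb (coord_ring m) {..<card F} (a \<circ> h) (\<lambda>i. coord_class m (bidet_poly m (h i)))"
    unfolding int_lincomb_def
  proof (rule R.finsum_cong'[OF refl])
    show "(\<lambda>i. [(a \<circ> h) i] \<cdot>\<^bsub>coord_ring m\<^esub> coord_class m (bidet_poly m (h i))) \<in> {..<card F} \<rightarrow> carrier (coord_ring m)"
      using c by (auto simp: coord_class_of_int intro!: coord_class_carrier poly_carrier_of_int_mult)
  qed (use d in auto)
  also have "\<dots> = coord_class m (\<Sum>i<card F. of_int ((a \<circ> h) i) * bidet_poly m (h i))"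
    by (rule int_lincomb_coord_class) (use c in auto)
  also have "(\<Sum>i<card F. of_int ((a \<circ> h) i) * bidet_poly m (h i)) = ?sum"
    using sum.reindex_bij_betw[OF h, of "\<lambda>i. of_int (a i) * bidet_poly m i"] by simp
  also have "coord_class m ?sum = bideterminant m (S, T)"
    unfolding bitab_cols_poly(5)[OF L]
    by (rule coord_class_eq[OF bitab_cols_poly(2)[OF L] int_lincomb_index(2)[OF F(1,2)], THEN iffD2, OF J, symmetric])
  finally have "bideterminant m (S, T) =
      int_lincomb (coord_ring m) {..<card F} (a \<circ> h) (\<lambda>i. d_bidet m (fst (h i)) (snd (h i)))" ..
  then show ?thesis using props
    by (intro exI[of _ "card F"] exI[of _ "a \<circ> h"] exI[of _ "\<lambda>i. fst (h i)"] exI[of _ "\<lambda>i. snd (h i)"]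
        exI[of _ "\<lambda>i. bracket (mu1 i) (mu2 i)"] exI[of _ mu1] exI[of _ mu2]) blast
qed

end

theorem theorem3p1:
  fixes m :: nat and ord :: "nat rel"
  assumes "m \<ge> 1" and "linear_order_on {1..m} ord"
  shows
    "(\<forall>lam lam1 lam2 S T.
        lam \<in> dominant_weights m \<and> is_decomposition m lam lam1 lam2 \<and>
        is_rat_tableau m lam1 lam2 S \<and> is_rat_tableau m lam1 lam2 T \<longrightarrow>
        (\<exists>(n::nat) a t ST mu mu1 mu2.
           (\<forall>i<n.
              mu i \<in> dominant_weights m \<and> is_decomposition m (mu i) (mu1 i) (mu2 i) \<and>
              is_rat_bitableau m (mu1 i) (mu2 i) (ST i) \<and>
              standard_rat_bitableau m ord (ST i) \<and>
              dominance_le (mu i) lam \<and>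
              int (sum_list (mu1 i)) = int (sum_list lam1) - int (t i) \<and>
              int (sum_list (mu2 i)) = int (sum_list lam2) - int (t i) \<and>
              bitableau_weight m (ST i) = bitableau_weight m (S, T)) \<and>
           bideterminant m (S, T) =
             int_lincomb (coord_ring m) {..<n} a (\<lambda>i. d_bidet m (t i) (ST i)))) \<and>
     is_int_basis (coord_ring m)
       {(t, ST). (\<exists>lam1\<in>partitions m. \<exists>lam2\<in>partitions m. is_rat_bitableau m lam1 lam2 ST) \<and>
                 standard_rat_bitableau m ord ST}
       (\<lambda>(t, ST). d_bidet m t ST)"
proof -
  obtain r s where "ranking m ord r s" by (rule ranking_exists[OF assms])
  then interpret ranking m ord r s .
  show ?thesis
    using bideterminant_expansion standard_bideterminants_basis unfolding std_index_def by blast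
qed

end
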